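(* There exist $\tau>0$ and a $\tau$-antiperiodic (in time) function $g=g(\xi,t)$ such that the plate problem admits at least two distinct $\tau$-antiperiodic solutions for a suitable choice of the parameters $\delta>0$, $P\in[0,\lambda_1)$ and $S>0$.
   Context: A function $w$ is called $\tau$-antiperiodic (in time) if $w(t+\tau)=-w(t)$ for all $t\in\mathbb{R}$. Domain and spaces: $\Omega=(0,\pi)\times(-\ell,\ell)\subset\mathbb{R}^2$ with $0<\ell\ll\pi$ fixed, $\xi=(x,y)\in\Omega$, and the Poisson ratio is $\sigma=0.2$. $H^2_*(\Omega)=\{U\in H^2(\Omega):U=0\text{ on }\{0,\pi\}\times[-\ell,\ell]\}$, a Hilbert space with inner product $(U,V)_{H^2_*}=\int_\Omega\big(\Delta U\Delta V-(1-\sigma)(U_{xx}V_{yy}+U_{yy}V_{xx}-2U_{xy}V_{xy})\big)$ and norm $\|\cdot\|_{H^2_*}$; $(H^2_*(\Omega))'$ is its dual, $\langle\cdot,\cdot\rangle$ the duality pairing, $(\cdot,\cdot)_{L^2}$ the inner product of $L^2(\Omega)$. $\lambda_1=\min_{0\ne v\in H^2_*(\Omega)}\|v\|_{H^2_*}^2/\|v\|_{L^2}^2$. Plate problem: $u_{tt}+\delta u_t+\Delta^2u+\big[P-S\int_\Omega u_x^2\big]u_{xx}=g(\xi,t)$ in $\Omega$, with boundary conditions $u=u_{xx}=0$ on $\{0,\pi\}\times[-\ell,\ell]$ and $u_{yy}+\sigma u_{xx}=u_{yyy}+(2-\sigma)u_{xxy}=0$ on $[0,\pi]\times\{-\ell,\ell\}$,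 where $g\in C^0(\mathbb{R},L^2(\Omega))$. Solution means weak solution on $\mathbb{R}$: $u\in C^0(\mathbb{R},H^2_*(\Omega))\cap C^1(\mathbb{R},L^2(\Omega))\cap C^2(\mathbb{R},(H^2_*(\Omega))')$ with $\langle u_{tt},v\rangle+\delta(u_t,v)_{L^2}+(u,v)_{H^2_*}+\big[S\|u_x\|_{L^2}^2-P\big](u_x,v_x)_{L^2}=(g,v)_{L^2}$ for all $t\in\mathbb{R}$ and all $v\in H^2_*(\Omega)$. *)

theory Defs
  imports "HOL-Analysis.Analysis"
begin

text \<open>
  The half-width of the plate is an explicit parameter \<open>l\<close>. Elements of the Lebesgue and Sobolev
  spaces over the plate are represented by functions on the plane; two of them are identified when
  they agree almost everywhere on the plate.
\<close>

definition Omega :: "real \<Rightarrow> (real \<times> real) set" where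
  "Omega l = {0<..<pi} \<times> {-l<..<l}"

definition sigma :: real where
  "sigma = 0.2"

definition L2 :: "real \<Rightarrow> (real \<times> real \<Rightarrow> real) set" where
  "L2 l = {U. U \<in> borel_measurable (lebesgue_on (Omega l)) \<and>
              integrable (lebesgue_on (Omega l)) (\<lambda>z. (U z)\<^sup>2)}"

definition eqL2 :: "real \<Rightarrow> (real \<times> real \<Rightarrow> real) \<Rightarrow> (real \<times> real \<Rightarrow> real) \<Rightarrow> bool" where
  "eqL2 l U V \<longleftrightarrow> (AE z in lebesgue_on (Omega l). U z = V z)"

definition innerL2 :: "real \<Rightarrow> (real \<times> real \<Rightarrow> real) \<Rightarrow> (real \<times> real \<Rightarrow> real) \<Rightarrow> real" where
  "innerL2 l U V = (\<integral>z. U z * V z \<partial>lebesgue_on (Omega l))"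

definition normL2 :: "real \<Rightarrow> (real \<times> real \<Rightarrow> real) \<Rightarrow> real" where
  "normL2 l U = sqrt (innerL2 l U U)"

definition pdx :: "(real \<times> real \<Rightarrow> real) \<Rightarrow> real \<times> real \<Rightarrow> real" where
  "pdx f = (\<lambda>(x, y). deriv (\<lambda>s. f (s, y)) x)"

definition pdy :: "(real \<times> real \<Rightarrow> real) \<Rightarrow> real \<times> real \<Rightarrow> real" where
  "pdy f = (\<lambda>(x, y). deriv (\<lambda>s. f (x, s)) y)"

primrec Ck :: "nat \<Rightarrow> (real \<times> real \<Rightarrow> real) \<Rightarrow> bool" where
  "Ck 0 f \<longleftrightarrow> continuous_on UNIV f"
| "Ck (Suc k) f \<longleftrightarrow> f differentiable_on UNIV \<and> Ck k (pdx f) \<and> Ck k (pdy f)"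

definition test_functions :: "real \<Rightarrow> (real \<times> real \<Rightarrow> real) set" where
  "test_functions l =
     {f. (\<forall>k. Ck k f) \<and> compact (closure {z. f z \<noteq> 0}) \<and> closure {z. f z \<noteq> 0} \<subseteq> Omega l}"

definition is_weak_deriv ::
  "real \<Rightarrow> nat \<Rightarrow> nat \<Rightarrow> (real \<times> real \<Rightarrow> real) \<Rightarrow> (real \<times> real \<Rightarrow> real) \<Rightarrow> bool" where
  "is_weak_deriv l i j U V \<longleftrightarrow> V \<in> L2 l \<and>
     (\<forall>f \<in> test_functions l.
        innerL2 l U ((pdx ^^ i) ((pdy ^^ j) f)) = (-1) ^ (i + j) * innerL2 l V f)"

text \<open>
  A weak derivative is unique up to a null set, so the inner products below do not depend on the
  representative that is chosen here.
\<close>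

definition weak_deriv :: "real \<Rightarrow> nat \<Rightarrow> nat \<Rightarrow> (real \<times> real \<Rightarrow> real) \<Rightarrow> real \<times> real \<Rightarrow> real" where
  "weak_deriv l i j U = (SOME V. is_weak_deriv l i j U V)"

definition H2 :: "real \<Rightarrow> (real \<times> real \<Rightarrow> real) set" where
  "H2 l = {U \<in> L2 l. \<forall>i j. i + j \<le> 2 \<longrightarrow> (\<exists>V. is_weak_deriv l i j U V)}"

text \<open>
  In dimension two, elements of \<open>H2\<close> are continuous up to the boundary; the condition on the short
  edges is a pointwise condition on the continuous representative.
\<close>

definition H2star :: "real \<Rightarrow> (real \<times> real \<Rightarrow> real) set" where
  "H2star l = {U \<in> H2 l. \<exists>W. continuous_on ({0..pi} \<times> {-l..l}) W \<and> eqL2 l U W \<and>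
                 (\<forall>z \<in> {0, pi} \<times> {-l..l}. W z = 0)}"

definition innerH2star :: "real \<Rightarrow> (real \<times> real \<Rightarrow> real) \<Rightarrow> (real \<times> real \<Rightarrow> real) \<Rightarrow> real" where
  "innerH2star l U V =
    (let Uxx = weak_deriv l 2 0 U; Uxy = weak_deriv l 1 1 U; Uyy = weak_deriv l 0 2 U;
         Vxx = weak_deriv l 2 0 V; Vxy = weak_deriv l 1 1 V; Vyy = weak_deriv l 0 2 V
     in \<integral>z. (Uxx z + Uyy z) * (Vxx z + Vyy z)
            - (1 - sigma) * (Uxx z * Vyy z + Uyy z * Vxx z - 2 * Uxy z * Vxy z)
          \<partial>lebesgue_on (Omega l))"

definition normH2star :: "real \<Rightarrow> (real \<times> real \<Rightarrow> real) \<Rightarrow> real" where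
  "normH2star l U = sqrt (innerH2star l U U)"

text \<open>The infimum is attained, so it is the minimum of the Rayleigh quotient.\<close>

definition lambda1 :: "real \<Rightarrow> real" where
  "lambda1 l =
     Inf {(normH2star l v)\<^sup>2 / (normL2 l v)\<^sup>2 |v. v \<in> H2star l \<and> \<not> eqL2 l v (\<lambda>_. 0)}"

text \<open>
  Boundedness forces a functional to respect almost-everywhere equality. Only
  its values on \<open>H2star\<close> matter.
\<close>

definition dualH2star :: "real \<Rightarrow> ((real \<times> real \<Rightarrow> real) \<Rightarrow> real) set" where
  "dualH2star l =
     {F. (\<forall>U \<in> H2star l. \<forall>V \<in> H2star l. \<forall>a b.
            F (\<lambda>z. a * U z + b * V z) = a * F U + b * F V) \<and>
         (\<exists>C. \<forall>V \<in> H2star l. \<bar>F V\<bar> \<le> C * normH2star l V)}"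

definition norm_dual :: "real \<Rightarrow> ((real \<times> real \<Rightarrow> real) \<Rightarrow> real) \<Rightarrow> real" where
  "norm_dual l F = (SUP V \<in> {V \<in> H2star l. normH2star l V \<le> 1}. \<bar>F V\<bar>)"

text \<open>
  The type variable covers both functions on the plate and functionals on such functions, so that
  the \<open>L2\<close>, \<open>H2star\<close> and dual norms can all be used for \<open>N\<close>.
\<close>

definition cont_wrt :: "(('a \<Rightarrow> real) \<Rightarrow> real) \<Rightarrow> (real \<Rightarrow> 'a \<Rightarrow> real) \<Rightarrow> bool" where
  "cont_wrt N w \<longleftrightarrow> (\<forall>t. ((\<lambda>s. N (\<lambda>a. w s a - w t a)) \<longlongrightarrow> 0) (at t))"

definition deriv_wrt ::
  "(('a \<Rightarrow> real) \<Rightarrow> real) \<Rightarrow> (real \<Rightarrow> 'a \<Rightarrow> real) \<Rightarrow> (real \<Rightarrow> 'a \<Rightarrow> real) \<Rightarrow> bool" where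
  "deriv_wrt N w w' \<longleftrightarrow>
     (\<forall>t. ((\<lambda>h. N (\<lambda>a. (w (t + h) a - w t a) / h - w' t a)) \<longlongrightarrow> 0) (at 0))"

definition C0_L2 :: "real \<Rightarrow> (real \<Rightarrow> real \<times> real \<Rightarrow> real) \<Rightarrow> bool" where
  "C0_L2 l g \<longleftrightarrow> (\<forall>t. g t \<in> L2 l) \<and> cont_wrt (normL2 l) g"

definition antiperiodic :: "real \<Rightarrow> real \<Rightarrow> (real \<Rightarrow> real \<times> real \<Rightarrow> real) \<Rightarrow> bool" where
  "antiperiodic l \<tau> w \<longleftrightarrow> (\<forall>t. eqL2 l (w (t + \<tau>)) (\<lambda>z. - w t z))"

text \<open>
  The second time derivative is taken in the dual, into which \<open>L2\<close> is embedded by \<open>innerL2\<close>.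
\<close>

definition weak_solution ::
  "real \<Rightarrow> real \<Rightarrow> real \<Rightarrow> real \<Rightarrow> (real \<Rightarrow> real \<times> real \<Rightarrow> real) \<Rightarrow>
   (real \<Rightarrow> real \<times> real \<Rightarrow> real) \<Rightarrow> bool" where
  "weak_solution l \<delta> P S g u \<longleftrightarrow>
     (\<forall>t. u t \<in> H2star l) \<and> cont_wrt (normH2star l) u \<and>
     (\<exists>ut utt.
        C0_L2 l ut \<and> deriv_wrt (normL2 l) u ut \<and>
        (\<forall>t. utt t \<in> dualH2star l) \<and> cont_wrt (norm_dual l) utt \<and>
        deriv_wrt (norm_dual l) (\<lambda>t. innerL2 l (ut t)) utt \<and>
        (\<forall>t. \<forall>v \<in> H2star l.
           utt t v + \<delta> * innerL2 l (ut t) v + innerH2star l (u t) v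
           + (S * (normL2 l (weak_deriv l 1 0 (u t)))\<^sup>2 - P)
             * innerL2 l (weak_deriv l 1 0 (u t)) (weak_deriv l 1 0 v)
           = innerL2 l (g t) v))"

end

theory Submission imports Defs begin

text \<open>
  Two solutions are constructed in the form \<open>p + d\<close> and \<open>p - d\<close>. If \<open>p_x\<close> and \<open>d_x\<close> are orthogonal,
  both have the same stretching energy \<open>N = \<parallel>p_x\<parallel>\<^sup>2 + \<parallel>d_x\<parallel>\<^sup>2\<close>. With \<open>P = 0\<close> and \<open>S = 1\<close> they solve the
  plate problem for the same force if and only if the difference satisfies the homogeneous linear equation
  \<open>d_tt + \<delta> d_t + \<Delta>\<^sup>2 d - N d_xx = 0\<close>; the equation for \<open>p\<close> then serves as the definition of the force.

  Let \<open>d = d(t) e1\<close>, where \<open>e1 = sin x \<psi>(y)\<close> is an eigenfunction of the plate with eigenvalue \<open>\<Lambda>\<close>,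
  normalised by \<open>\<parallel>(e1)_x\<parallel> = 1\<close>. The equation becomes the damped Hill equation \<open>d'' + \<delta> d' + (\<Lambda> + N) d = 0\<close>,
  in which the oscillating coefficient \<open>N\<close> can compensate for the damping. It is solved backwards: an
  explicit antiperiodic \<open>d\<close> is chosen so that \<open>N\<close> can be read off as a smooth function
  (\<open>damped_profile\<close>), and \<open>p\<close> is chosen to supply the missing energy \<open>N - d\<^sup>2 > 0\<close>. As one antiperiodic
  coefficient would have zeros, \<open>p\<close> uses two further modes and rotates in their plane by half a turn
  (\<open>time_profiles\<close>).

  What remains is to make the modes and the function spaces explicit. The eigenfunctions come from
  a transcendental equation (\<open>exists_mode\<close>). That they are eigenfunctions in the weak sense is
  Green's formula for arbitrary elements of \<open>H2star\<close>, which is obtained without trace theory from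
  smooth cutoffs (\<open>H2star_parts\<close>, \<open>mode_separated\<close>). The bending form of an explicit function can be
  evaluated because weak derivatives are unique (\<open>fundamental_lemma\<close>). Finally, a Poincare inequality
  (\<open>H2star_coercive\<close>) shows that \<open>lambda1\<close> is positive, so that \<open>P = 0\<close> is admissible, and that elements
  of \<open>L2\<close> act on \<open>H2star\<close> as bounded functionals.
\<close>

section \<open>Smooth functions of one variable\<close>

text \<open>
  Infinitely many derivatives on the whole line, in the same recursive form as \<open>Ck\<close> in the plane, so
  that a product \<open>a(x) b(y)\<close> of smooth factors is seen to be a smooth function of two variables.
\<close>

primrec Dk :: "nat \<Rightarrow> (real \<Rightarrow> real) \<Rightarrow> bool" where
  "Dk 0 f \<longleftrightarrow> continuous_on UNIV f"
| "Dk (Suc k) f \<longleftrightarrow> (\<forall>x. (f has_real_derivative deriv f x) (at x)) \<and> Dk k (deriv f)"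

definition smooth :: "(real \<Rightarrow> real) \<Rightarrow> bool" where
  "smooth f \<longleftrightarrow> (\<forall>k. Dk k f)"

lemma Dk_SucI:
  assumes "\<And>x. (f has_real_derivative f' x) (at x)" and "Dk k f'"
  shows "Dk (Suc k) f"
proof -
  have "deriv f = f'"
    using assms(1) by (intro ext DERIV_imp_deriv)
  with assms show ?thesis by simp
qed

lemma Dk_Suc_imp: "Dk (Suc k) f \<Longrightarrow> Dk k f"
proof (induction k arbitrary: f)
  case 0
  then show ?case by (auto intro: DERIV_continuous_on)
qed auto

lemma smooth_DERIV: "smooth f \<Longrightarrow> (f has_real_derivative deriv f x) (at x)"
  unfolding smooth_def using Dk.simps(2) by blast

lemma smooth_deriv: "smooth f \<Longrightarrow> smooth (deriv f)"
  unfolding smooth_def using Dk.simps(2) by blast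

lemma smooth_continuous: "smooth f \<Longrightarrow> continuous_on S f"
  unfolding smooth_def using Dk.simps(1) continuous_on_subset by blast

lemma smoothI:
  assumes "\<And>x. (f has_real_derivative f' x) (at x)" and "smooth f'"
  shows "smooth f"
  unfolding smooth_def
proof
  fix k
  have "Dk (Suc k) f"
    using Dk_SucI[OF assms(1)] assms(2) unfolding smooth_def by blast
  then show "Dk k f" by (rule Dk_Suc_imp)
qed

lemma Dk_const [simp]: "Dk k (\<lambda>x. c)"
  by (induction k arbitrary: c) simp_all

lemma smooth_const [simp]: "smooth (\<lambda>x. c)"
  by (simp add: smooth_def)

lemma smooth_ident [simp]: "smooth (\<lambda>x. x)"
  by (rule smoothI[of _ "\<lambda>_. 1"]) auto

lemma Dk_add: "Dk k f \<Longrightarrow> Dk k g \<Longrightarrow> Dk k (\<lambda>x. f x + g x)"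
proof (induction k arbitrary: f g)
  case 0
  then show ?case by (auto intro: continuous_intros)
next
  case (Suc k)
  then show ?case
    by (intro Dk_SucI[of _ "\<lambda>x. deriv f x + deriv g x"]) (auto intro!: derivative_eq_intros)
qed

lemma Dk_mult: "Dk k f \<Longrightarrow> Dk k g \<Longrightarrow> Dk k (\<lambda>x. f x * g x)"
proof (induction k arbitrary: f g)
  case 0
  then show ?case by (auto intro: continuous_intros)
next
  case (Suc k)
  have fg: "Dk k f" "Dk k g"
    using Suc.prems Dk_Suc_imp by blast+
  have "(f has_real_derivative deriv f x) (at x)" "(g has_real_derivative deriv g x) (at x)" for x
    using Suc.prems by auto
  then have "((\<lambda>x. f x * g x) has_real_derivative deriv f x * g x + f x * deriv g x) (at x)" for x
    by (auto intro!: derivative_eq_intros)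
  moreover have "Dk k (\<lambda>x. deriv f x * g x + f x * deriv g x)"
    using Suc fg by (intro Dk_add Suc.IH) auto
  ultimately show ?case by (rule Dk_SucI)
qed

lemma Dk_inverse:
  "Dk k f \<Longrightarrow> (\<And>x. f x \<noteq> 0) \<Longrightarrow> Dk k (\<lambda>x. inverse (f x))"
proof (induction k)
  case 0
  then show ?case by (auto intro: continuous_intros)
next
  case (Suc k)
  have i: "Dk k (\<lambda>x. inverse (f x))"
    using Suc Dk_Suc_imp by blast
  have "((\<lambda>x. inverse (f x)) has_real_derivative
          (-1) * (deriv f x * (inverse (f x) * inverse (f x)))) (at x)" for x
    using Suc.prems by (auto intro!: derivative_eq_intros)
  moreover have "Dk k (\<lambda>x. (-1) * (deriv f x * (inverse (f x) * inverse (f x))))"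
    using Suc.prems by (intro Dk_mult i) auto
  ultimately show ?case by (rule Dk_SucI)
qed

lemma Dk_affine: "Dk k f \<Longrightarrow> Dk k (\<lambda>x. f (a * x + b))"
proof (induction k arbitrary: f)
  case 0
  then have "continuous_on UNIV (f \<circ> (\<lambda>x. a * x + b))"
    by (intro continuous_on_compose) (auto intro!: continuous_intros intro: continuous_on_subset)
  then show ?case by (simp add: o_def)
next
  case (Suc k)
  have "((\<lambda>x. f (a * x + b)) has_real_derivative deriv f (a * x + b) * a) (at x)" for x
  proof -
    have "(f has_real_derivative deriv f (a * x + b)) (at (a * x + b))"
      using Suc.prems by simp
    moreover have "((\<lambda>x. a * x + b) has_real_derivative a) (at x)"
      by (auto intro!: derivative_eq_intros)
    ultimately show ?thesis
      by (rule DERIV_chain2[where f = f and g = "\<lambda>x. a * x + b"])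
  qed
  moreover have "Dk k (\<lambda>x. deriv f (a * x + b) * a)"
    using Suc.prems Suc.IH[of "deriv f"] by (intro Dk_mult) auto
  ultimately show ?case by (rule Dk_SucI)
qed

lemma smooth_add [intro]: "smooth f \<Longrightarrow> smooth g \<Longrightarrow> smooth (\<lambda>x. f x + g x)"
  by (simp add: smooth_def Dk_add)

lemma smooth_mult [intro]: "smooth f \<Longrightarrow> smooth g \<Longrightarrow> smooth (\<lambda>x. f x * g x)"
  by (simp add: smooth_def Dk_mult)

lemma smooth_diff [intro]: "smooth f \<Longrightarrow> smooth g \<Longrightarrow> smooth (\<lambda>x. f x - g x)"
  using smooth_add[of f "\<lambda>x. (-1) * g x"] smooth_mult[of "\<lambda>_. -1" g] by simp

lemma smooth_power [intro]: "smooth (\<lambda>x. x ^ n)"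
  by (induction n) auto

lemma smooth_exp: "smooth (\<lambda>x. exp (a * x))"
proof -
  have "Dk k (\<lambda>x. exp (a * x))" for k
  proof (induction k)
    case 0
    then show ?case by (auto intro!: continuous_intros)
  next
    case (Suc k)
    then show ?case
      by (intro Dk_SucI[of _ "\<lambda>x. a * exp (a * x)"] Dk_mult)
         (auto intro!: derivative_eq_intros)
  qed
  then show ?thesis by (simp add: smooth_def)
qed

lemma smooth_cosh: "smooth (\<lambda>x. cosh (a * x))"
  using smooth_mult[OF smooth_const[of "1/2"]
      smooth_add[OF smooth_exp[of a] smooth_exp[of "-a"]]]
  by (simp add: cosh_def)

lemma smooth_sin_cos: "smooth (\<lambda>x. a * sin (m * x) + b * cos (m * x))"
proof -
  have "Dk k (\<lambda>x. a * sin (m * x) + b * cos (m * x))" for k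
  proof (induction k arbitrary: a b)
    case 0
    then show ?case by (auto intro!: continuous_intros)
  next
    case (Suc k)
    show ?case
      by (rule Dk_SucI[OF _ Suc[of "-(b*m)" "a*m"]]) (auto intro!: derivative_eq_intros)
  qed
  then show ?thesis by (simp add: smooth_def)
qed

lemma smooth_sin: "smooth (\<lambda>x. sin (m * x))"
  using smooth_sin_cos[of 1 m 0] by simp

lemma smooth_cos: "smooth (\<lambda>x. cos (m * x))"
  using smooth_sin_cos[of 0 m 1] by simp


section \<open>Smooth cutoff functions\<close>

text \<open>
  The classical functions that are smooth but not analytic at the origin. Allowing an arbitrary
  polynomial factor makes the family closed under differentiation, and smoothness follows by induction.
\<close>

definition flat :: "real poly \<Rightarrow> real \<Rightarrow> real" where
  "flat p x = (if x > 0 then poly p (1 / x) * exp (- (1 / x)) else 0)"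

lemma poly_exp_tendsto_0: "((\<lambda>y. poly p y * exp (- y)) \<longlongrightarrow> (0::real)) at_top"
proof -
  have "((\<lambda>y. \<Sum>i\<le>degree p. coeff p i * (y ^ i / exp y)) \<longlongrightarrow> (\<Sum>i\<le>degree p. coeff p i * 0)) at_top"
    by (intro tendsto_intros tendsto_power_div_exp_0)
  then show ?thesis
    by (simp add: poly_altdef exp_minus sum_divide_distrib divide_inverse[symmetric])
qed

lemma flat_tendsto_0: "(flat p \<longlongrightarrow> 0) (at_right 0)"
proof -
  have "((\<lambda>x. poly p (inverse x) * exp (- inverse x)) \<longlongrightarrow> 0) (at_right 0)"
    by (rule filterlim_compose[OF poly_exp_tendsto_0 filterlim_inverse_at_top_right])
  moreover have "\<forall>\<^sub>F x in at_right 0. poly p (inverse x) * exp (- inverse x) = flat p x"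
    by (auto simp: eventually_at_filter flat_def inverse_eq_divide)
  ultimately show ?thesis
    using tendsto_cong by fastforce
qed

lemma flat_DERIV:
  "(flat p has_real_derivative flat ([:0,0,1:] * (p - pderiv p)) x) (at x)"
proof -
  consider "x > 0" | "x < 0" | "x = 0" by linarith
  then show ?thesis
  proof cases
    case 1
    have "((\<lambda>x. poly p (1 / x) * exp (- (1 / x))) has_real_derivative
            flat ([:0,0,1:] * (p - pderiv p)) x) (at x)"
      using 1 by (auto intro!: derivative_eq_intros simp: flat_def field_simps power2_eq_square)
    moreover have "\<forall>\<^sub>F y in nhds x. poly p (1 / y) * exp (- (1 / y)) = flat p y"
      using eventually_nhds_in_open[of "{0<..}" x] 1
      by (auto elim!: eventually_mono simp: flat_def)
    ultimately show ?thesis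
      by (subst (asm) DERIV_cong_ev[OF refl _ refl])
  next
    case 2
    have "\<forall>\<^sub>F y in nhds x. 0 = flat p y"
      using eventually_nhds_in_open[of "{..<0}" x] 2
      by (auto elim!: eventually_mono simp: flat_def)
    then have "(flat p has_real_derivative 0) (at x)"
      using DERIV_cong_ev[where x = x and f = "\<lambda>_. 0" and g = "flat p" and u = 0] by simp
    with 2 show ?thesis by (simp add: flat_def)
  next
    case 3
    \<comment> \<open>Dividing by \<open>h\<close> only changes the polynomial factor.\<close>
    have "((\<lambda>h. flat p h / h) \<longlongrightarrow> 0) (at_right 0)"
    proof -
      have "\<forall>\<^sub>F h in at_right 0. flat (pCons 0 p) h = flat p h / h"
        by (auto simp: eventually_at_filter flat_def)
      with flat_tendsto_0[of "pCons 0 p"] show ?thesis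
        using tendsto_cong by fastforce
    qed
    moreover have "((\<lambda>h. flat p h / h) \<longlongrightarrow> 0) (at_left 0)"
    proof -
      have "\<forall>\<^sub>F h in at_left 0. 0 = flat p h / h"
        by (auto simp: eventually_at_filter flat_def)
      then show ?thesis
        using tendsto_cong[of "\<lambda>_. 0" "\<lambda>h. flat p h / h" "at_left 0" 0] by simp
    qed
    ultimately have "((\<lambda>h. flat p h / h) \<longlongrightarrow> 0) (at 0)"
      by (rule filterlim_split_at[rotated])
    with 3 show ?thesis
      by (simp add: DERIV_def flat_def)
  qed
qed

lemma smooth_flat: "smooth (flat p)"
proof -
  have "Dk k (flat p)" for k
  proof (induction k arbitrary: p)
    case 0
    then show ?case
      using flat_DERIV by (auto intro: DERIV_continuous_on)
  next
    case (Suc k)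
    show ?case by (rule Dk_SucI[OF flat_DERIV Suc])
  qed
  then show ?thesis by (simp add: smooth_def)
qed

text \<open>
  A smooth transition from \<open>0\<close> on the negative axis to \<open>1\<close> to the right of \<open>1\<close>; the second summand of
  the denominator is \<open>flat 1 (1 - x)\<close>.
\<close>

definition step :: "real \<Rightarrow> real" where
  "step x = flat 1 x * inverse (flat 1 x + flat 1 ((-1) * x + 1))"

lemma flat_1_pos: "x > 0 \<Longrightarrow> flat 1 x > 0" and flat_1_nonneg: "flat 1 x \<ge> 0"
  by (auto simp: flat_def)

lemma step_denominator_pos: "flat 1 x + flat 1 ((-1) * x + 1) > 0"
  using flat_1_pos[of x] flat_1_pos[of "(-1) * x + 1"] flat_1_nonneg[of x]
    flat_1_nonneg[of "(-1) * x + 1"]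
  by (cases "x > 0") linarith+

lemma smooth_step: "smooth step"
proof -
  have "smooth (\<lambda>x. inverse (flat 1 x + flat 1 ((-1) * x + 1)))"
    unfolding smooth_def
  proof
    fix k
    have "Dk k (flat 1)"
      using smooth_flat by (simp add: smooth_def)
    then have "Dk k (\<lambda>x. flat 1 x + flat 1 ((-1) * x + 1))"
      by (intro Dk_add Dk_affine[of k "flat 1" "-1" 1])
    then show "Dk k (\<lambda>x. inverse (flat 1 x + flat 1 ((-1) * x + 1)))"
      by (rule Dk_inverse) (metis less_irrefl step_denominator_pos)
  qed
  then show ?thesis
    unfolding step_def by (intro smooth_mult smooth_flat)
qed

lemma step_0: "x \<le> 0 \<Longrightarrow> step x = 0" and step_1: "x \<ge> 1 \<Longrightarrow> step x = 1"
  by (auto simp: step_def flat_def)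

lemma step_bounds: "0 \<le> step x" "step x \<le> 1"
  using step_denominator_pos[of x] flat_1_nonneg[of x] flat_1_nonneg[of "(-1) * x + 1"]
  unfolding step_def divide_inverse[symmetric] by simp_all

lemma deriv_step_0: "x < 0 \<or> x > 1 \<Longrightarrow> deriv step x = 0"
proof -
  assume "x < 0 \<or> x > 1"
  then have "\<exists>c S. open S \<and> x \<in> S \<and> (\<forall>y\<in>S. step y = c)"
  proof
    assume "x < 0"
    then show ?thesis by (intro exI[of _ 0] exI[of _ "{..<0}"]) (auto simp: step_0)
  next
    assume "x > 1"
    then show ?thesis by (intro exI[of _ 1] exI[of _ "{1<..}"]) (auto simp: step_1)
  qed
  then obtain c S where S: "open S" "x \<in> S" "\<And>y. y \<in> S \<Longrightarrow> step y = c"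
    by blast
  have "\<forall>\<^sub>F y in nhds x. c = step y"
    using eventually_nhds_in_open[OF S(1,2)] S(3) by (auto elim!: eventually_mono)
  then have "(step has_real_derivative 0) (at x)"
    using DERIV_cong_ev[where x = x and f = "\<lambda>_. c" and g = step and u = 0] by simp
  then show ?thesis by (rule DERIV_imp_deriv)
qed

lemma deriv_step_bounded: obtains M where "M > 0" "\<And>x. \<bar>deriv step x\<bar> \<le> M"
proof -
  have "bounded (deriv step ` {0..1})"
    by (intro compact_imp_bounded compact_continuous_image smooth_continuous smooth_deriv
        smooth_step compact_Icc)
  then obtain M where M: "M > 0" "\<And>x. x \<in> {0..1} \<Longrightarrow> \<bar>deriv step x\<bar> \<le> M"
    unfolding bounded_pos by auto
  have "\<bar>deriv step x\<bar> \<le> M" for x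
    using M deriv_step_0[of x] by (cases "x \<in> {0..1}") auto
  with M(1) show ?thesis by (rule that)
qed

text \<open>
  With \<open>h = 1 / (k + 1)\<close>, this equals \<open>1\<close> on \<open>[lo + 2 h, hi - 2 h]\<close> and vanishes outside
  \<open>[lo + h, hi - h]\<close>, so it is supported inside the open interval.
\<close>

definition cutoff :: "real \<Rightarrow> real \<Rightarrow> nat \<Rightarrow> real \<Rightarrow> real" where
  "cutoff lo hi k x = step (real (Suc k) * (x - lo) - 1) * step (real (Suc k) * (hi - x) - 1)"

text \<open>
  The interval \<open>{c..d}\<close> may be empty, so that a cutoff with a small index, which is identically zero,
  is included.
\<close>

definition compact_in :: "real \<Rightarrow> real \<Rightarrow> (real \<Rightarrow> real) \<Rightarrow> bool" where
  "compact_in lo hi a \<longleftrightarrow> (\<exists>c d. lo < c \<and> d < hi \<and> (\<forall>x. x \<notin> {c..d} \<longrightarrow> a x = 0))"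

lemma smooth_cutoff: "smooth (cutoff lo hi k)"
proof -
  have "smooth (\<lambda>x. step (a * x + b))" for a b
    using smooth_step Dk_affine[of _ step a b] by (simp add: smooth_def)
  note this[of "real (Suc k)" "- real (Suc k) * lo - 1"]
    this[of "- real (Suc k)" "real (Suc k) * hi - 1"]
  then show ?thesis
    unfolding cutoff_def by (intro smooth_mult) (simp_all add: algebra_simps)
qed

lemma compact_in_cutoff: "compact_in lo hi (\<lambda>x. a x * cutoff lo hi k x)"
  unfolding compact_in_def
proof (intro exI conjI allI impI)
  show "lo < lo + 1 / real (Suc k)" "hi - 1 / real (Suc k) < hi"
    by (simp_all add: field_simps del: of_nat_Suc)
  fix x assume "x \<notin> {lo + 1 / real (Suc k)..hi - 1 / real (Suc k)}"
  then have "real (Suc k) * (x - lo) - 1 \<le> 0 \<or> real (Suc k) * (hi - x) - 1 \<le> 0"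
    by (auto simp: field_simps not_le simp del: of_nat_Suc)
  then show "a x * cutoff lo hi k x = 0"
    by (auto simp: cutoff_def step_0)
qed

lemma cutoff_bounds: "0 \<le> cutoff lo hi k x" "cutoff lo hi k x \<le> 1"
  using step_bounds by (auto simp: cutoff_def intro!: mult_le_one)

lemma eventually_far:
  fixes x lo :: real
  assumes "lo < x"
  shows "\<forall>\<^sub>F k in sequentially. real (Suc k) * (x - lo) - 1 > 1"
proof -
  obtain N :: nat where N: "real N * (x - lo) > 2"
    using assms reals_Archimedean3[of "x - lo"] by auto
  have "real (Suc k) * (x - lo) - 1 > 1" if "N \<le> k" for k
  proof -
    have "real N * (x - lo) \<le> real (Suc k) * (x - lo)"
      using that assms by (intro mult_right_mono) auto
    with N show ?thesis by linarith
  qed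
  then show ?thesis
    unfolding eventually_sequentially by blast
qed

lemma cutoff_tendsto:
  assumes "lo < x" "x < hi"
  shows "(\<lambda>k. cutoff lo hi k x) \<longlonglongrightarrow> 1"
proof (rule tendsto_eventually)
  have "\<forall>\<^sub>F k in sequentially. real (Suc k) * (hi - x) - 1 > 1"
    using eventually_far[of "-hi" "-x"] assms by simp
  with eventually_far[OF assms(1)] show "\<forall>\<^sub>F k in sequentially. cutoff lo hi k x = 1"
    by eventually_elim (simp add: cutoff_def step_1)
qed

lemma deriv_cutoff:
  "deriv (cutoff lo hi k) x = real (Suc k) *
     (deriv step (real (Suc k) * (x - lo) - 1) * step (real (Suc k) * (hi - x) - 1)
      - step (real (Suc k) * (x - lo) - 1) * deriv step (real (Suc k) * (hi - x) - 1))"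
proof (rule DERIV_imp_deriv)
  define K where "K = real (Suc k)"
  have "((\<lambda>x. step (K * (x - lo) - 1)) has_real_derivative deriv step (K * (x - lo) - 1) * K) (at x)"
    by (rule DERIV_chain2[OF smooth_DERIV[OF smooth_step]]) (auto intro!: derivative_eq_intros)
  moreover have "((\<lambda>x. step (K * (hi - x) - 1)) has_real_derivative
                   deriv step (K * (hi - x) - 1) * (- K)) (at x)"
    by (rule DERIV_chain2[OF smooth_DERIV[OF smooth_step]]) (auto intro!: derivative_eq_intros)
  ultimately have "((\<lambda>x. step (K * (x - lo) - 1) * step (K * (hi - x) - 1)) has_real_derivative
      deriv step (K * (x - lo) - 1) * K * step (K * (hi - x) - 1)
      + deriv step (K * (hi - x) - 1) * (- K) * step (K * (x - lo) - 1)) (at x)"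
    by (rule DERIV_mult)
  then show "(cutoff lo hi k has_real_derivative real (Suc k) *
     (deriv step (real (Suc k) * (x - lo) - 1) * step (real (Suc k) * (hi - x) - 1)
      - step (real (Suc k) * (x - lo) - 1) * deriv step (real (Suc k) * (hi - x) - 1))) (at x)"
    unfolding K_def[symmetric] cutoff_def[abs_def] by (simp add: algebra_simps)
qed

lemma deriv_cutoff_eventually_0:
  assumes "lo < x" "x < hi"
  shows "\<forall>\<^sub>F k in sequentially. deriv (cutoff lo hi k) x = 0"
proof -
  have "\<forall>\<^sub>F k in sequentially. real (Suc k) * (hi - x) - 1 > 1"
    using eventually_far[of "-hi" "-x"] assms by simp
  with eventually_far[OF assms(1)] show ?thesis
    by eventually_elim (simp add: deriv_cutoff deriv_step_0)
qed

lemma deriv_cutoff_strip: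
  "x \<notin> {..lo + 2 / real (Suc k)} \<union> {hi - 2 / real (Suc k)..} \<Longrightarrow> deriv (cutoff lo hi k) x = 0"
  by (subst deriv_cutoff) (simp add: deriv_step_0 field_simps not_le del: of_nat_Suc)

lemma deriv_cutoff_bound:
  obtains M where "M > 0" "\<And>lo hi k x. \<bar>deriv (cutoff lo hi k) x\<bar> \<le> M * real (Suc k)"
proof -
  obtain M where M: "M > 0" "\<And>x. \<bar>deriv step x\<bar> \<le> M"
    using deriv_step_bounded by blast
  have "\<bar>deriv (cutoff lo hi k) x\<bar> \<le> (M + M) * real (Suc k)" for lo hi k x
  proof -
    have p: "\<bar>deriv step u * step v\<bar> \<le> M * 1" for u v
      unfolding abs_mult using M step_bounds[of v] by (intro mult_mono) (auto intro: less_imp_le)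
    have "\<bar>deriv step u * step v - step u * deriv step v\<bar> \<le> M + M" for u v
      using p[of u v] p[of v u] by (simp add: mult.commute abs_le_iff)
    then show ?thesis
      unfolding deriv_cutoff abs_mult by (simp add: mult.commute)
  qed
  with M(1) show ?thesis by (intro that[of "M + M"]) auto
qed

lemma cutoff_product_DERIV:
  assumes "smooth a"
  shows "((\<lambda>x. a x * cutoff lo hi k x) has_real_derivative
           deriv a x * cutoff lo hi k x + a x * deriv (cutoff lo hi k) x) (at x)"
  using smooth_DERIV[OF assms, of x] smooth_DERIV[OF smooth_cutoff, of lo hi k x]
  by (auto intro!: derivative_eq_intros)

lemma smooth_bounded_on:
  assumes "smooth a"
  obtains C where "C > 0" "\<And>x. x \<in> {lo..hi} \<Longrightarrow> \<bar>a x\<bar> \<le> C"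
proof -
  have "bounded (a ` {lo..hi})"
    by (intro compact_imp_bounded compact_continuous_image smooth_continuous assms compact_Icc)
  then show ?thesis
    unfolding bounded_pos using that by auto
qed

text \<open>
  The slope of the cutoff is of order \<open>k\<close>, but only at distance of order \<open>1 / k\<close> from an end, where a
  function that vanishes at the end is itself of order \<open>1 / k\<close>. This is why no boundary term survives
  in an integration by parts against such a function.
\<close>

lemma cutoff_product_bounded:
  assumes "smooth a" "a lo = 0" "a hi = 0"
  obtains C where "C > 0" "\<And>k x. x \<in> {lo..hi} \<Longrightarrow> \<bar>a x * deriv (cutoff lo hi k) x\<bar> \<le> C"
proof -
  obtain L where L: "L > 0" "\<And>x. x \<in> {lo..hi} \<Longrightarrow> \<bar>deriv a x\<bar> \<le> L"
    using smooth_bounded_on[OF smooth_deriv[OF assms(1)]] by blast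
  obtain M where M: "M > 0" "\<And>lo hi k x. \<bar>deriv (cutoff lo hi k) x\<bar> \<le> M * real (Suc k)"
    using deriv_cutoff_bound by blast
  have lip: "\<bar>a u - a v\<bar> \<le> L * \<bar>u - v\<bar>" if "u \<in> {lo..hi}" "v \<in> {lo..hi}" for u v
  proof -
    have "norm (a u - a v) \<le> L * norm (u - v)"
    proof (rule field_differentiable_bound[OF convex_real_interval(5)[of lo hi]])
      show "(a has_field_derivative deriv a z) (at z within {lo..hi})" for z
        by (rule has_field_derivative_at_within[OF smooth_DERIV[OF assms(1)]])
    qed (use that L in auto)
    then show ?thesis by simp
  qed
  have "\<bar>a x * deriv (cutoff lo hi k) x\<bar> \<le> 2 * L * M" if x: "x \<in> {lo..hi}" for x k
  proof (cases "x \<in> {..lo + 2 / real (Suc k)} \<union> {hi - 2 / real (Suc k)..}")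
    case False
    then show ?thesis using L M deriv_cutoff_strip by simp
  next
    case True
    then have "\<bar>x - lo\<bar> \<le> 2 / real (Suc k) \<or> \<bar>x - hi\<bar> \<le> 2 / real (Suc k)"
      using x by auto
    then have "\<bar>a x\<bar> \<le> L * (2 / real (Suc k))"
      using lip[of x lo] lip[of x hi] x assms(2,3) L(1)
      by (smt (verit) atLeastAtMost_iff mult_left_mono)
    then have "\<bar>a x\<bar> * \<bar>deriv (cutoff lo hi k) x\<bar> \<le> L * (2 / real (Suc k)) * (M * real (Suc k))"
      using M L by (intro mult_mono) auto
    also have "\<dots> = 2 * L * M" by (simp add: field_simps del: of_nat_Suc)
    finally show ?thesis by (simp add: abs_mult)
  qed
  with L M show ?thesis by (intro that[of "2 * L * M"]) auto
qed


section \<open>The space \<open>L2\<close> over the plate\<close>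

lemma Omega_box: "Omega l = box (0, -l) (pi, l)"
  by (auto simp: Omega_def mem_box Basis_prod_def)

lemma Omega_lmeasurable: "Omega l \<in> lmeasurable"
  unfolding Omega_box by (rule lmeasurable_box)

lemma finite_measure_Omega: "finite_measure (lebesgue_on (Omega l))"
  by (rule finite_measure_lebesgue_on[OF Omega_lmeasurable])

lemma space_Omega [simp]: "space (lebesgue_on (Omega l)) = Omega l"
  by (simp add: space_restrict_space)

lemma continuous_measurable_Omega:
  "continuous_on (Omega l) f \<Longrightarrow> f \<in> borel_measurable (lebesgue_on (Omega l))"
  by (rule continuous_imp_measurable_on_sets_lebesgue[OF _ fmeasurableD[OF Omega_lmeasurable]])

lemma L2_measurable: "U \<in> L2 l \<Longrightarrow> U \<in> borel_measurable (lebesgue_on (Omega l))"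
  and L2_square: "U \<in> L2 l \<Longrightarrow> integrable (lebesgue_on (Omega l)) (\<lambda>z. (U z)\<^sup>2)"
  by (auto simp: L2_def)

lemma L2_product_integrable:
  assumes "U \<in> L2 l" "V \<in> L2 l"
  shows "integrable (lebesgue_on (Omega l)) (\<lambda>z. U z * V z)"
proof (rule Bochner_Integration.integrable_bound)
  show "integrable (lebesgue_on (Omega l)) (\<lambda>z. (U z)\<^sup>2 + (V z)\<^sup>2)"
    using assms by (intro Bochner_Integration.integrable_add L2_square)
  show "(\<lambda>z. U z * V z) \<in> borel_measurable (lebesgue_on (Omega l))"
    using assms by (intro borel_measurable_times L2_measurable)
  have "\<bar>U z * V z\<bar> \<le> (U z)\<^sup>2 + (V z)\<^sup>2" for z
  proof -
    have "2 * \<bar>U z * V z\<bar> \<le> (U z)\<^sup>2 + (V z)\<^sup>2"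
      using sum_squares_bound[of "\<bar>U z\<bar>" "\<bar>V z\<bar>"] by (simp add: abs_mult mult.assoc)
    then show ?thesis
      using abs_ge_zero[of "U z * V z"] by linarith
  qed
  then show "AE z in lebesgue_on (Omega l). norm (U z * V z) \<le> norm ((U z)\<^sup>2 + (V z)\<^sup>2)"
    by (intro always_eventually) auto
qed

lemma L2_scale: "U \<in> L2 l \<Longrightarrow> (\<lambda>z. c * U z) \<in> L2 l"
  by (auto simp: L2_def power_mult_distrib intro!: borel_measurable_times)

lemma L2_add:
  assumes "U \<in> L2 l" "V \<in> L2 l"
  shows "(\<lambda>z. U z + V z) \<in> L2 l"
proof -
  have "integrable (lebesgue_on (Omega l)) (\<lambda>z. (U z)\<^sup>2 + (V z)\<^sup>2 + 2 * (U z * V z))"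
    using assms by (intro Bochner_Integration.integrable_add Bochner_Integration.integrable_mult_right
        L2_square L2_product_integrable) auto
  with assms show ?thesis
    by (auto simp: L2_def power2_sum algebra_simps)
qed

lemma L2_diff: "U \<in> L2 l \<Longrightarrow> V \<in> L2 l \<Longrightarrow> (\<lambda>z. U z - V z) \<in> L2 l"
  using L2_add[of U l "\<lambda>z. (-1) * V z"] L2_scale[of V l "-1"] by simp

lemma L2_bounded:
  assumes "f \<in> borel_measurable (lebesgue_on (Omega l))" "\<And>z. z \<in> Omega l \<Longrightarrow> \<bar>f z\<bar> \<le> C"
  shows "f \<in> L2 l"
proof -
  interpret finite_measure "lebesgue_on (Omega l)" by (rule finite_measure_Omega)
  have "integrable (lebesgue_on (Omega l)) (\<lambda>z. (f z)\<^sup>2)"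
  proof (rule integrable_const_bound)
    show "AE z in lebesgue_on (Omega l). norm ((f z)\<^sup>2) \<le> C\<^sup>2"
      using assms(2) by (intro AE_I2) (auto simp: abs_le_square_iff[symmetric] intro: order_trans[OF _ abs_ge_self])
  qed (use assms(1) in measurable)
  with assms(1) show ?thesis by (simp add: L2_def)
qed

lemma L2_continuous_closed:
  assumes "continuous_on ({0..pi} \<times> {-l..l}) f"
  shows "f \<in> L2 l"
proof -
  have sub: "Omega l \<subseteq> {0..pi} \<times> {-l..l}"
    by (auto simp: Omega_def)
  have "bounded (f ` ({0..pi} \<times> {-l..l}))"
    by (intro compact_imp_bounded compact_continuous_image assms compact_Times compact_Icc)
  then obtain C where "\<And>z. z \<in> {0..pi} \<times> {-l..l} \<Longrightarrow> \<bar>f z\<bar> \<le> C"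
    unfolding bounded_iff by auto
  with sub show ?thesis
    by (intro L2_bounded[of _ _ C] continuous_measurable_Omega continuous_on_subset[OF assms]) auto
qed

lemma L2_integrable:
  assumes "U \<in> L2 l"
  shows "integrable (lebesgue_on (Omega l)) U"
  using L2_product_integrable[OF assms L2_continuous_closed[of l "\<lambda>_. 1"]] by simp

lemma innerL2_commute: "innerL2 l U V = innerL2 l V U"
  by (simp add: innerL2_def mult.commute)

lemma innerL2_add_left:
  "U \<in> L2 l \<Longrightarrow> V \<in> L2 l \<Longrightarrow> W \<in> L2 l \<Longrightarrow>
     innerL2 l (\<lambda>z. U z + V z) W = innerL2 l U W + innerL2 l V W"
  by (simp add: innerL2_def distrib_right L2_product_integrable)

lemma innerL2_scale_left: "innerL2 l (\<lambda>z. c * U z) W = c * innerL2 l U W"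
  by (simp add: innerL2_def mult.assoc)

lemma innerL2_add_right:
  "U \<in> L2 l \<Longrightarrow> V \<in> L2 l \<Longrightarrow> W \<in> L2 l \<Longrightarrow>
     innerL2 l W (\<lambda>z. U z + V z) = innerL2 l W U + innerL2 l W V"
  by (simp add: innerL2_commute[of l W] innerL2_add_left)

lemma innerL2_scale_right: "innerL2 l W (\<lambda>z. c * U z) = c * innerL2 l W U"
  by (simp add: innerL2_commute[of l W] innerL2_scale_left)

lemma innerL2_diff_left:
  "U \<in> L2 l \<Longrightarrow> V \<in> L2 l \<Longrightarrow> W \<in> L2 l \<Longrightarrow>
     innerL2 l (\<lambda>z. U z - V z) W = innerL2 l U W - innerL2 l V W"
  by (simp add: innerL2_def left_diff_distrib L2_product_integrable)

lemma innerL2_nonneg: "innerL2 l U U \<ge> 0"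
  by (auto simp: innerL2_def intro: integral_nonneg)

lemma normL2_square: "(normL2 l U)\<^sup>2 = innerL2 l U U"
  by (simp add: normL2_def innerL2_nonneg)

lemma innerL2_cong_AE:
  assumes "eqL2 l U U'" "eqL2 l V V'" "U \<in> L2 l" "U' \<in> L2 l" "V \<in> L2 l" "V' \<in> L2 l"
  shows "innerL2 l U V = innerL2 l U' V'"
  unfolding innerL2_def
proof (rule integral_cong_AE)
  show "AE z in lebesgue_on (Omega l). U z * V z = U' z * V' z"
    using assms(1,2) unfolding eqL2_def by eventually_elim simp
qed (use assms L2_measurable in \<open>auto intro!: borel_measurable_times\<close>)

lemma innerL2_Cauchy_Schwarz:
  assumes "U \<in> L2 l" "V \<in> L2 l"
  shows "\<bar>innerL2 l U V\<bar> \<le> normL2 l U * normL2 l V"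
proof -
  define a b c where "a = innerL2 l U U" and "b = innerL2 l U V" and "c = innerL2 l V V"
  have q: "0 \<le> a * s\<^sup>2 + 2 * b * s * t + c * t\<^sup>2" for s t
  proof -
    have "innerL2 l (\<lambda>z. s * U z + t * V z) (\<lambda>z. s * U z + t * V z) = a * s\<^sup>2 + 2 * b * s * t + c * t\<^sup>2"
      using assms
      by (simp add: innerL2_add_left innerL2_add_right innerL2_scale_left innerL2_scale_right
          L2_add L2_scale a_def b_def c_def innerL2_commute[of l V U] power2_eq_square algebra_simps)
    then show ?thesis using innerL2_nonneg[of l "\<lambda>z. s * U z + t * V z"] by simp
  qed
  have c: "c \<ge> 0" and a: "a \<ge> 0"
    by (simp_all add: c_def a_def innerL2_nonneg)
  have "b\<^sup>2 \<le> a * c"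
  proof (cases "c = 0")
    case True
    have "b = 0"
    proof (rule ccontr)
      assume "b \<noteq> 0"
      have "0 \<le> a * 1\<^sup>2 + 2 * b * 1 * (- (a + 1) / (2 * b)) + c * (- (a + 1) / (2 * b))\<^sup>2"
        by (rule q)
      with True \<open>b \<noteq> 0\<close> show False by (simp add: field_simps)
    qed
    with a c show ?thesis by simp
  next
    case False
    have "0 \<le> a * c\<^sup>2 + 2 * b * c * (- b) + c * (- b)\<^sup>2" by (rule q)
    then have "0 \<le> c * (a * c - b\<^sup>2)" by (simp add: power2_eq_square algebra_simps)
    with False c show ?thesis by (simp add: zero_le_mult_iff)
  qed
  then have "sqrt (b\<^sup>2) \<le> sqrt (a * c)" by (rule real_sqrt_le_mono)
  then show ?thesis by (simp add: normL2_def a_def b_def c_def real_sqrt_mult)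
qed


section \<open>Test functions and weak derivatives\<close>

text \<open>
  All test functions that are needed, and all spatial profiles of the solutions, are products of this
  kind, which reduces the analysis in the plane to calculus in one variable.
\<close>

definition sep :: "(real \<Rightarrow> real) \<Rightarrow> (real \<Rightarrow> real) \<Rightarrow> real \<times> real \<Rightarrow> real" where
  "sep a b z = a (fst z) * b (snd z)"

lemma continuous_sep:
  assumes "continuous_on UNIV a" "continuous_on UNIV b"
  shows "continuous_on S (sep a b)"
  unfolding sep_def
  by (intro continuous_on_mult continuous_on_compose2[OF assms(1)] continuous_on_compose2[OF assms(2)]
      continuous_on_fst continuous_on_snd continuous_on_id) auto

lemma sep_L2: "continuous_on UNIV a \<Longrightarrow> continuous_on UNIV b \<Longrightarrow> sep a b \<in> L2 l"
  by (intro L2_continuous_closed continuous_sep)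

lemma sep_smooth_L2: "smooth a \<Longrightarrow> smooth b \<Longrightarrow> sep a b \<in> L2 l"
  by (intro sep_L2 smooth_continuous)

lemma pdx_sep: "smooth a \<Longrightarrow> pdx (sep a b) = sep (deriv a) b"
proof
  fix z
  assume "smooth a"
  then have "((\<lambda>s. a s * b (snd z)) has_real_derivative deriv a (fst z) * b (snd z)) (at (fst z))"
    using smooth_DERIV by (auto intro!: derivative_eq_intros)
  then show "pdx (sep a b) z = sep (deriv a) b z"
    by (cases z) (simp add: pdx_def sep_def DERIV_imp_deriv)
qed

lemma pdy_sep: "smooth b \<Longrightarrow> pdy (sep a b) = sep a (deriv b)"
proof
  fix z
  assume "smooth b"
  then have "((\<lambda>s. a (fst z) * b s) has_real_derivative a (fst z) * deriv b (snd z)) (at (snd z))"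
    using smooth_DERIV by (auto intro!: derivative_eq_intros)
  then show "pdy (sep a b) z = sep a (deriv b) z"
    by (cases z) (simp add: pdy_def sep_def DERIV_imp_deriv)
qed

lemma differentiable_sep:
  assumes "smooth a" "smooth b"
  shows "sep a b differentiable_on S"
  unfolding differentiable_on_def
proof
  fix z assume "z \<in> S"
  have fa: "((\<lambda>w. a (fst w)) has_derivative (\<lambda>h. deriv a (fst z) * fst h)) (at z)"
    using has_derivative_compose[OF has_derivative_fst[OF has_derivative_ident]
        smooth_DERIV[OF assms(1), of "fst z", unfolded has_field_derivative_def]] by simp
  have fb: "((\<lambda>w. b (snd w)) has_derivative (\<lambda>h. deriv b (snd z) * snd h)) (at z)"
    using has_derivative_compose[OF has_derivative_snd[OF has_derivative_ident]
        smooth_DERIV[OF assms(2), of "snd z", unfolded has_field_derivative_def]] by simp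
  show "sep a b differentiable at z within S"
    using has_derivative_mult[OF fa fb] unfolding sep_def
    by (meson differentiable_at_withinI differentiableI)
qed

lemma Ck_sep: "smooth a \<Longrightarrow> smooth b \<Longrightarrow> Ck k (sep a b)"
proof (induction k arbitrary: a b)
  case 0
  then show ?case by (simp add: continuous_sep smooth_continuous)
next
  case (Suc k)
  then show ?case by (simp add: pdx_sep pdy_sep smooth_deriv differentiable_sep)
qed

lemma test_function_sep:
  assumes "smooth a" "smooth b" "compact_in 0 pi a" "compact_in (-l) l b"
  shows "sep a b \<in> test_functions l"
proof -
  obtain c d where x: "0 < c" "d < pi" "\<And>x. x \<notin> {c..d} \<Longrightarrow> a x = 0"
    using assms(3) unfolding compact_in_def by blast
  obtain p q where y: "-l < p" "q < l" "\<And>y. y \<notin> {p..q} \<Longrightarrow> b y = 0"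
    using assms(4) unfolding compact_in_def by blast
  have "{z. sep a b z \<noteq> 0} \<subseteq> {c..d} \<times> {p..q}"
    using x(3) y(3) by (fastforce simp: sep_def)
  moreover have "closed ({c..d} \<times> {p..q})"
    by (intro closed_Times closed_atLeastAtMost)
  ultimately have sub: "closure {z. sep a b z \<noteq> 0} \<subseteq> {c..d} \<times> {p..q}"
    by (rule closure_minimal)
  moreover have "compact ({c..d} \<times> {p..q})"
    by (intro compact_Times compact_Icc)
  ultimately have "compact (closure {z. sep a b z \<noteq> 0})"
    by (meson bounded_subset closed_closure compact_eq_bounded_closed)
  moreover have "{c..d} \<times> {p..q} \<subseteq> Omega l"
    using x y by (auto simp: Omega_def)
  ultimately show ?thesis
    using sub assms by (auto simp: test_functions_def Ck_sep)
qed

lemma pdx_DERIV: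
  assumes "f differentiable_on UNIV"
  shows "((\<lambda>s. f (s, y)) has_real_derivative pdx f (x, y)) (at x)"
proof -
  have "f differentiable (at (x, y))"
    using assms by (simp add: differentiable_on_def)
  moreover have "(\<lambda>s. (s, y)) differentiable (at x)"
    by (rule differentiableI, rule has_derivative_Pair[OF has_derivative_ident has_derivative_const])
  ultimately have "(f \<circ> (\<lambda>s. (s, y))) differentiable (at x)"
    using differentiable_chain_at[of "\<lambda>s. (s, y)" x f] by simp
  then show ?thesis
    by (simp add: o_def pdx_def DERIV_deriv_iff_real_differentiable)
qed

lemma pdy_DERIV:
  assumes "f differentiable_on UNIV"
  shows "((\<lambda>s. f (x, s)) has_real_derivative pdy f (x, y)) (at y)"
proof -
  have "f differentiable (at (x, y))"
    using assms by (simp add: differentiable_on_def)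
  moreover have "(\<lambda>s. (x, s)) differentiable (at y)"
    by (rule differentiableI, rule has_derivative_Pair[OF has_derivative_const has_derivative_ident])
  ultimately have "(f \<circ> (\<lambda>s. (x, s))) differentiable (at y)"
    using differentiable_chain_at[of "\<lambda>s. (x, s)" y f] by simp
  then show ?thesis
    by (simp add: o_def pdy_def DERIV_deriv_iff_real_differentiable)
qed

lemma locally_zero_pd:
  assumes "z \<notin> closure {z. f z \<noteq> 0}"
  shows "pdx f z = 0" "pdy f z = 0"
proof -
  obtain x y where z: "z = (x, y)" by (cases z)
  define S where "S = - closure {z. f z \<noteq> 0}"
  have S: "open S" "z \<in> S" "\<And>w. w \<in> S \<Longrightarrow> f w = 0"
    using assms closure_subset[of "{z. f z \<noteq> 0}"] by (auto simp: S_def)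
  have "open ((\<lambda>s. (s, y)) -` S)" "open ((\<lambda>s. (x, s)) -` S)"
    by (intro open_vimage S(1) continuous_intros)+
  then have "\<forall>\<^sub>F s in nhds x. f (s, y) = 0" "\<forall>\<^sub>F s in nhds y. f (x, s) = 0"
    using S z eventually_nhds_in_open[of "(\<lambda>s. (s, y)) -` S" x]
      eventually_nhds_in_open[of "(\<lambda>s. (x, s)) -` S" y]
    by (auto elim!: eventually_mono)
  then have "deriv (\<lambda>s. f (s, y)) x = deriv (\<lambda>_. 0) x" "deriv (\<lambda>s. f (x, s)) y = deriv (\<lambda>_. 0) y"
    by - (rule deriv_cong_ev, simp, simp)+
  then show "pdx f z = 0" "pdy f z = 0"
    by (simp_all add: z pdx_def pdy_def)
qed

lemma test_function_pd:
  assumes "f \<in> test_functions l"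
  shows "pdx f \<in> test_functions l" "pdy f \<in> test_functions l"
proof -
  have Ck: "Ck k (pdx f)" "Ck k (pdy f)" for k
    using assms Ck.simps(2)[of k f] by (auto simp: test_functions_def)
  have "{z. pdx f z \<noteq> 0} \<subseteq> closure {z. f z \<noteq> 0}" "{z. pdy f z \<noteq> 0} \<subseteq> closure {z. f z \<noteq> 0}"
    using locally_zero_pd by blast+
  then have "closure {z. pdx f z \<noteq> 0} \<subseteq> closure {z. f z \<noteq> 0}"
      "closure {z. pdy f z \<noteq> 0} \<subseteq> closure {z. f z \<noteq> 0}"
    by (simp_all add: closure_minimal)
  moreover have "compact (closure {z. f z \<noteq> 0})" "closure {z. f z \<noteq> 0} \<subseteq> Omega l"
    using assms by (auto simp: test_functions_def)
  moreover from calculation have "compact (closure {z. pdx f z \<noteq> 0})" "compact (closure {z. pdy f z \<noteq> 0})"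
    by (meson bounded_subset closed_closure compact_eq_bounded_closed)+
  ultimately show "pdx f \<in> test_functions l" "pdy f \<in> test_functions l"
    unfolding test_functions_def using Ck by auto
qed

lemma test_function_differentiable: "f \<in> test_functions l \<Longrightarrow> f differentiable_on UNIV"
  and test_function_continuous: "f \<in> test_functions l \<Longrightarrow> continuous_on S f"
  and test_function_outside: "f \<in> test_functions l \<Longrightarrow> z \<notin> Omega l \<Longrightarrow> f z = 0"
proof -
  assume f: "f \<in> test_functions l"
  then have "Ck (Suc 0) f" "Ck 0 f"
    unfolding test_functions_def by blast+
  then show "f differentiable_on UNIV" "continuous_on S f"
    using continuous_on_subset by auto
next
  assume "f \<in> test_functions l" "z \<notin> Omega l"
  then show "f z = 0"
    using closure_subset[of "{z. f z \<noteq> 0}"] by (auto simp: test_functions_def)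
qed

lemma test_function_L2: "f \<in> test_functions l \<Longrightarrow> f \<in> L2 l"
  by (intro L2_continuous_closed test_function_continuous)

lemma integral_Omega_iterated:
  fixes f :: "real \<times> real \<Rightarrow> real"
  assumes "continuous_on ({0..pi} \<times> {-l..l}) f"
  shows "(\<integral>z. f z \<partial>lebesgue_on (Omega l)) =
           integral {0..pi} (\<lambda>x. integral {-l..l} (\<lambda>y. f (x, y)))"
    and "(\<integral>z. f z \<partial>lebesgue_on (Omega l)) =
           integral {-l..l} (\<lambda>y. integral {0..pi} (\<lambda>x. f (x, y)))"
proof -
  have cb: "cbox (0, -l) (pi, l) = {0..pi} \<times> {-l..l}"
    by (simp add: cbox_Pair_eq)
  have c: "continuous_on (cbox (0, -l) (pi, l)) f"
    using assms by (simp add: cb)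
  have "(\<integral>z. f z \<partial>lebesgue_on (Omega l)) = integral (Omega l) f"
    by (rule lebesgue_integral_eq_integral[OF L2_integrable[OF L2_continuous_closed[OF assms]]])
       (rule fmeasurableD[OF Omega_lmeasurable])
  also have "\<dots> = integral (cbox (0, -l) (pi, l)) f"
    unfolding Omega_box by (rule integral_open_interval)
  finally have *: "(\<integral>z. f z \<partial>lebesgue_on (Omega l)) = integral (cbox (0, -l) (pi, l)) f" .
  then show 1: "(\<integral>z. f z \<partial>lebesgue_on (Omega l)) =
           integral {0..pi} (\<lambda>x. integral {-l..l} (\<lambda>y. f (x, y)))"
    using integral_prod_continuous[OF c] by (simp add: cbox_interval)
  have "continuous_on (cbox (0, -l) (pi, l)) (\<lambda>(x, y). f (x, y))"
    using c by simp
  from integral_swap_continuous[OF this] 1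
  show "(\<integral>z. f z \<partial>lebesgue_on (Omega l)) =
           integral {-l..l} (\<lambda>y. integral {0..pi} (\<lambda>x. f (x, y)))"
    by (simp add: cbox_interval)
qed

lemma FTC_real:
  fixes f :: "real \<Rightarrow> real"
  assumes "a \<le> b" "\<And>x. (f has_real_derivative f' x) (at x)"
  shows "integral {a..b} f' = f b - f a"
  using fundamental_theorem_of_calculus[OF assms(1), of f f'] assms(2)
  by (auto intro!: integral_unique intro: has_field_derivative_at_within
      simp: has_real_derivative_iff_has_vector_derivative[symmetric])

text \<open>
  Fubini and the fundamental theorem of calculus on the slices, whose endpoints lie outside the open
  plate.
\<close>

lemma integral_pd_eq_0:
  assumes "f differentiable_on UNIV" "\<And>z. z \<notin> Omega l \<Longrightarrow> f z = 0" "0 < l"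
  shows "continuous_on UNIV (pdx f) \<Longrightarrow> (\<integral>z. pdx f z \<partial>lebesgue_on (Omega l)) = 0"
    and "continuous_on UNIV (pdy f) \<Longrightarrow> (\<integral>z. pdy f z \<partial>lebesgue_on (Omega l)) = 0"
proof -
  assume "continuous_on UNIV (pdx f)"
  then have "(\<integral>z. pdx f z \<partial>lebesgue_on (Omega l)) =
     integral {-l..l} (\<lambda>y. integral {0..pi} (\<lambda>x. pdx f (x, y)))"
    by (intro integral_Omega_iterated(2)) (auto intro: continuous_on_subset)
  moreover have "integral {0..pi} (\<lambda>x. pdx f (x, y)) = 0" for y
    using FTC_real[of 0 pi "\<lambda>s. f (s, y)" "\<lambda>x. pdx f (x, y)", OF _ pdx_DERIV[OF assms(1)]]
      assms(2)[of "(0, y)"] assms(2)[of "(pi, y)"] by (simp add: Omega_def)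
  ultimately show "(\<integral>z. pdx f z \<partial>lebesgue_on (Omega l)) = 0" by simp
next
  assume "continuous_on UNIV (pdy f)"
  then have "(\<integral>z. pdy f z \<partial>lebesgue_on (Omega l)) =
     integral {0..pi} (\<lambda>x. integral {-l..l} (\<lambda>y. pdy f (x, y)))"
    by (intro integral_Omega_iterated(1)) (auto intro: continuous_on_subset)
  moreover have "integral {-l..l} (\<lambda>y. pdy f (x, y)) = 0" for x
    using FTC_real[of "-l" l "\<lambda>s. f (x, s)" "\<lambda>y. pdy f (x, y)", OF _ pdy_DERIV[OF assms(1)]]
      assms(2)[of "(x, -l)"] assms(2)[of "(x, l)"] assms(3) by (simp add: Omega_def)
  ultimately show "(\<integral>z. pdy f z \<partial>lebesgue_on (Omega l)) = 0" by simp
qed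

lemma integration_by_parts_sep:
  assumes "0 < l" "smooth a" "smooth b" "f \<in> test_functions l"
  shows "innerL2 l (sep a b) (pdx f) = - innerL2 l (sep (deriv a) b) f"
    and "innerL2 l (sep a b) (pdy f) = - innerL2 l (sep a (deriv b)) f"
proof -
  \<comment> \<open>The product rule turns the vanishing integral of a derivative of \<open>h\<close> into the claim.\<close>
  define h where "h = (\<lambda>z. sep a b z * f z)"
  note fd = test_function_differentiable[OF assms(4)]
  note cs = smooth_continuous smooth_deriv assms(2,3) continuous_sep
  note fc = test_function_continuous[OF assms(4)] test_function_continuous[OF test_function_pd(1)[OF assms(4)]]
    test_function_continuous[OF test_function_pd(2)[OF assms(4)]]
  have hd: "h differentiable_on UNIV"
    unfolding h_def using differentiable_sep[OF assms(2,3)] fd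
    by (auto simp: differentiable_on_def intro: differentiable_mult)
  have hx: "pdx h = (\<lambda>z. sep (deriv a) b z * f z + sep a b z * pdx f z)"
  proof
    fix z :: "real \<times> real"
    obtain x y where z: "z = (x, y)" by (cases z)
    have "((\<lambda>s. h (s, y)) has_real_derivative
            sep (deriv a) b (x, y) * f (x, y) + sep a b (x, y) * pdx f (x, y)) (at x)"
      unfolding h_def using pdx_DERIV[OF fd] pdx_DERIV[OF differentiable_sep[OF assms(2,3)]]
      by (auto intro!: derivative_eq_intros simp: pdx_sep assms(2))
    then show "pdx h z = sep (deriv a) b z * f z + sep a b z * pdx f z"
      using DERIV_unique pdx_DERIV[OF hd] z by blast
  qed
  have hy: "pdy h = (\<lambda>z. sep a (deriv b) z * f z + sep a b z * pdy f z)"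
  proof
    fix z :: "real \<times> real"
    obtain x y where z: "z = (x, y)" by (cases z)
    have "((\<lambda>s. h (x, s)) has_real_derivative
            sep a (deriv b) (x, y) * f (x, y) + sep a b (x, y) * pdy f (x, y)) (at y)"
      unfolding h_def using pdy_DERIV[OF fd] pdy_DERIV[OF differentiable_sep[OF assms(2,3)]]
      by (auto intro!: derivative_eq_intros simp: pdy_sep assms(3))
    then show "pdy h z = sep a (deriv b) z * f z + sep a b z * pdy f z"
      using DERIV_unique pdy_DERIV[OF hd] z by blast
  qed
  have out: "h z = 0" if "z \<notin> Omega l" for z
    using test_function_outside[OF assms(4) that] by (simp add: h_def)
  have int: "integrable (lebesgue_on (Omega l)) (\<lambda>z. sep p q z * g z)"
    if "smooth p" "smooth q" "g \<in> test_functions l" for p q g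
    using that by (intro L2_product_integrable sep_smooth_L2 test_function_L2)
  note ii = int[OF _ _ assms(4)] int[OF assms(2,3) test_function_pd(1)[OF assms(4)]]
    int[OF assms(2,3) test_function_pd(2)[OF assms(4)]]
  have "continuous_on UNIV (pdx h)" "continuous_on UNIV (pdy h)"
    unfolding hx hy by (intro continuous_on_add continuous_on_mult fc cs)+
  then have "(\<integral>z. pdx h z \<partial>lebesgue_on (Omega l)) = 0" "(\<integral>z. pdy h z \<partial>lebesgue_on (Omega l)) = 0"
    using integral_pd_eq_0[OF hd out assms(1)] by auto
  then show "innerL2 l (sep a b) (pdx f) = - innerL2 l (sep (deriv a) b) f"
      "innerL2 l (sep a b) (pdy f) = - innerL2 l (sep a (deriv b)) f"
    unfolding hx hy innerL2_def
    by (simp_all add: ii assms(2,3) smooth_deriv add_eq_0_iff2)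
qed

lemma smooth_deriv_funpow: "smooth a \<Longrightarrow> smooth ((deriv ^^ n) a)"
  by (induction n) (auto simp: smooth_deriv)

lemma test_function_pd_funpow:
  "f \<in> test_functions l \<Longrightarrow> (pdx ^^ i) f \<in> test_functions l"
  "f \<in> test_functions l \<Longrightarrow> (pdy ^^ j) f \<in> test_functions l"
  by (induction i, auto simp: test_function_pd) (induction j, auto simp: test_function_pd)

text \<open>
  Classical derivatives are weak derivatives: a test function vanishes near the boundary, so there are
  no boundary terms.
\<close>

lemma is_weak_deriv_sep:
  assumes "0 < l" "smooth a" "smooth b"
  shows "is_weak_deriv l i j (sep a b) (sep ((deriv ^^ i) a) ((deriv ^^ j) b))"
proof -
  have x: "innerL2 l (sep a b) ((pdx ^^ i) f) = (-1) ^ i * innerL2 l (sep ((deriv ^^ i) a) b) f"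
    if "f \<in> test_functions l" for f
    using that
  proof (induction i arbitrary: f)
    case (Suc i)
    have "innerL2 l (sep a b) ((pdx ^^ Suc i) f) = innerL2 l (sep a b) ((pdx ^^ i) (pdx f))"
      by (simp add: funpow_swap1)
    also have "\<dots> = (-1) ^ i * innerL2 l (sep ((deriv ^^ i) a) b) (pdx f)"
      using Suc by (simp add: test_function_pd)
    finally show ?case
      using Suc.prems assms by (simp add: integration_by_parts_sep smooth_deriv_funpow)
  qed simp
  have y: "innerL2 l (sep p b) ((pdy ^^ j) f) = (-1) ^ j * innerL2 l (sep p ((deriv ^^ j) b)) f"
    if "f \<in> test_functions l" "smooth p" for f p
    using that
  proof (induction j arbitrary: f)
    case (Suc j)
    have "innerL2 l (sep p b) ((pdy ^^ Suc j) f) = innerL2 l (sep p b) ((pdy ^^ j) (pdy f))"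
      by (simp add: funpow_swap1)
    also have "\<dots> = (-1) ^ j * innerL2 l (sep p ((deriv ^^ j) b)) (pdy f)"
      using Suc by (simp add: test_function_pd)
    finally show ?case
      using Suc.prems assms by (simp add: integration_by_parts_sep smooth_deriv_funpow)
  qed simp
  show ?thesis
    unfolding is_weak_deriv_def using assms
    by (simp add: x y test_function_pd_funpow smooth_deriv_funpow sep_smooth_L2 power_add)
qed

lemma is_weak_deriv_scale: "is_weak_deriv l i j U V \<Longrightarrow> is_weak_deriv l i j (\<lambda>z. c * U z) (\<lambda>z. c * V z)"
  by (simp add: is_weak_deriv_def innerL2_scale_left L2_scale)

lemma is_weak_deriv_add:
  assumes "is_weak_deriv l i j U V" "is_weak_deriv l i j U' V'" "U \<in> L2 l" "U' \<in> L2 l"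
  shows "is_weak_deriv l i j (\<lambda>z. U z + U' z) (\<lambda>z. V z + V' z)"
  using assms unfolding is_weak_deriv_def
  by (auto simp: innerL2_add_left L2_add test_function_L2 test_function_pd_funpow distrib_left)

text \<open>
  Dominated convergence, in the form in which cutoffs are removed.
\<close>

lemma innerL2_sep_tendsto:
  fixes \<alpha> \<beta> :: "nat \<Rightarrow> real \<Rightarrow> real"
  assumes D: "D \<in> L2 l"
    and c: "\<And>k. continuous_on UNIV (\<alpha> k)" "\<And>k. continuous_on UNIV (\<beta> k)"
    and b: "\<And>k x. 0 < x \<Longrightarrow> x < pi \<Longrightarrow> \<bar>\<alpha> k x\<bar> \<le> A" "\<And>k y. -l < y \<Longrightarrow> y < l \<Longrightarrow> \<bar>\<beta> k y\<bar> \<le> B"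
    and lim: "\<And>x. 0 < x \<Longrightarrow> x < pi \<Longrightarrow> (\<lambda>k. \<alpha> k x) \<longlonglongrightarrow> a x"
      "\<And>y. -l < y \<Longrightarrow> y < l \<Longrightarrow> (\<lambda>k. \<beta> k y) \<longlonglongrightarrow> b y"
  shows "(\<lambda>k. innerL2 l D (sep (\<alpha> k) (\<beta> k))) \<longlonglongrightarrow> innerL2 l D (sep a b)"
  unfolding innerL2_def
proof (rule integral_dominated_convergence)
  have m: "sep (\<alpha> k) (\<beta> k) \<in> borel_measurable (lebesgue_on (Omega l))" for k
    by (intro continuous_measurable_Omega continuous_sep c)
  have l: "(\<lambda>k. sep (\<alpha> k) (\<beta> k) z) \<longlonglongrightarrow> sep a b z" if "z \<in> Omega l" for z
    using that lim by (auto simp: sep_def Omega_def intro!: tendsto_mult)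
  have m': "sep a b \<in> borel_measurable (lebesgue_on (Omega l))"
    by (rule borel_measurable_LIMSEQ_metric[of "\<lambda>k. sep (\<alpha> k) (\<beta> k)"]) (use m l in auto)
  show "(\<lambda>z. D z * sep (\<alpha> k) (\<beta> k) z) \<in> borel_measurable (lebesgue_on (Omega l))" for k
    by (intro borel_measurable_times L2_measurable[OF D] m)
  show "(\<lambda>z. D z * sep a b z) \<in> borel_measurable (lebesgue_on (Omega l))"
    by (intro borel_measurable_times L2_measurable[OF D] m')
  show "integrable (lebesgue_on (Omega l)) (\<lambda>z. \<bar>D z\<bar> * (A * B))"
    using L2_integrable[OF D] by auto
  show "AE z in lebesgue_on (Omega l). (\<lambda>k. D z * sep (\<alpha> k) (\<beta> k) z) \<longlonglongrightarrow> D z * sep a b z"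
    by (intro AE_I2 tendsto_mult tendsto_const l) auto
  show "AE z in lebesgue_on (Omega l). norm (D z * sep (\<alpha> k) (\<beta> k) z) \<le> \<bar>D z\<bar> * (A * B)" for k
  proof (intro AE_I2)
    fix z assume "z \<in> space (lebesgue_on (Omega l))"
    then have "\<bar>\<alpha> k (fst z)\<bar> \<le> A" "\<bar>\<beta> k (snd z)\<bar> \<le> B"
      using b by (auto simp: Omega_def)
    then have "\<bar>\<alpha> k (fst z)\<bar> * \<bar>\<beta> k (snd z)\<bar> \<le> A * B"
      by (intro mult_mono) auto
    then show "norm (D z * sep (\<alpha> k) (\<beta> k) z) \<le> \<bar>D z\<bar> * (A * B)"
      by (simp add: sep_def abs_mult mult_left_mono)
  qed
qed


section \<open>Uniqueness of weak derivatives\<close>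

lemma compact_in_mono: "compact_in a b f \<Longrightarrow> lo \<le> a \<Longrightarrow> b \<le> hi \<Longrightarrow> compact_in lo hi f"
  unfolding compact_in_def by (meson le_less_trans less_le_trans)

text \<open>
  The factor \<open>1\<close> is kept so that \<open>compact_in_cutoff\<close> applies with a constant first factor.
\<close>

lemma cutoff_tendsto_indicator: "(\<lambda>k. 1 * cutoff a b k x) \<longlonglongrightarrow> indicator {a<..<b} x"
proof (cases "x \<in> {a<..<b}")
  case True
  then show ?thesis using cutoff_tendsto[of a x b] by simp
next
  case False
  then have "x - a \<le> 0 \<or> b - x \<le> 0" by auto
  then have "cutoff a b k x = 0" for k
  proof
    assume "x - a \<le> 0"
    then have "real (Suc k) * (x - a) \<le> 0"
      by (intro mult_nonneg_nonpos) auto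
    then show ?thesis by (simp add: cutoff_def step_0 del: of_nat_Suc)
  next
    assume "b - x \<le> 0"
    then have "real (Suc k) * (b - x) \<le> 0"
      by (intro mult_nonneg_nonpos) auto
    then show ?thesis by (simp add: cutoff_def step_0 del: of_nat_Suc)
  qed
  with False show ?thesis by simp
qed

text \<open>
  The indicator of a box inside the plate is a bounded pointwise limit of products of cutoffs, which
  are test functions.
\<close>

lemma orthogonal_box:
  assumes D: "D \<in> L2 l" and o: "\<And>f. f \<in> test_functions l \<Longrightarrow> innerL2 l D f = 0"
    and r: "0 \<le> a" "b \<le> pi" "-l \<le> c" "d \<le> l"
  shows "innerL2 l D (sep (indicator {a<..<b}) (indicator {c<..<d})) = 0"
proof -
  have sm: "smooth (\<lambda>x. 1 * cutoff p q k x)" for p q k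
    by (intro smooth_mult smooth_cutoff smooth_const)
  have "(\<lambda>k. innerL2 l D (sep (\<lambda>x. 1 * cutoff a b k x) (\<lambda>x. 1 * cutoff c d k x)))
          \<longlonglongrightarrow> innerL2 l D (sep (indicator {a<..<b}) (indicator {c<..<d}))"
    using cutoff_bounds
    by (intro innerL2_sep_tendsto[where A = 1 and B = 1] D smooth_continuous sm cutoff_tendsto_indicator)
       (auto simp: abs_le_iff intro: order_trans[OF _ zero_le_one] order_trans[of _ 0])
  moreover have "innerL2 l D (sep (\<lambda>x. 1 * cutoff a b k x) (\<lambda>x. 1 * cutoff c d k x)) = 0" for k
    using r compact_in_cutoff[of a b "\<lambda>_. 1" k] compact_in_cutoff[of c d "\<lambda>_. 1" k]
    by (intro o test_function_sep sm) (auto elim: compact_in_mono)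
  ultimately show ?thesis
    by (simp add: LIMSEQ_const_iff)
qed

lemma Int_stable_boxes: "Int_stable (range (\<lambda>(a, b). box a b :: 'a::euclidean_space set))"
  by (auto simp: Int_stable_def box_Int_box)

text \<open>
  A function that is orthogonal to all test functions has integral zero over all boxes. Boxes are an
  intersection-stable generator of the Borel sets, so the integral over every Borel set is zero, and
  the function vanishes almost everywhere. The function is only Lebesgue measurable; a Borel
  measurable representative \<open>g\<close> of its extension by zero carries the argument.
\<close>

lemma fundamental_lemma:
  assumes D: "D \<in> L2 l" and o: "\<And>f. f \<in> test_functions l \<Longrightarrow> innerL2 l D f = 0"
  shows "eqL2 l D (\<lambda>_. 0)"
proof -
  have Os: "Omega l \<in> sets lebesgue"
    by (rule fmeasurableD[OF Omega_lmeasurable])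
  define D' where "D' = (\<lambda>z. indicator (Omega l) z *\<^sub>R D z)"
  have iD': "integrable lebesgue D'"
    using L2_integrable[OF D] Os unfolding D'_def by (subst (asm) integrable_restrict_space) auto
  obtain g where g: "g \<in> borel_measurable lborel" and eq: "AE z in lborel. D' z = g z"
    using completion_ex_borel_measurable_real[OF borel_measurable_integrable[OF iD']] by blast
  have gl: "g \<in> borel_measurable lebesgue"
    using g by (rule measurable_completion)
  have eql: "AE z in lebesgue. D' z = g z"
    using eq by (rule AE_completion)
  have "integrable lebesgue g"
    by (rule integrable_cong_AE_imp[OF iD' gl]) (use eql in \<open>auto simp: eq_commute\<close>)
  then have ig: "integrable lborel g"
    using g by (simp add: integrable_completion)
  have set_eq: "(LINT z:A|lborel. g z) = (\<integral>z. indicator A z * D' z \<partial>lebesgue)" if "A \<in> sets borel" for A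
  proof -
    have "(LINT z:A|lborel. g z) = (\<integral>z. indicator A z * g z \<partial>lebesgue)"
      unfolding set_lebesgue_integral_def using g that
      by (subst integral_completion) (auto intro!: borel_measurable_times)
    also have "\<dots> = (\<integral>z. indicator A z * D' z \<partial>lebesgue)"
    proof (rule integral_cong_AE)
      have "(indicator A :: real \<times> real \<Rightarrow> real) \<in> borel_measurable lebesgue"
        using that by (intro borel_measurable_indicator) (simp add: sets_completionI_sets)
      then show "(\<lambda>z. indicator A z * g z) \<in> borel_measurable lebesgue"
          "(\<lambda>z. indicator A z * D' z) \<in> borel_measurable lebesgue"
        using gl borel_measurable_integrable[OF iD'] by (auto intro!: borel_measurable_times)
    qed (use eql in \<open>eventually_elim, simp\<close>)
    finally show ?thesis .
  qed
  have box0: "(LINT z:box p q|lborel. g z) = 0" for p q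
  proof -
    obtain p1 p2 q1 q2 where pq: "p = (p1, p2)" "q = (q1, q2)" by (cases p, cases q)
    have "(LINT z:box p q|lborel. g z) = (\<integral>z. indicator (box p q) z * D' z \<partial>lebesgue)"
      by (rule set_eq) simp
    also have "\<dots> = (\<integral>z. indicator (Omega l) z *\<^sub>R
        (D z * sep (indicator {max p1 0<..<min q1 pi}) (indicator {max p2 (-l)<..<min q2 l}) z) \<partial>lebesgue)"
      by (intro Bochner_Integration.integral_cong refl)
         (auto simp: D'_def sep_def indicator_def Omega_def pq box_prod)
    also have "\<dots> = innerL2 l D (sep (indicator {max p1 0<..<min q1 pi}) (indicator {max p2 (-l)<..<min q2 l}))"
      unfolding innerL2_def using Os by (subst integral_restrict_space) auto
    also have "\<dots> = 0"
      by (rule orthogonal_box[OF D o]) auto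
    finally show ?thesis .
  qed
  have UNIV0: "(LINT z:UNIV|lborel. g z) = 0"
  proof -
    have "(LINT z:UNIV|lborel. g z) = (LINT z:Omega l|lborel. g z)"
      by (subst (1 2) set_eq) (auto simp: Omega_box D'_def indicator_def intro!: Bochner_Integration.integral_cong)
    then show ?thesis using box0 by (simp add: Omega_box)
  qed
  have int: "set_integrable lborel A g" if "A \<in> sets borel" for A
    unfolding set_integrable_def using ig that by (intro integrable_mult_indicator) auto
  define G where "G = range (\<lambda>(a, b). box a b :: (real \<times> real) set)"
  have zero: "(LINT z:A|lborel. g z) = 0" if A: "A \<in> sets borel" for A
  proof -
    have st: "Int_stable G"
      unfolding G_def by (rule Int_stable_boxes)
    have sub: "G \<subseteq> Pow UNIV" by simp
    have sig: "sigma_sets UNIV G = sets borel"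
      unfolding borel_eq_box G_def by simp
    from A have "A \<in> sigma_sets UNIV G" by (simp add: sig)
    with st sub show ?thesis
    proof (induction rule: sigma_sets_induct_disjoint)
      case (basic A)
      then show ?case using box0 by (auto simp: G_def)
    next
      case empty
      then show ?case by (simp add: set_lebesgue_integral_def)
    next
      case (compl A)
      then have A: "A \<in> sets borel" by (simp add: sig)
      have "(LINT z:A \<union> (UNIV - A)|lborel. g z) = (LINT z:A|lborel. g z) + (LINT z:UNIV - A|lborel. g z)"
        using A by (intro set_integral_Un int) auto
      with compl UNIV0 show ?case by simp
    next
      case (union A)
      then have "range A \<subseteq> sets borel" by (simp add: sig)
      with union show ?case
        by (subst lebesgue_integral_countable_add) (auto simp: disjoint_family_on_def intro!: int)
    qed
  qed
  have "AE z in lborel. g z = 0"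
    using zero by (intro sigma_finite_measure.density_zero[OF sigma_finite_lborel ig]) simp
  then have "AE z in lebesgue. g z = 0"
    by (rule AE_completion)
  with eql have "AE z in lebesgue. z \<in> Omega l \<longrightarrow> D z = 0"
    by eventually_elim (auto simp: D'_def)
  then show ?thesis
    unfolding eqL2_def using Os by (subst AE_restrict_space_iff) auto
qed

text \<open>
  The inner products of the plate problem are defined with a chosen weak derivative; by uniqueness they
  can be evaluated with the classical derivatives of an explicit function.
\<close>

lemma weak_deriv_unique:
  assumes "is_weak_deriv l i j U V" "is_weak_deriv l i j U V'"
  shows "eqL2 l V V'"
proof -
  have L: "V \<in> L2 l" "V' \<in> L2 l"
    using assms by (auto simp: is_weak_deriv_def)
  have "innerL2 l (\<lambda>z. V z - V' z) f = 0" if "f \<in> test_functions l" for f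
  proof -
    have "(-1) ^ (i + j) * innerL2 l V f = (-1) ^ (i + j) * innerL2 l V' f"
      using assms that unfolding is_weak_deriv_def by metis
    then show ?thesis
      using L that by (simp add: innerL2_diff_left test_function_L2)
  qed
  then have "eqL2 l (\<lambda>z. V z - V' z) (\<lambda>_. 0)"
    by (intro fundamental_lemma L2_diff L)
  then show ?thesis by (simp add: eqL2_def)
qed

lemma is_weak_deriv_weak_deriv:
  assumes "is_weak_deriv l i j U V"
  shows "is_weak_deriv l i j U (weak_deriv l i j U)"
  unfolding weak_deriv_def by (rule someI[of "is_weak_deriv l i j U", OF assms])


section \<open>Green's formulas in \<open>H2star\<close>\<close>

lemma H2star_weak_deriv:
  assumes "v \<in> H2star l" "i + j \<le> 2"
  shows "is_weak_deriv l i j v (weak_deriv l i j v)"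
proof -
  have "\<exists>V. is_weak_deriv l i j v V"
    using assms unfolding H2star_def H2_def by blast
  then show ?thesis
    using is_weak_deriv_weak_deriv by blast
qed

lemma H2star_L2: "v \<in> H2star l \<Longrightarrow> v \<in> L2 l"
  by (simp add: H2star_def H2_def)

lemma H2star_deriv_L2: "v \<in> H2star l \<Longrightarrow> i + j \<le> 2 \<Longrightarrow> weak_deriv l i j v \<in> L2 l"
  using H2star_weak_deriv by (simp add: is_weak_deriv_def)

lemma H2star_test:
  assumes "v \<in> H2star l" "f \<in> test_functions l"
  shows "innerL2 l (weak_deriv l 1 0 v) f = - innerL2 l v (pdx f)"
    and "innerL2 l (weak_deriv l 0 1 v) f = - innerL2 l v (pdy f)"
    and "innerL2 l (weak_deriv l 2 0 v) f = innerL2 l v (pdx (pdx f))"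
    and "innerL2 l (weak_deriv l 0 2 v) f = innerL2 l v (pdy (pdy f))"
    and "innerL2 l (weak_deriv l 1 1 v) f = innerL2 l v (pdx (pdy f))"
  using H2star_weak_deriv[OF assms(1), of 1 0] H2star_weak_deriv[OF assms(1), of 0 1]
    H2star_weak_deriv[OF assms(1), of 2 0] H2star_weak_deriv[OF assms(1), of 0 2]
    H2star_weak_deriv[OF assms(1), of 1 1] assms(2)
  unfolding is_weak_deriv_def by (auto simp: numeral_2_eq_2)

lemma compact_in_deriv:
  assumes "compact_in lo hi a"
  shows "compact_in lo hi (deriv a)"
proof -
  obtain c d where cd: "lo < c" "d < hi" "\<And>x. x \<notin> {c..d} \<Longrightarrow> a x = 0"
    using assms unfolding compact_in_def by blast
  have "deriv a x = 0" if "x \<notin> {c..d}" for x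
  proof -
    have "open (- {c..d})" by (simp add: open_Compl)
    then have "\<forall>\<^sub>F y in nhds x. a y = 0"
      using that cd(3) by (auto simp: eventually_nhds)
    then have "deriv a x = deriv (\<lambda>_. 0) x"
      by (rule deriv_cong_ev) simp
    then show ?thesis by simp
  qed
  with cd show ?thesis unfolding compact_in_def by blast
qed

lemma compact_in_mult: "compact_in lo hi b \<Longrightarrow> compact_in lo hi (\<lambda>x. a x * b x)"
  unfolding compact_in_def by (metis mult_zero_right)

lemma H2star_parts_compact:
  assumes v: "v \<in> H2star l" and s: "smooth a" "smooth b"
    and c: "compact_in 0 pi a" "compact_in (-l) l b"
  shows "innerL2 l (weak_deriv l 1 0 v) (sep a b) = - innerL2 l v (sep (deriv a) b)"
    and "innerL2 l (weak_deriv l 0 1 v) (sep a b) = - innerL2 l v (sep a (deriv b))"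
    and "innerL2 l (weak_deriv l 2 0 v) (sep a b) = - innerL2 l (weak_deriv l 1 0 v) (sep (deriv a) b)"
    and "innerL2 l (weak_deriv l 0 2 v) (sep a b) = - innerL2 l (weak_deriv l 0 1 v) (sep a (deriv b))"
    and "innerL2 l (weak_deriv l 1 1 v) (sep a b) = - innerL2 l (weak_deriv l 0 1 v) (sep (deriv a) b)"
proof -
  note t = test_function_sep[OF s c] test_function_sep[OF smooth_deriv[OF s(1)] s(2) compact_in_deriv[OF c(1)] c(2)]
    test_function_sep[OF s(1) smooth_deriv[OF s(2)] c(1) compact_in_deriv[OF c(2)]]
  show "innerL2 l (weak_deriv l 1 0 v) (sep a b) = - innerL2 l v (sep (deriv a) b)"
    "innerL2 l (weak_deriv l 0 1 v) (sep a b) = - innerL2 l v (sep a (deriv b))"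
    "innerL2 l (weak_deriv l 2 0 v) (sep a b) = - innerL2 l (weak_deriv l 1 0 v) (sep (deriv a) b)"
    "innerL2 l (weak_deriv l 0 2 v) (sep a b) = - innerL2 l (weak_deriv l 0 1 v) (sep a (deriv b))"
    "innerL2 l (weak_deriv l 1 1 v) (sep a b) = - innerL2 l (weak_deriv l 0 1 v) (sep (deriv a) b)"
    by (simp_all only: H2star_test[OF v] t pdx_sep pdy_sep s smooth_deriv minus_minus)
qed

lemma cutoff_product_props:
  assumes "smooth a"
  shows "smooth (\<lambda>x. a x * cutoff lo hi k x)"
    and "deriv (\<lambda>x. a x * cutoff lo hi k x) =
           (\<lambda>x. deriv a x * cutoff lo hi k x + a x * deriv (cutoff lo hi k) x)"
    and "lo < x \<Longrightarrow> x < hi \<Longrightarrow> (\<lambda>k. a x * cutoff lo hi k x) \<longlonglongrightarrow> a x"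
    and "lo < x \<Longrightarrow> x < hi \<Longrightarrow> (\<lambda>k. a x * deriv (cutoff lo hi k) x) \<longlonglongrightarrow> 0"
    and "\<bar>a x\<bar> \<le> C \<Longrightarrow> \<bar>a x * cutoff lo hi k x\<bar> \<le> C"
proof -
  show "smooth (\<lambda>x. a x * cutoff lo hi k x)"
    by (intro smooth_mult assms smooth_cutoff)
  show "deriv (\<lambda>x. a x * cutoff lo hi k x) =
           (\<lambda>x. deriv a x * cutoff lo hi k x + a x * deriv (cutoff lo hi k) x)"
    by (intro ext DERIV_imp_deriv cutoff_product_DERIV assms)
  show "(\<lambda>k. a x * cutoff lo hi k x) \<longlonglongrightarrow> a x" if "lo < x" "x < hi"
    using tendsto_mult[OF tendsto_const cutoff_tendsto[OF that], of "a x"] by simp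
  show "(\<lambda>k. a x * deriv (cutoff lo hi k) x) \<longlonglongrightarrow> 0" if "lo < x" "x < hi"
    using deriv_cutoff_eventually_0[OF that] by (intro tendsto_eventually) (auto elim: eventually_mono)
  show "\<bar>a x * cutoff lo hi k x\<bar> \<le> C" if "\<bar>a x\<bar> \<le> C"
    using that cutoff_bounds[of lo hi k x] mult_right_le_one_le[of "\<bar>a x\<bar>" "cutoff lo hi k x"]
    by (simp add: abs_mult)
qed

text \<open>
  Let \<open>D\<close> be the weak \<open>x\<close>-derivative of \<open>E\<close>, tested against products of compact support. The formula
  extends to arbitrary smooth factors as soon as the slope of the \<open>x\<close>-cutoff contributes nothing in the
  limit. The \<open>x\<close>-cutoff is removed first, with the factor in \<open>y\<close> still compactly supported, because the
  contribution of the slope may have to be transformed by a further integration by parts in \<open>y\<close>.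
\<close>

lemma extend_parts_x:
  assumes D: "D \<in> L2 l" and E: "E \<in> L2 l" and s: "smooth a" "smooth b"
    and parts: "\<And>a b. smooth a \<Longrightarrow> smooth b \<Longrightarrow> compact_in 0 pi a \<Longrightarrow> compact_in (-l) l b \<Longrightarrow>
        innerL2 l D (sep a b) = - innerL2 l E (sep (deriv a) b)"
    and decay: "\<And>b. smooth b \<Longrightarrow> compact_in (-l) l b \<Longrightarrow>
        (\<lambda>k. innerL2 l E (sep (\<lambda>x. a x * deriv (cutoff 0 pi k) x) b)) \<longlonglongrightarrow> 0"
  shows "innerL2 l D (sep a b) = - innerL2 l E (sep (deriv a) b)"
proof -
  obtain A where A: "\<And>x. x \<in> {0..pi} \<Longrightarrow> \<bar>a x\<bar> \<le> A"
    using smooth_bounded_on[OF s(1)] by metis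
  obtain A' where A': "\<And>x. x \<in> {0..pi} \<Longrightarrow> \<bar>deriv a x\<bar> \<le> A'"
    using smooth_bounded_on[OF smooth_deriv[OF s(1)]] by metis
  note sm = cutoff_product_props(1)
  have 1: "innerL2 l D (sep a \<beta>) = - innerL2 l E (sep (deriv a) \<beta>)"
    if \<beta>: "smooth \<beta>" "compact_in (-l) l \<beta>" for \<beta>
  proof -
    obtain B where B: "\<And>y. y \<in> {-l..l} \<Longrightarrow> \<bar>\<beta> y\<bar> \<le> B"
      using smooth_bounded_on[OF \<beta>(1)] by metis
    have "innerL2 l D (sep (\<lambda>x. a x * cutoff 0 pi k x) \<beta>) =
        - innerL2 l E (sep (\<lambda>x. deriv a x * cutoff 0 pi k x) \<beta>)
        - innerL2 l E (sep (\<lambda>x. a x * deriv (cutoff 0 pi k) x) \<beta>)" for k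
    proof -
      have "innerL2 l D (sep (\<lambda>x. a x * cutoff 0 pi k x) \<beta>) =
          - innerL2 l E (\<lambda>z. sep (\<lambda>x. deriv a x * cutoff 0 pi k x) \<beta> z
              + sep (\<lambda>x. a x * deriv (cutoff 0 pi k) x) \<beta> z)"
        using parts[OF sm[OF s(1)] \<beta>(1) compact_in_cutoff \<beta>(2)]
        by (simp add: cutoff_product_props(2)[OF s(1)] sep_def[abs_def] distrib_right)
      also have "\<dots> = - innerL2 l E (sep (\<lambda>x. deriv a x * cutoff 0 pi k x) \<beta>)
        - innerL2 l E (sep (\<lambda>x. a x * deriv (cutoff 0 pi k) x) \<beta>)"
        by (subst innerL2_add_right) (auto intro!: sep_smooth_L2 smooth_mult smooth_deriv s \<beta> smooth_cutoff E)
      finally show ?thesis .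
    qed
    moreover have "(\<lambda>k. innerL2 l D (sep (\<lambda>x. a x * cutoff 0 pi k x) \<beta>)) \<longlonglongrightarrow> innerL2 l D (sep a \<beta>)"
      using A B by (intro innerL2_sep_tendsto[where A = A and B = B] D smooth_continuous sm s \<beta> tendsto_const
          cutoff_product_props(3,5)) auto
    moreover have "(\<lambda>k. - innerL2 l E (sep (\<lambda>x. deriv a x * cutoff 0 pi k x) \<beta>)
        - innerL2 l E (sep (\<lambda>x. a x * deriv (cutoff 0 pi k) x) \<beta>)) \<longlonglongrightarrow> - innerL2 l E (sep (deriv a) \<beta>) - 0"
      using A' B by (intro tendsto_diff tendsto_minus decay \<beta> innerL2_sep_tendsto[where A = A' and B = B] E
          smooth_continuous sm smooth_deriv s tendsto_const cutoff_product_props(3,5)) auto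
    ultimately show ?thesis
      using LIMSEQ_unique by fastforce
  qed
  obtain B where B: "\<And>y. y \<in> {-l..l} \<Longrightarrow> \<bar>b y\<bar> \<le> B"
    using smooth_bounded_on[OF s(2)] by metis
  have "(\<lambda>k. innerL2 l D (sep a (\<lambda>y. b y * cutoff (-l) l k y))) \<longlonglongrightarrow> innerL2 l D (sep a b)"
    using A B by (intro innerL2_sep_tendsto[where A = A and B = B] D smooth_continuous sm s tendsto_const
          cutoff_product_props(3,5)) auto
  moreover have "(\<lambda>k. - innerL2 l E (sep (deriv a) (\<lambda>y. b y * cutoff (-l) l k y)))
      \<longlonglongrightarrow> - innerL2 l E (sep (deriv a) b)"
    using A' B by (intro tendsto_minus innerL2_sep_tendsto[where A = A' and B = B] E smooth_continuous sm
          smooth_deriv s tendsto_const cutoff_product_props(3,5)) auto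
  ultimately show ?thesis
    using 1[OF sm[OF s(2)] compact_in_cutoff] LIMSEQ_unique by fastforce
qed

lemma extend_parts_x_vanishing:
  assumes D: "D \<in> L2 l" and E: "E \<in> L2 l" and s: "smooth a" "smooth b"
    and parts: "\<And>a b. smooth a \<Longrightarrow> smooth b \<Longrightarrow> compact_in 0 pi a \<Longrightarrow> compact_in (-l) l b \<Longrightarrow>
        innerL2 l D (sep a b) = - innerL2 l E (sep (deriv a) b)"
    and zero: "a 0 = 0" "a pi = 0"
  shows "innerL2 l D (sep a b) = - innerL2 l E (sep (deriv a) b)"
proof (rule extend_parts_x[OF D E s parts])
  fix b assume b: "smooth b" "compact_in (-l) l b"
  obtain C where C: "\<And>k x. x \<in> {0..pi} \<Longrightarrow> \<bar>a x * deriv (cutoff 0 pi k) x\<bar> \<le> C"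
    using cutoff_product_bounded[OF s(1) zero] by metis
  obtain B where B: "\<And>y. y \<in> {-l..l} \<Longrightarrow> \<bar>b y\<bar> \<le> B"
    using smooth_bounded_on[OF b(1)] by metis
  have "(\<lambda>k. innerL2 l E (sep (\<lambda>x. a x * deriv (cutoff 0 pi k) x) b)) \<longlonglongrightarrow> innerL2 l E (sep (\<lambda>_. 0) b)"
    using B C by (intro innerL2_sep_tendsto[where A = C and B = B] E smooth_continuous smooth_mult
        smooth_deriv smooth_cutoff s b tendsto_const cutoff_product_props(4)) auto
  then show "(\<lambda>k. innerL2 l E (sep (\<lambda>x. a x * deriv (cutoff 0 pi k) x) b)) \<longlonglongrightarrow> 0"
    by (simp add: innerL2_def sep_def)
qed

lemma extend_parts_y_vanishing:
  assumes D: "D \<in> L2 l" and E: "E \<in> L2 l" and s: "smooth a" "smooth b"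
    and parts: "\<And>a b. smooth a \<Longrightarrow> smooth b \<Longrightarrow> compact_in 0 pi a \<Longrightarrow> compact_in (-l) l b \<Longrightarrow>
        innerL2 l D (sep a b) = - innerL2 l E (sep a (deriv b))"
    and zero: "b (-l) = 0" "b l = 0"
  shows "innerL2 l D (sep a b) = - innerL2 l E (sep a (deriv b))"
proof -
  define \<alpha> where "\<alpha> = (\<lambda>k x. a x * cutoff 0 pi k x)"
  define \<beta> where "\<beta> = (\<lambda>k y. b y * cutoff (-l) l k y)"
  have sm: "smooth (\<alpha> k)" "smooth (\<beta> k)" for k
    unfolding \<alpha>_def \<beta>_def by (intro cutoff_product_props(1) s)+
  obtain A where A: "\<And>x. x \<in> {0..pi} \<Longrightarrow> \<bar>a x\<bar> \<le> A"
    using smooth_bounded_on[OF s(1)] by metis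
  obtain B where B: "\<And>y. y \<in> {-l..l} \<Longrightarrow> \<bar>b y\<bar> \<le> B"
    using smooth_bounded_on[OF s(2)] by metis
  obtain B' where B': "\<And>y. y \<in> {-l..l} \<Longrightarrow> \<bar>deriv b y\<bar> \<le> B'"
    using smooth_bounded_on[OF smooth_deriv[OF s(2)]] by metis
  obtain C where C: "\<And>k y. y \<in> {-l..l} \<Longrightarrow> \<bar>b y * deriv (cutoff (-l) l k) y\<bar> \<le> C"
    using cutoff_product_bounded[OF s(2) zero] by metis
  have d: "deriv (\<beta> k) y = deriv b y * cutoff (-l) l k y + b y * deriv (cutoff (-l) l k) y" for k y
    unfolding \<beta>_def by (simp add: cutoff_product_props(2)[OF s(2)])
  have bd: "\<bar>deriv (\<beta> k) y\<bar> \<le> B' + C" if "-l < y" "y < l" for k y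
    using cutoff_product_props(5)[OF smooth_deriv[OF s(2)], of y B' "-l" l k] B'[of y] C[of y k] that
    unfolding d by (intro order_trans[OF abs_triangle_ineq] add_mono) auto
  have ld: "(\<lambda>k. deriv (\<beta> k) y) \<longlonglongrightarrow> deriv b y" if "-l < y" "y < l" for y
    unfolding d using tendsto_add[OF cutoff_product_props(3)[OF smooth_deriv[OF s(2)] that]
        cutoff_product_props(4)[OF s(2) that]] by simp
  have "(\<lambda>k. innerL2 l D (sep (\<alpha> k) (\<beta> k))) \<longlonglongrightarrow> innerL2 l D (sep a b)"
    using A B unfolding \<alpha>_def \<beta>_def
    by (intro innerL2_sep_tendsto[where A = A and B = B] D smooth_continuous cutoff_product_props s) auto
  moreover have "(\<lambda>k. - innerL2 l E (sep (\<alpha> k) (deriv (\<beta> k)))) \<longlonglongrightarrow> - innerL2 l E (sep a (deriv b))"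
  proof (intro tendsto_minus innerL2_sep_tendsto[where A = A and B = "B' + C"] E smooth_continuous sm smooth_deriv bd ld)
    show "\<bar>\<alpha> k x\<bar> \<le> A" if "0 < x" "x < pi" for k x
      unfolding \<alpha>_def using A that by (intro cutoff_product_props(5) s) auto
    show "(\<lambda>k. \<alpha> k x) \<longlonglongrightarrow> a x" if "0 < x" "x < pi" for x
      unfolding \<alpha>_def using that by (intro cutoff_product_props(3) s)
  qed
  moreover have "innerL2 l D (sep (\<alpha> k) (\<beta> k)) = - innerL2 l E (sep (\<alpha> k) (deriv (\<beta> k)))" for k
    unfolding \<alpha>_def \<beta>_def by (intro parts cutoff_product_props(1) s compact_in_cutoff)
  ultimately show ?thesis
    using LIMSEQ_unique by fastforce
qed

lemma measure_strips:
  assumes "0 < l" "0 < h"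
  defines "S \<equiv> Omega l \<inter> (cbox (0, -l) (h, l) \<union> cbox (pi - h, -l) (pi, l))"
  shows "S \<in> sets (lebesgue_on (Omega l))" "measure (lebesgue_on (Omega l)) S \<le> 4 * l * h"
proof -
  have Os: "Omega l \<in> sets lebesgue"
    by (rule fmeasurableD[OF Omega_lmeasurable])
  have U: "cbox (0, -l) (h, l) \<union> cbox (pi - h, -l) (pi, l) \<in> lmeasurable"
    by (intro fmeasurable.Un lmeasurable_cbox)
  then have Sl: "S \<in> sets lebesgue"
    unfolding S_def using Os fmeasurableD[OF U] by (intro sets.Int)
  then show "S \<in> sets (lebesgue_on (Omega l))"
    using Os by (subst sets_restrict_space_iff) (auto simp: S_def)
  have "measure (lebesgue_on (Omega l)) S = measure lebesgue S"
    using Os by (intro measure_restrict_space) (auto simp: S_def)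
  also have "\<dots> \<le> measure lebesgue (cbox (0, -l) (h, l) \<union> cbox (pi - h, -l) (pi, l))"
    by (rule measure_mono_fmeasurable[OF _ Sl U]) (auto simp: S_def)
  also have "\<dots> \<le> measure lebesgue (cbox (0, -l) (h, l)) + measure lebesgue (cbox (pi - h, -l) (pi, l))"
    by (rule measure_Un_le) auto
  also have "\<dots> = 4 * l * h"
    using assms(1,2) by (simp add: content_Pair)
  finally show "measure (lebesgue_on (Omega l)) S \<le> 4 * l * h" .
qed

text \<open>
  This is where the boundary condition on the short edges enters. The slope of the cutoff is of order
  \<open>k\<close> on two strips of area of order \<open>1 / k\<close>, and the continuous representative of \<open>v\<close> is uniformly small
  there because it vanishes on the edges.
\<close>

lemma boundary_strip_decay:
  assumes l: "0 < l" and v: "v \<in> H2star l" and a: "smooth a" and b: "smooth b"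
  shows "(\<lambda>k. innerL2 l v (sep (\<lambda>x. a x * deriv (cutoff 0 pi k) x) b)) \<longlonglongrightarrow> 0"
proof -
  obtain W where W: "continuous_on ({0..pi} \<times> {-l..l}) W" "eqL2 l v W"
      and W0: "\<And>z. z \<in> {0, pi} \<times> {-l..l} \<Longrightarrow> W z = 0"
    using v unfolding H2star_def by blast
  obtain A where A: "A > 0" "\<And>x. x \<in> {0..pi} \<Longrightarrow> \<bar>a x\<bar> \<le> A"
    using smooth_bounded_on[OF a] by metis
  obtain B where B: "B > 0" "\<And>y. y \<in> {-l..l} \<Longrightarrow> \<bar>b y\<bar> \<le> B"
    using smooth_bounded_on[OF b] by metis
  obtain M where M: "M > 0" "\<And>lo hi k x. \<bar>deriv (cutoff lo hi k) x\<bar> \<le> M * real (Suc k)"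
    using deriv_cutoff_bound by metis
  have unif: "uniformly_continuous_on ({0..pi} \<times> {-l..l}) W"
    by (intro compact_uniformly_continuous W compact_Times compact_Icc)
  define C where "C = A * M * B * (8 * l)"
  have C: "C > 0" using A B M l by (simp add: C_def)
  show ?thesis
  proof (rule LIMSEQ_I)
    fix e :: real assume e: "0 < e"
    \<comment> \<open>The integral is at most \<open>\<epsilon> * C\<close>, once the strips are so thin that \<open>\<bar>W\<bar> \<le> \<epsilon>\<close> on them.\<close>
    define \<epsilon> where "\<epsilon> = e / (2 * C)"
    have \<epsilon>: "\<epsilon> > 0" using e C by (simp add: \<epsilon>_def)
    obtain d where d: "d > 0" "\<And>z w. z \<in> {0..pi} \<times> {-l..l} \<Longrightarrow> w \<in> {0..pi} \<times> {-l..l} \<Longrightarrow>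
        dist w z < d \<Longrightarrow> dist (W w) (W z) < \<epsilon>"
      using unif \<epsilon> unfolding uniformly_continuous_on_def by blast
    obtain N :: nat where N: "2 / d < real N"
      using reals_Archimedean2 by blast
    have "\<bar>innerL2 l v (sep (\<lambda>x. a x * deriv (cutoff 0 pi k) x) b)\<bar> < e" if k: "k \<ge> N" for k
    proof -
      define h where "h = 2 / real (Suc k)"
      have h: "h > 0" by (simp add: h_def)
      have hd: "h < d"
      proof -
        have "2 / d < real (Suc k)" using N k by linarith
        then show ?thesis using d(1) by (simp add: h_def field_simps del: of_nat_Suc)
      qed
      define S where "S = Omega l \<inter> (cbox (0, -l) (h, l) \<union> cbox (pi - h, -l) (pi, l))"
      note S = measure_strips[OF l h, folded S_def]
      define K where "K = \<epsilon> * (A * (M * real (Suc k)) * B)"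
      have K: "K \<ge> 0" using \<epsilon> A B M by (simp add: K_def)
      interpret finite_measure "lebesgue_on (Omega l)" by (rule finite_measure_Omega)
      have int: "integrable (lebesgue_on (Omega l)) (\<lambda>z. K * indicator S z)"
        using S(1) by (intro Bochner_Integration.integrable_mult_right integrable_real_indicator)
          (auto simp: emeasure_eq_measure)
      have near: "\<bar>W z\<bar> \<le> \<epsilon>" if "z \<in> S" for z
      proof -
        obtain x y where z: "z = (x, y)" by (cases z)
        from that z have xy: "0 < x" "x < pi" "-l < y" "y < l" "x \<le> h \<or> pi - h \<le> x"
          by (auto simp: S_def Omega_def)
        have "\<exists>x0\<in>{0, pi}. \<bar>x - x0\<bar> < d"
          using xy hd by (smt (verit) insertCI)
        then obtain x0 where x0: "x0 \<in> {0, pi}" "\<bar>x - x0\<bar> < d" by blast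
        have "dist (W (x, y)) (W (x0, y)) < \<epsilon>"
          using x0 xy by (intro d(2)) (auto simp: dist_prod_def dist_real_def)
        moreover have "W (x0, y) = 0"
          using x0 xy by (intro W0) auto
        ultimately show ?thesis by (simp add: z dist_real_def)
      qed
      have bound: "\<bar>W z * sep (\<lambda>x. a x * deriv (cutoff 0 pi k) x) b z\<bar> \<le> K * indicator S z"
        if z: "z \<in> Omega l" for z
      proof (cases "z \<in> S")
        case True
        have ab: "\<bar>a (fst z)\<bar> \<le> A" "\<bar>b (snd z)\<bar> \<le> B"
          using z by (auto simp: Omega_def intro!: A(2) B(2))
        have "\<bar>a (fst z) * deriv (cutoff 0 pi k) (fst z)\<bar> \<le> A * (M * real (Suc k))"
          unfolding abs_mult using ab M A by (intro mult_mono) auto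
        then have "\<bar>sep (\<lambda>x. a x * deriv (cutoff 0 pi k) x) b z\<bar> \<le> A * (M * real (Suc k)) * B"
          unfolding sep_def using ab A M by (subst abs_mult) (intro mult_mono, auto)
        then have "\<bar>W z * sep (\<lambda>x. a x * deriv (cutoff 0 pi k) x) b z\<bar> \<le> K"
          unfolding K_def using near[OF True] \<epsilon> by (subst abs_mult) (intro mult_mono, auto)
        with True show ?thesis by simp
      next
        case False
        then have "deriv (cutoff 0 pi k) (fst z) = 0"
          using z by (intro deriv_cutoff_strip) (auto simp: S_def Omega_def h_def)
        with False show ?thesis by (simp add: sep_def)
      qed
      have "\<bar>innerL2 l v (sep (\<lambda>x. a x * deriv (cutoff 0 pi k) x) b)\<bar> \<le> (\<integral>z. K * indicator S z \<partial>lebesgue_on (Omega l))"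
        unfolding innerL2_def
      proof (rule order_trans[OF integral_abs_bound Bochner_Integration.integral_mono_AE])
        show "integrable (lebesgue_on (Omega l)) (\<lambda>z. \<bar>v z * sep (\<lambda>x. a x * deriv (cutoff 0 pi k) x) b z\<bar>)"
          by (intro integrable_abs L2_product_integrable H2star_L2[OF v] sep_smooth_L2 smooth_mult
              smooth_deriv smooth_cutoff a b)
        have "AE z in lebesgue_on (Omega l). z \<in> Omega l"
          by (rule AE_I2) simp
        then show "AE z in lebesgue_on (Omega l). \<bar>v z * sep (\<lambda>x. a x * deriv (cutoff 0 pi k) x) b z\<bar> \<le> K * indicator S z"
          using W(2) unfolding eqL2_def
          by eventually_elim (use bound in simp)
      qed (rule int)
      also have "\<dots> = K * measure (lebesgue_on (Omega l)) S"
      proof -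
        have "S \<inter> Omega l = S" by (auto simp: S_def)
        then show ?thesis using S(1) by simp
      qed
      also have "\<dots> \<le> K * (4 * l * h)"
        by (rule mult_left_mono[OF S(2) K])
      also have "\<dots> = \<epsilon> * C"
        by (simp add: K_def C_def h_def field_simps del: of_nat_Suc)
      also have "\<dots> < e"
        using e C by (simp add: \<epsilon>_def)
      finally show ?thesis .
    qed
    then show "\<exists>no. \<forall>n\<ge>no. norm (innerL2 l v (sep (\<lambda>x. a x * deriv (cutoff 0 pi n) x) b) - 0) < e"
      by auto
  qed
qed

text \<open>
  Integration by parts against smooth products, without traces. A boundary term on the short edges is
  absent if \<open>v\<close> itself or a tangential derivative of \<open>v\<close> is left there, or if the factor \<open>a\<close> vanishes;
  on the long edges nothing is known about \<open>v\<close>, so the factor \<open>b\<close> has to vanish.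
\<close>

lemma H2star_parts:
  assumes l: "0 < l" and v: "v \<in> H2star l" and s: "smooth a" "smooth b"
  shows "innerL2 l (weak_deriv l 1 0 v) (sep a b) = - innerL2 l v (sep (deriv a) b)"
    and "innerL2 l (weak_deriv l 1 1 v) (sep a b) = - innerL2 l (weak_deriv l 0 1 v) (sep (deriv a) b)"
    and "a 0 = 0 \<Longrightarrow> a pi = 0 \<Longrightarrow>
      innerL2 l (weak_deriv l 2 0 v) (sep a b) = - innerL2 l (weak_deriv l 1 0 v) (sep (deriv a) b)"
    and "b (-l) = 0 \<Longrightarrow> b l = 0 \<Longrightarrow>
      innerL2 l (weak_deriv l 0 1 v) (sep a b) = - innerL2 l v (sep a (deriv b))"
    and "b (-l) = 0 \<Longrightarrow> b l = 0 \<Longrightarrow>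
      innerL2 l (weak_deriv l 0 2 v) (sep a b) = - innerL2 l (weak_deriv l 0 1 v) (sep a (deriv b))"
proof -
  have L: "v \<in> L2 l" "weak_deriv l 1 0 v \<in> L2 l" "weak_deriv l 0 1 v \<in> L2 l" "weak_deriv l 1 1 v \<in> L2 l"
     "weak_deriv l 2 0 v \<in> L2 l" "weak_deriv l 0 2 v \<in> L2 l"
    using v by (auto intro: H2star_L2 H2star_deriv_L2)
  note c = H2star_parts_compact[OF v]
  show "innerL2 l (weak_deriv l 1 0 v) (sep a b) = - innerL2 l v (sep (deriv a) b)"
    by (rule extend_parts_x[OF L(2,1) s c(1) boundary_strip_decay[OF l v s(1)]])
  show "innerL2 l (weak_deriv l 1 1 v) (sep a b) = - innerL2 l (weak_deriv l 0 1 v) (sep (deriv a) b)"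
  proof (rule extend_parts_x[OF L(4,3) s c(5)])
    fix b assume b: "smooth b" "compact_in (-l) l b"
    \<comment> \<open>A trace of \<open>v_y\<close> on the short edges is not available; the \<open>y\<close>-derivative is moved to \<open>b\<close> instead.\<close>
    have "innerL2 l (weak_deriv l 0 1 v) (sep (\<lambda>x. a x * deriv (cutoff 0 pi k) x) b)
        = - innerL2 l v (sep (\<lambda>x. a x * deriv (cutoff 0 pi k) x) (deriv b))" for k
      using compact_in_cutoff[of 0 pi "\<lambda>_. 1" k]
      by (intro c(2) smooth_mult smooth_deriv smooth_cutoff s b compact_in_mult compact_in_deriv) simp
    then show "(\<lambda>k. innerL2 l (weak_deriv l 0 1 v) (sep (\<lambda>x. a x * deriv (cutoff 0 pi k) x) b)) \<longlonglongrightarrow> 0"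
      using tendsto_minus[OF boundary_strip_decay[OF l v s(1) smooth_deriv[OF b(1)]]] by simp
  qed
  show "innerL2 l (weak_deriv l 2 0 v) (sep a b) = - innerL2 l (weak_deriv l 1 0 v) (sep (deriv a) b)"
    if "a 0 = 0" "a pi = 0"
    by (rule extend_parts_x_vanishing[OF L(5,2) s c(3) that])
  show "innerL2 l (weak_deriv l 0 1 v) (sep a b) = - innerL2 l v (sep a (deriv b))"
    if "b (-l) = 0" "b l = 0"
    by (rule extend_parts_y_vanishing[OF L(3,1) s c(2) that])
  show "innerL2 l (weak_deriv l 0 2 v) (sep a b) = - innerL2 l (weak_deriv l 0 1 v) (sep a (deriv b))"
    if "b (-l) = 0" "b l = 0"
    by (rule extend_parts_y_vanishing[OF L(6,3) s c(4) that])
qed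


section \<open>The Poincare inequality\<close>

text \<open>
  Polynomials in two variables as sums of products, so that a linear identity has to be verified only
  for a single product.
\<close>

inductive poly2 :: "(real \<times> real \<Rightarrow> real) \<Rightarrow> bool" where
  monomial: "poly2 (sep (\<lambda>x. c * x ^ i) (\<lambda>y. y ^ j))"
| add: "poly2 f \<Longrightarrow> poly2 g \<Longrightarrow> poly2 (\<lambda>z. f z + g z)"

lemma poly2_mult: "poly2 f \<Longrightarrow> poly2 g \<Longrightarrow> poly2 (\<lambda>z. f z * g z)"
proof (induction rule: poly2.induct)
  case (monomial c i j)
  from monomial show ?case
  proof (induction rule: poly2.induct)
    case (monomial d k m)
    have "(\<lambda>z. sep (\<lambda>x. c * x ^ i) (\<lambda>y. y ^ j) z * sep (\<lambda>x. d * x ^ k) (\<lambda>y. y ^ m) z) =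
            sep (\<lambda>x. (c * d) * x ^ (i + k)) (\<lambda>y. y ^ (j + m))"
      by (simp add: sep_def fun_eq_iff power_add algebra_simps)
    then show ?case using poly2.monomial by metis
  next
    case (add f g)
    then show ?case using poly2.add by (simp add: distrib_left)
  qed
next
  case (add f g)
  then show ?case using poly2.add by (simp add: distrib_right)
qed

lemma poly2_real_polynomial_function:
  fixes f :: "real \<times> real \<Rightarrow> real"
  shows "real_polynomial_function f \<Longrightarrow> poly2 f"
proof (induction rule: real_polynomial_function.induct)
  case (linear f)
  interpret bounded_linear f by (rule linear)
  have "f z = sep (\<lambda>x. f (1, 0) * x ^ 1) (\<lambda>y. y ^ 0) z + sep (\<lambda>x. f (0, 1) * x ^ 0) (\<lambda>y. y ^ 1) z" for z
  proof -
    have "z = fst z *\<^sub>R (1, 0) + snd z *\<^sub>R (0, 1)" by (cases z) simp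
    then have "f z = fst z *\<^sub>R f (1, 0) + snd z *\<^sub>R f (0, 1)"
      by (metis add scale)
    then show ?thesis by (simp add: sep_def mult.commute)
  qed
  then have "f = (\<lambda>z. sep (\<lambda>x. f (1, 0) * x ^ 1) (\<lambda>y. y ^ 0) z + sep (\<lambda>x. f (0, 1) * x ^ 0) (\<lambda>y. y ^ 1) z)"
    by blast
  then show ?case
    using poly2.add[OF poly2.monomial[of "f (1, 0)" 1 0] poly2.monomial[of "f (0, 1)" 0 1]] by metis
next
  case (const c)
  have "(\<lambda>z. c) = sep (\<lambda>x. c * x ^ 0) (\<lambda>y. y ^ 0)" by (simp add: sep_def fun_eq_iff)
  then show ?case using poly2.monomial by metis
qed (auto intro: poly2.add poly2_mult)

lemma poly2_continuous: "poly2 f \<Longrightarrow> continuous_on S f"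
proof (induction rule: poly2.induct)
  case (monomial c i j)
  then show ?case by (intro continuous_sep continuous_intros)
qed (intro continuous_on_add)

text \<open>
  For each \<open>y\<close> this is the solution of \<open>g_xx = Q\<close> on \<open>[0, pi]\<close> with \<open>g = 0\<close> at both ends.
\<close>

definition dirichlet_primitive :: "(real \<times> real \<Rightarrow> real) \<Rightarrow> real \<times> real \<Rightarrow> real" where
  "dirichlet_primitive Q z =
     integral {0..fst z} (\<lambda>s. (fst z - s) * Q (s, snd z))
     - fst z / pi * integral {0..pi} (\<lambda>s. (pi - s) * Q (s, snd z))"

lemma slice_integrable:
  assumes "continuous_on UNIV (Q :: real \<times> real \<Rightarrow> real)"
  shows "(\<lambda>s. (x - s) * Q (s, y)) integrable_on {a..b}" "(\<lambda>s. Q (s, y)) integrable_on {a..b}"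
    "(\<lambda>s. (Q (s, y))\<^sup>2) integrable_on {a..b}" "(\<lambda>s. \<bar>Q (s, y)\<bar>) integrable_on {a..b}"
proof -
  have "continuous_on {a..b} (\<lambda>s. Q (s, y))"
    by (rule continuous_on_compose2[OF assms]) (auto intro!: continuous_intros)
  then show "(\<lambda>s. (x - s) * Q (s, y)) integrable_on {a..b}" "(\<lambda>s. Q (s, y)) integrable_on {a..b}"
    "(\<lambda>s. (Q (s, y))\<^sup>2) integrable_on {a..b}" "(\<lambda>s. \<bar>Q (s, y)\<bar>) integrable_on {a..b}"
    by (auto intro!: integrable_continuous_interval continuous_intros)
qed

lemma DERIV_monomial: "((\<lambda>x::real. x ^ Suc n / real (Suc n)) has_real_derivative x ^ n) (at x)"
  using DERIV_cdivide[OF DERIV_pow[of "Suc n" x], of "real (Suc n)"] by simp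

text \<open>
  By two integrations by parts, \<open>(v, Q) = (v, g_xx) = (v_xx, g)\<close>. The function \<open>g\<close> agrees with the
  primitive on the closed plate only, since for negative \<open>x\<close> the integral over \<open>{0..x}\<close> is zero.
\<close>

lemma poly2_dirichlet:
  assumes l: "0 < l"
  shows "poly2 Q \<Longrightarrow> \<exists>g. continuous_on UNIV g \<and>
      (\<forall>z \<in> {0..pi} \<times> {-l..l}. dirichlet_primitive Q z = g z) \<and>
      (\<forall>v \<in> H2star l. innerL2 l v Q = innerL2 l (weak_deriv l 2 0 v) g)"
proof (induction rule: poly2.induct)
  case (monomial c i j)
  define h where "h = (\<lambda>x::real. c / real (Suc i) * (x ^ Suc (Suc i) / real (Suc (Suc i))))"
  define k where "k = h pi / pi"
  define a where "a = (\<lambda>x. h x - x * k)"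
  have smh: "smooth h"
    unfolding h_def using smooth_mult[OF smooth_const smooth_power, of "c / real (Suc i) / real (Suc (Suc i))" "Suc (Suc i)"]
    by (simp add: field_simps)
  have sm: "smooth a" "smooth (\<lambda>y. y ^ j)"
    unfolding a_def by (intro smooth_diff smooth_mult smooth_const smooth_power smooth_ident smh)+
  have lin: "((\<lambda>x. x * k) has_real_derivative k) (at x)" for x
    by (auto intro!: derivative_eq_intros)
  have d1: "deriv a = (\<lambda>x. c / real (Suc i) * x ^ Suc i - k)"
    unfolding a_def h_def
    by (rule ext, rule DERIV_imp_deriv) (rule DERIV_diff[OF DERIV_cmult[OF DERIV_monomial] lin])
  have d2: "deriv (deriv a) = (\<lambda>x. c * x ^ i)"
  proof
    fix x
    have "((\<lambda>x. c * (x ^ Suc i / real (Suc i)) - k) has_real_derivative c * x ^ i - 0) (at x)"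
      by (rule DERIV_diff[OF DERIV_cmult[OF DERIV_monomial] DERIV_const])
    then show "deriv (deriv a) x = c * x ^ i"
      unfolding d1 by (intro DERIV_imp_deriv) (simp del: of_nat_Suc power_Suc)
  qed
  have hint: "integral {0..x} (\<lambda>s. (x - s) * (c * s ^ i * t)) = h x * t" if "0 \<le> x" for x t
  proof -
    define P where "P = (\<lambda>s. (c * t * x) * (s ^ Suc i / real (Suc i)) - (c * t) * (s ^ Suc (Suc i) / real (Suc (Suc i))))"
    have "(P has_real_derivative (c * t * x) * s ^ i - (c * t) * s ^ Suc i) (at s)" for s
      unfolding P_def by (rule DERIV_diff[OF DERIV_cmult[OF DERIV_monomial] DERIV_cmult[OF DERIV_monomial]])
    then have "integral {0..x} (\<lambda>s. (c * t * x) * s ^ i - (c * t) * s ^ Suc i) = P x - P 0"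
      by (rule FTC_real[OF that])
    moreover have "P x = h x * t" "P 0 = 0"
    proof -
      define n where "n = real (Suc i)"
      have "n > 0" "real (Suc (Suc i)) = n + 1" by (simp_all add: n_def)
      then show "P x = h x * t"
        unfolding P_def h_def n_def[symmetric] power_Suc by (simp add: field_simps)
    qed (simp add: P_def)
    ultimately show ?thesis
      by (simp add: algebra_simps)
  qed
  show ?case
  proof (intro exI[of _ "sep a (\<lambda>y. y ^ j)"] conjI ballI)
    show "continuous_on UNIV (sep a (\<lambda>y. y ^ j))"
      by (intro continuous_sep smooth_continuous sm)
    show "dirichlet_primitive (sep (\<lambda>x. c * x ^ i) (\<lambda>y. y ^ j)) z = sep a (\<lambda>y. y ^ j) z"
      if "z \<in> {0..pi} \<times> {-l..l}" for z
    proof -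
      have "dirichlet_primitive (sep (\<lambda>x. c * x ^ i) (\<lambda>y. y ^ j)) z =
          h (fst z) * snd z ^ j - fst z / pi * (h pi * snd z ^ j)"
        using that by (auto simp: dirichlet_primitive_def sep_def hint)
      then show ?thesis by (simp add: sep_def a_def k_def left_diff_distrib)
    qed
    fix v assume v: "v \<in> H2star l"
    have "innerL2 l (weak_deriv l 2 0 v) (sep a (\<lambda>y. y ^ j)) =
        - innerL2 l (weak_deriv l 1 0 v) (sep (deriv a) (\<lambda>y. y ^ j))"
      by (rule H2star_parts(3)[OF l v sm]) (auto simp: a_def k_def h_def)
    also have "\<dots> = innerL2 l v (sep (\<lambda>x. c * x ^ i) (\<lambda>y. y ^ j))"
      using H2star_parts(1)[OF l v smooth_deriv[OF sm(1)] sm(2)] by (simp add: d2)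
    finally show "innerL2 l v (sep (\<lambda>x. c * x ^ i) (\<lambda>y. y ^ j)) =
        innerL2 l (weak_deriv l 2 0 v) (sep a (\<lambda>y. y ^ j))" ..
  qed
next
  case (add f g)
  then obtain F G where F: "continuous_on UNIV F" "\<forall>z \<in> {0..pi} \<times> {-l..l}. dirichlet_primitive f z = F z"
      "\<forall>v \<in> H2star l. innerL2 l v f = innerL2 l (weak_deriv l 2 0 v) F"
    and G: "continuous_on UNIV G" "\<forall>z \<in> {0..pi} \<times> {-l..l}. dirichlet_primitive g z = G z"
      "\<forall>v \<in> H2star l. innerL2 l v g = innerL2 l (weak_deriv l 2 0 v) G"
    by blast
  note c = poly2_continuous[OF add.hyps(1), of UNIV] poly2_continuous[OF add.hyps(2), of UNIV]
  have L: "p \<in> L2 l" if "continuous_on UNIV p" for p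
    by (intro L2_continuous_closed continuous_on_subset[OF that]) auto
  show ?case
  proof (intro exI[of _ "\<lambda>z. F z + G z"] conjI ballI)
    show "continuous_on UNIV (\<lambda>z. F z + G z)"
      by (intro continuous_on_add F G)
    show "dirichlet_primitive (\<lambda>z. f z + g z) z = F z + G z" if "z \<in> {0..pi} \<times> {-l..l}" for z
    proof -
      have "dirichlet_primitive (\<lambda>z. f z + g z) z = dirichlet_primitive f z + dirichlet_primitive g z"
        unfolding dirichlet_primitive_def
        by (simp add: distrib_left Henstock_Kurzweil_Integration.integral_add slice_integrable c)
      then show ?thesis using F G that by simp
    qed
    show "innerL2 l v (\<lambda>z. f z + g z) = innerL2 l (weak_deriv l 2 0 v) (\<lambda>z. F z + G z)"
      if v: "v \<in> H2star l" for v
      using F G v by (simp add: innerL2_add_right L c H2star_L2 H2star_deriv_L2)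
  qed
qed

text \<open>
  The square of the distance of \<open>q\<close> to its mean has a nonnegative integral.
\<close>

lemma integral_square_le:
  fixes q :: "real \<Rightarrow> real"
  assumes "q integrable_on {0..pi}" "(\<lambda>s. (q s)\<^sup>2) integrable_on {0..pi}"
  shows "(integral {0..pi} q)\<^sup>2 \<le> pi * integral {0..pi} (\<lambda>s. (q s)\<^sup>2)"
proof -
  define m where "m = integral {0..pi} q / pi"
  have 1: "((\<lambda>s. (q s)\<^sup>2 - 2 * m * q s + m\<^sup>2) has_integral
      integral {0..pi} (\<lambda>s. (q s)\<^sup>2) - 2 * m * integral {0..pi} q + m\<^sup>2 * pi) {0..pi}"
    using assms has_integral_const_real[of "m\<^sup>2" 0 pi]
    by (intro has_integral_add has_integral_diff has_integral_mult_right integrable_integral)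
       (auto simp: mult.commute)
  have "0 \<le> integral {0..pi} (\<lambda>s. (q s)\<^sup>2) - 2 * m * integral {0..pi} q + m\<^sup>2 * pi"
  proof (rule has_integral_nonneg[OF 1])
    show "0 \<le> (q s)\<^sup>2 - 2 * m * q s + m\<^sup>2" for s
      using zero_le_power2[of "q s - m"] by (simp add: power2_diff algebra_simps)
  qed
  then show ?thesis
    by (simp add: m_def field_simps power2_eq_square)
qed

lemma dirichlet_primitive_bound:
  assumes Q: "continuous_on UNIV (Q :: real \<times> real \<Rightarrow> real)" and x: "0 \<le> x" "x \<le> pi"
  shows "(dirichlet_primitive Q (x, y))\<^sup>2 \<le> 4 * pi ^ 3 * integral {0..pi} (\<lambda>s. (Q (s, y))\<^sup>2)"
proof -
  define I where "I = integral {0..pi} (\<lambda>s. \<bar>Q (s, y)\<bar>)"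
  have H: "\<bar>integral {0..t} (\<lambda>s. (t - s) * Q (s, y))\<bar> \<le> pi * I" if "0 \<le> t" "t \<le> pi" for t
  proof -
    have "norm (integral {0..t} (\<lambda>s. (t - s) * Q (s, y))) \<le> integral {0..t} (\<lambda>s. pi * \<bar>Q (s, y)\<bar>)"
    proof (rule integral_norm_bound_integral)
      show "norm ((t - s) * Q (s, y)) \<le> pi * \<bar>Q (s, y)\<bar>" if "s \<in> {0..t}" for s
        unfolding real_norm_def abs_mult using that \<open>t \<le> pi\<close> by (intro mult_right_mono) auto
    qed (intro slice_integrable[OF Q] integrable_on_mult_right)+
    also have "\<dots> = pi * integral {0..t} (\<lambda>s. \<bar>Q (s, y)\<bar>)"
      by simp
    also have "\<dots> \<le> pi * I"
      unfolding I_def using that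
      by (intro mult_left_mono integral_subset_le slice_integrable[OF Q]) auto
    finally show ?thesis by simp
  qed
  have "\<bar>x / pi * integral {0..pi} (\<lambda>s. (pi - s) * Q (s, y))\<bar> \<le> 1 * (pi * I)"
    unfolding abs_mult using x H[of pi] by (intro mult_mono) auto
  then have "\<bar>dirichlet_primitive Q (x, y)\<bar> \<le> pi * I + 1 * (pi * I)"
    unfolding dirichlet_primitive_def fst_conv snd_conv
    by (intro order_trans[OF abs_triangle_ineq4] add_mono H[OF x])
  then have "\<bar>dirichlet_primitive Q (x, y)\<bar> \<le> 2 * pi * I" by (simp add: mult_ac)
  then have "(dirichlet_primitive Q (x, y))\<^sup>2 \<le> (2 * pi * I)\<^sup>2"
    using power_mono[of "\<bar>dirichlet_primitive Q (x, y)\<bar>" "2 * pi * I" 2] by simp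
  also have "\<dots> = 4 * pi\<^sup>2 * I\<^sup>2"
    by (simp add: power_mult_distrib)
  also have "\<dots> \<le> 4 * pi\<^sup>2 * (pi * integral {0..pi} (\<lambda>s. (Q (s, y))\<^sup>2))"
    unfolding I_def using integral_square_le[of "\<lambda>s. \<bar>Q (s, y)\<bar>"] slice_integrable[OF Q]
    by (intro mult_left_mono) auto
  finally show ?thesis
    by (simp add: power2_eq_square power3_eq_cube algebra_simps)
qed

lemma slice_square_integral_continuous:
  assumes "continuous_on UNIV (Q :: real \<times> real \<Rightarrow> real)"
  shows "(\<lambda>y. integral {0..pi} (\<lambda>x. (Q (x, y))\<^sup>2)) integrable_on {-l..l}"
proof -
  have "continuous_on ({-l..l} \<times> cbox 0 pi) (\<lambda>(y, x). (Q (x, y))\<^sup>2)"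
    unfolding case_prod_beta
    by (intro continuous_on_power continuous_on_compose2[OF assms]) (auto intro!: continuous_intros)
  then have "continuous_on {-l..l} (\<lambda>y. integral (cbox 0 pi) (\<lambda>x. (Q (x, y))\<^sup>2))"
    by (rule integral_continuous_on_param)
  then show ?thesis
    by (intro integrable_continuous_interval) simp
qed

lemma dirichlet_primitive_L2_bound:
  assumes Q: "continuous_on UNIV Q" and g: "continuous_on UNIV g"
    and eq: "\<forall>z \<in> {0..pi} \<times> {-l..l}. dirichlet_primitive Q z = g z"
  shows "innerL2 l g g \<le> 4 * pi ^ 4 * innerL2 l Q Q"
proof -
  have it: "innerL2 l f f = integral {-l..l} (\<lambda>y. integral {0..pi} (\<lambda>x. (f (x, y))\<^sup>2))"
    if "continuous_on UNIV f" for f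
    unfolding innerL2_def power2_eq_square[symmetric]
    by (rule integral_Omega_iterated(2)) (intro continuous_on_power continuous_on_subset[OF that], auto)
  have "integral {-l..l} (\<lambda>y. integral {0..pi} (\<lambda>x. (g (x, y))\<^sup>2))
      \<le> integral {-l..l} (\<lambda>y. 4 * pi ^ 4 * integral {0..pi} (\<lambda>s. (Q (s, y))\<^sup>2))"
  proof (rule integral_le)
    fix y assume y: "y \<in> {-l..l}"
    have "integral {0..pi} (\<lambda>x. (g (x, y))\<^sup>2)
        \<le> integral {0..pi} (\<lambda>x. 4 * pi ^ 3 * integral {0..pi} (\<lambda>s. (Q (s, y))\<^sup>2))"
    proof (rule integral_le)
      fix x assume "x \<in> {0..pi}"
      with y eq have "g (x, y) = dirichlet_primitive Q (x, y)" by auto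
      then show "(g (x, y))\<^sup>2 \<le> 4 * pi ^ 3 * integral {0..pi} (\<lambda>s. (Q (s, y))\<^sup>2)"
        using dirichlet_primitive_bound[OF Q] \<open>x \<in> {0..pi}\<close> by simp
    qed (intro slice_integrable[OF g] integrable_const_ivl)+
    also have "\<dots> = 4 * pi ^ 4 * integral {0..pi} (\<lambda>s. (Q (s, y))\<^sup>2)"
      by (simp add: power_numeral_reduce)
    finally show "integral {0..pi} (\<lambda>x. (g (x, y))\<^sup>2) \<le> 4 * pi ^ 4 * integral {0..pi} (\<lambda>s. (Q (s, y))\<^sup>2)" .
  qed (intro slice_square_integral_continuous Q g integrable_on_mult_right)+
  then show ?thesis
    by (simp add: it Q g)
qed

lemma innerL2_square_diff:
  assumes "U \<in> L2 l" "V \<in> L2 l"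
  shows "innerL2 l (\<lambda>z. U z - V z) (\<lambda>z. U z - V z) = innerL2 l U U - 2 * innerL2 l U V + innerL2 l V V"
proof -
  have "innerL2 l (\<lambda>z. U z - V z) W = innerL2 l U W - innerL2 l V W" if "W \<in> L2 l" for W
    using assms that by (rule innerL2_diff_left)
  moreover have "innerL2 l W (\<lambda>z. U z - V z) = innerL2 l W U - innerL2 l W V" if "W \<in> L2 l" for W
    using innerL2_diff_left[OF assms that] by (simp add: innerL2_commute)
  ultimately show ?thesis
    using assms innerL2_commute[of l V U] by (simp add: L2_diff)
qed

text \<open>
  Instead of approximating \<open>v\<close> in a Sobolev norm, only the continuous representative is approximated,
  uniformly, by polynomials \<open>Q\<close>. The duality \<open>(v, Q) = (v_xx, g)\<close> with \<open>g_xx = Q\<close> and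
  \<open>(g, g) \<le> c (Q, Q)\<close>, where \<open>c = 4 pi^4\<close>, gives \<open>2 (v, Q) - (Q, Q) \<le> c (v_xx, v_xx)\<close> by Young's inequality.
  The left side is \<open>(v, v) - (v - Q, v - Q)\<close>, which tends to \<open>(v, v)\<close>.
\<close>

lemma Poincare:
  assumes l: "0 < l" and v: "v \<in> H2star l"
  shows "innerL2 l v v \<le> 4 * pi ^ 4 * innerL2 l (weak_deriv l 2 0 v) (weak_deriv l 2 0 v)"
proof -
  define X where "X = innerL2 l (weak_deriv l 2 0 v) (weak_deriv l 2 0 v)"
  obtain W where W: "continuous_on ({0..pi} \<times> {-l..l}) W" "eqL2 l v W"
    using v unfolding H2star_def by blast
  note vL = H2star_L2[OF v] and xL = H2star_deriv_L2[OF v, of 2 0, simplified]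
  interpret finite_measure "lebesgue_on (Omega l)" by (rule finite_measure_Omega)
  define m where "m = measure (lebesgue_on (Omega l)) (Omega l)"
  have approx: "innerL2 l v v \<le> 4 * pi ^ 4 * X + e\<^sup>2 * m" if e: "0 < e" for e
  proof -
    obtain Q where Q: "real_polynomial_function Q" "\<And>z. z \<in> {0..pi} \<times> {-l..l} \<Longrightarrow> \<bar>W z - Q z\<bar> < e"
      using Stone_Weierstrass_real_polynomial_function[OF _ W(1) e] by (metis compact_Times compact_Icc)
    have p2: "poly2 Q" by (rule poly2_real_polynomial_function[OF Q(1)])
    have Qc: "continuous_on UNIV Q" by (rule poly2_continuous[OF p2])
    obtain g where g: "continuous_on UNIV g" "\<forall>z \<in> {0..pi} \<times> {-l..l}. dirichlet_primitive Q z = g z"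
        "innerL2 l v Q = innerL2 l (weak_deriv l 2 0 v) g"
      using poly2_dirichlet[OF l p2] v by blast
    have L: "p \<in> L2 l" if "continuous_on UNIV p" for p
      by (intro L2_continuous_closed continuous_on_subset[OF that]) auto
    note QL = L[OF Qc] and gL = L[OF g(1)]
    define c where "c = 4 * pi ^ 4"
    have c: "c > 0" by (simp add: c_def)
    have "0 \<le> innerL2 l (\<lambda>z. c * weak_deriv l 2 0 v z - g z) (\<lambda>z. c * weak_deriv l 2 0 v z - g z)"
      by (rule innerL2_nonneg)
    also have "\<dots> = c\<^sup>2 * X - 2 * c * innerL2 l (weak_deriv l 2 0 v) g + innerL2 l g g"
      by (subst innerL2_square_diff) (simp_all add: innerL2_scale_left innerL2_scale_right L2_scale xL gL
          X_def power2_eq_square)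
    also have "\<dots> \<le> c\<^sup>2 * X - 2 * c * innerL2 l v Q + c * innerL2 l Q Q"
      using dirichlet_primitive_L2_bound[OF Qc g(1,2)] g(3) by (simp add: c_def)
    finally have "0 \<le> c * (c * X - 2 * innerL2 l v Q + innerL2 l Q Q)"
      by (simp add: power2_eq_square algebra_simps)
    then have 1: "2 * innerL2 l v Q - innerL2 l Q Q \<le> c * X"
      using c by (simp add: zero_le_mult_iff)
    have "innerL2 l (\<lambda>z. v z - Q z) (\<lambda>z. v z - Q z) \<le> (\<integral>z. e\<^sup>2 \<partial>lebesgue_on (Omega l))"
      unfolding innerL2_def
    proof (rule Bochner_Integration.integral_mono_AE)
      show "integrable (lebesgue_on (Omega l)) (\<lambda>z. (v z - Q z) * (v z - Q z))"
        by (intro L2_product_integrable L2_diff vL QL)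
      have "AE z in lebesgue_on (Omega l). z \<in> Omega l"
        by (rule AE_I2) simp
      then show "AE z in lebesgue_on (Omega l). (v z - Q z) * (v z - Q z) \<le> e\<^sup>2"
        using W(2) unfolding eqL2_def
      proof eventually_elim
        case (elim z)
        then have "\<bar>v z - Q z\<bar> \<le> \<bar>e\<bar>"
          using Q(2)[of z] e by (auto simp: Omega_def)
        then show ?case
          by (simp add: abs_le_square_iff power2_eq_square)
      qed
    qed auto
    also have "(\<integral>z. e\<^sup>2 \<partial>lebesgue_on (Omega l)) = e\<^sup>2 * m"
      by (simp add: m_def)
    finally have "innerL2 l v v - 2 * innerL2 l v Q + innerL2 l Q Q \<le> e\<^sup>2 * m"
      by (simp add: innerL2_square_diff vL QL)
    with 1 show ?thesis by (simp add: c_def)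
  qed
  have "m \<ge> 0" by (simp add: m_def)
  have "innerL2 l v v \<le> 4 * pi ^ 4 * X + e" if "0 < e" for e
  proof -
    define d where "d = sqrt (e / (m + 1))"
    have d: "0 < d" "d\<^sup>2 = e / (m + 1)"
      using that \<open>m \<ge> 0\<close> by (auto simp: d_def)
    have "d\<^sup>2 * m \<le> e"
      using that \<open>m \<ge> 0\<close> unfolding d(2) by (simp add: field_simps)
    then show ?thesis using approx[OF d(1)] by linarith
  qed
  then have "innerL2 l v v \<le> 4 * pi ^ 4 * X"
    by (rule field_le_epsilon)
  then show ?thesis by (simp add: X_def)
qed

lemma H2star_form_integrable:
  fixes U V :: "nat \<Rightarrow> nat \<Rightarrow> real \<times> real \<Rightarrow> real"
  assumes "\<And>i j. i + j = 2 \<Longrightarrow> U i j \<in> L2 l" "\<And>i j. i + j = 2 \<Longrightarrow> V i j \<in> L2 l"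
  shows "integrable (lebesgue_on (Omega l)) (\<lambda>z. (U 2 0 z + U 0 2 z) * (V 2 0 z + V 0 2 z)
            - (1 - sigma) * (U 2 0 z * V 0 2 z + U 0 2 z * V 2 0 z - 2 * U 1 1 z * V 1 1 z))"
proof -
  have "integrable (lebesgue_on (Omega l)) (\<lambda>z. (U 2 0 z + U 0 2 z) * (V 2 0 z + V 0 2 z)
            - (1 - sigma) * (U 2 0 z * V 0 2 z + U 0 2 z * V 2 0 z - (2 * U 1 1 z) * V 1 1 z))"
    using assms by (intro Bochner_Integration.integrable_diff Bochner_Integration.integrable_add
        integrable_mult_right L2_product_integrable L2_add L2_scale) auto
  then show ?thesis by simp
qed

text \<open>
  For the Poisson ratio \<open>1/5\<close> the integrand of the form dominates \<open>4/5\<close> of the square of \<open>v_xx\<close>, which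
  controls \<open>v\<close> by \<open>Poincare\<close>.
\<close>

lemma H2star_coercive:
  assumes l: "0 < l" and v: "v \<in> H2star l"
  shows "innerL2 l v v \<le> 5 * pi ^ 4 * innerH2star l v v"
proof -
  define X where "X = weak_deriv l 2 0 v"
  define Y where "Y = weak_deriv l 0 2 v"
  define Z where "Z = weak_deriv l 1 1 v"
  have L: "weak_deriv l i j v \<in> L2 l" if "i + j = 2" for i j
    using H2star_deriv_L2[OF v, of i j] that by simp
  have "(4/5) * innerL2 l X X = (\<integral>z. (4/5) * (X z * X z) \<partial>lebesgue_on (Omega l))"
    by (simp add: innerL2_def)
  also have "\<dots> \<le> innerH2star l v v"
    unfolding innerH2star_def Let_def
  proof (rule Bochner_Integration.integral_mono)
    show "integrable (lebesgue_on (Omega l)) (\<lambda>z. (4/5) * (X z * X z))"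
      unfolding X_def by (intro integrable_mult_right L2_product_integrable L) auto
    show "integrable (lebesgue_on (Omega l))
     (\<lambda>z. (weak_deriv l 2 0 v z + weak_deriv l 0 2 v z) * (weak_deriv l 2 0 v z + weak_deriv l 0 2 v z) -
          (1 - sigma) * (weak_deriv l 2 0 v z * weak_deriv l 0 2 v z + weak_deriv l 0 2 v z * weak_deriv l 2 0 v z -
           2 * weak_deriv l 1 1 v z * weak_deriv l 1 1 v z))"
      by (rule H2star_form_integrable[of "\<lambda>i j. weak_deriv l i j v" l "\<lambda>i j. weak_deriv l i j v", OF L L])
    fix z
    have "(4/5) * (x * x) \<le> (x + y) * (x + y) - (1 - sigma) * (x * y + y * x - 2 * w * w)" for x y w :: real
    proof -
      have "(x + y) * (x + y) - (1 - sigma) * (x * y + y * x - 2 * w * w) - (4/5) * (x * x)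
          = (1/5) * (x + y)\<^sup>2 + (4/5) * y\<^sup>2 + (8/5) * w\<^sup>2"
        by (simp add: sigma_def power2_eq_square algebra_simps)
      moreover have "0 \<le> (1/5) * (x + y)\<^sup>2 + (4/5) * y\<^sup>2 + (8/5) * w\<^sup>2"
        by (intro add_nonneg_nonneg mult_nonneg_nonneg) auto
      ultimately show ?thesis by linarith
    qed
    then show "(4/5) * (X z * X z) \<le> (weak_deriv l 2 0 v z + weak_deriv l 0 2 v z) * (weak_deriv l 2 0 v z + weak_deriv l 0 2 v z) -
          (1 - sigma) * (weak_deriv l 2 0 v z * weak_deriv l 0 2 v z + weak_deriv l 0 2 v z * weak_deriv l 2 0 v z -
           2 * weak_deriv l 1 1 v z * weak_deriv l 1 1 v z)"
      unfolding X_def .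
  qed
  finally have "innerL2 l X X \<le> (5/4) * innerH2star l v v" by simp
  then have "4 * pi ^ 4 * innerL2 l X X \<le> 4 * pi ^ 4 * ((5/4) * innerH2star l v v)"
    by (intro mult_left_mono) auto
  also have "\<dots> = 5 * pi ^ 4 * innerH2star l v v" by simp
  finally show ?thesis
    using Poincare[OF l v] unfolding X_def by linarith
qed


section \<open>Vibration modes of the plate\<close>

lemma innerL2_diff_right:
  "U \<in> L2 l \<Longrightarrow> V \<in> L2 l \<Longrightarrow> W \<in> L2 l \<Longrightarrow>
     innerL2 l W (\<lambda>z. U z - V z) = innerL2 l W U - innerL2 l W V"
  by (simp add: innerL2_commute[of l W] innerL2_diff_left)

lemma weak_deriv_innerL2:
  assumes "is_weak_deriv l i j U X" "W \<in> L2 l"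
  shows "innerL2 l (weak_deriv l i j U) W = innerL2 l X W"
proof (rule innerL2_cong_AE)
  note w = is_weak_deriv_weak_deriv[OF assms(1)]
  show "eqL2 l (weak_deriv l i j U) X"
    by (rule weak_deriv_unique[OF w assms(1)])
  show "weak_deriv l i j U \<in> L2 l" "X \<in> L2 l"
    using w assms(1) by (simp_all add: is_weak_deriv_def)
  show "eqL2 l W W" by (simp add: eqL2_def)
qed (use assms in auto)

lemma innerH2star_expand:
  assumes X: "is_weak_deriv l 2 0 U X" and Y: "is_weak_deriv l 0 2 U Y" and Z: "is_weak_deriv l 1 1 U Z"
    and v: "v \<in> H2star l"
  shows "innerH2star l U v =
    innerL2 l X (weak_deriv l 2 0 v) + sigma * innerL2 l Y (weak_deriv l 2 0 v)
    + (innerL2 l Y (weak_deriv l 0 2 v) + sigma * innerL2 l X (weak_deriv l 0 2 v))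
    + 2 * (1 - sigma) * innerL2 l Z (weak_deriv l 1 1 v)"
proof -
  define a b c where "a = weak_deriv l 2 0 v" and "b = weak_deriv l 0 2 v" and "c = weak_deriv l 1 1 v"
  define x y w where "x = weak_deriv l 2 0 U" and "y = weak_deriv l 0 2 U" and "w = weak_deriv l 1 1 U"
  have L: "a \<in> L2 l" "b \<in> L2 l" "c \<in> L2 l"
    unfolding a_def b_def c_def using v by (auto intro: H2star_deriv_L2)
  have LU: "x \<in> L2 l" "y \<in> L2 l" "w \<in> L2 l"
    unfolding x_def y_def w_def
    using is_weak_deriv_weak_deriv[OF X] is_weak_deriv_weak_deriv[OF Y] is_weak_deriv_weak_deriv[OF Z]
    by (simp_all add: is_weak_deriv_def)
  define t where "t = 2 * (1 - sigma)"
  have eq: "(x + y) * (a + b) - (1 - sigma) * (x * b + y * a - 2 * w * c) =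
      x * a + sigma * (y * a) + (y * b + sigma * (x * b)) + t * (w * c)" for x y w a b c :: real
    by (simp add: algebra_simps t_def)
  have "innerH2star l U v = innerL2 l x a + sigma * innerL2 l y a + (innerL2 l y b + sigma * innerL2 l x b)
    + t * innerL2 l w c"
    unfolding innerH2star_def Let_def innerL2_def a_def[symmetric] b_def[symmetric] c_def[symmetric]
      x_def[symmetric] y_def[symmetric] w_def[symmetric] eq
    by (simp add: L2_product_integrable L LU)
  then show ?thesis
    unfolding x_def y_def w_def
    by (simp only: weak_deriv_innerL2[OF X] weak_deriv_innerL2[OF Y] weak_deriv_innerL2[OF Z] L)
       (simp only: a_def b_def c_def t_def)
qed

definition gradx :: "real \<Rightarrow> (real \<times> real \<Rightarrow> real) \<Rightarrow> (real \<times> real \<Rightarrow> real) \<Rightarrow> real" where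
  "gradx l U V = innerL2 l (weak_deriv l 1 0 U) (weak_deriv l 1 0 V)"

lemma H2star_scale:
  assumes "U \<in> H2star l"
  shows "(\<lambda>z. c * U z) \<in> H2star l"
proof -
  obtain W where W: "continuous_on ({0..pi} \<times> {-l..l}) W" "eqL2 l U W" "\<forall>z \<in> {0, pi} \<times> {-l..l}. W z = 0"
    using assms unfolding H2star_def by blast
  have "eqL2 l (\<lambda>z. c * U z) (\<lambda>z. c * W z)"
    using W(2) unfolding eqL2_def by eventually_elim simp
  moreover have "continuous_on ({0..pi} \<times> {-l..l}) (\<lambda>z. c * W z)"
    by (intro continuous_intros W)
  moreover have "(\<lambda>z. c * U z) \<in> H2 l"
    using assms is_weak_deriv_scale unfolding H2star_def H2_def by (auto simp: L2_scale) blast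
  ultimately show ?thesis
    using W(3) unfolding H2star_def by (auto intro!: exI[of _ "\<lambda>z. c * W z"])
qed

lemma H2star_add:
  assumes "U \<in> H2star l" "V \<in> H2star l"
  shows "(\<lambda>z. U z + V z) \<in> H2star l"
proof -
  obtain W where W: "continuous_on ({0..pi} \<times> {-l..l}) W" "eqL2 l U W" "\<forall>z \<in> {0, pi} \<times> {-l..l}. W z = 0"
    using assms(1) unfolding H2star_def by blast
  obtain W' where W': "continuous_on ({0..pi} \<times> {-l..l}) W'" "eqL2 l V W'" "\<forall>z \<in> {0, pi} \<times> {-l..l}. W' z = 0"
    using assms(2) unfolding H2star_def by blast
  have "eqL2 l (\<lambda>z. U z + V z) (\<lambda>z. W z + W' z)"
    using W(2) W'(2) unfolding eqL2_def by eventually_elim simp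
  moreover have "continuous_on ({0..pi} \<times> {-l..l}) (\<lambda>z. W z + W' z)"
    by (intro continuous_intros W W')
  moreover have "(\<lambda>z. U z + V z) \<in> H2 l"
    unfolding H2_def
  proof (intro CollectI conjI allI impI exI)
    show "(\<lambda>z. U z + V z) \<in> L2 l"
      using assms by (intro L2_add H2star_L2)
    show "is_weak_deriv l i j (\<lambda>z. U z + V z) (\<lambda>z. weak_deriv l i j U z + weak_deriv l i j V z)"
      if "i + j \<le> 2" for i j
      using that assms by (intro is_weak_deriv_add H2star_weak_deriv H2star_L2)
  qed
  ultimately show ?thesis
    using W(3) W'(3) unfolding H2star_def by (auto intro!: exI[of _ "\<lambda>z. W z + W' z"])
qed

lemma H2star_forms_scale:
  assumes U: "U \<in> H2star l" and v: "v \<in> H2star l"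
  shows "innerH2star l (\<lambda>z. c * U z) v = c * innerH2star l U v"
    and "gradx l (\<lambda>z. c * U z) v = c * gradx l U v"
proof -
  note w = is_weak_deriv_scale[OF H2star_weak_deriv[OF U], of _ _ c]
  show "innerH2star l (\<lambda>z. c * U z) v = c * innerH2star l U v"
    by (subst innerH2star_expand[OF w w w v]; (subst innerH2star_expand[OF
        H2star_weak_deriv[OF U] H2star_weak_deriv[OF U] H2star_weak_deriv[OF U] v])?)
       (simp_all add: innerL2_scale_left algebra_simps)
  show "gradx l (\<lambda>z. c * U z) v = c * gradx l U v"
    unfolding gradx_def using v
    by (simp add: weak_deriv_innerL2[OF w] H2star_deriv_L2 innerL2_scale_left)
qed

lemma H2star_forms_add:
  assumes U: "U \<in> H2star l" and V: "V \<in> H2star l" and v: "v \<in> H2star l"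
  shows "innerH2star l (\<lambda>z. U z + V z) v = innerH2star l U v + innerH2star l V v"
    and "gradx l (\<lambda>z. U z + V z) v = gradx l U v + gradx l V v"
proof -
  note w = is_weak_deriv_add[OF H2star_weak_deriv[OF U] H2star_weak_deriv[OF V] H2star_L2[OF U] H2star_L2[OF V]]
  have L: "weak_deriv l i j p \<in> L2 l" if "p \<in> H2star l" "i + j \<le> 2" for i j p
    using that by (rule H2star_deriv_L2)
  show "innerH2star l (\<lambda>z. U z + V z) v = innerH2star l U v + innerH2star l V v"
    by (subst innerH2star_expand[OF w w w v]; (subst innerH2star_expand[OF
        H2star_weak_deriv[OF U] H2star_weak_deriv[OF U] H2star_weak_deriv[OF U] v])?;
       (subst innerH2star_expand[OF
        H2star_weak_deriv[OF V] H2star_weak_deriv[OF V] H2star_weak_deriv[OF V] v])?)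
       (simp_all add: innerL2_add_left L U V v algebra_simps)
  show "gradx l (\<lambda>z. U z + V z) v = gradx l U v + gradx l V v"
    unfolding gradx_def
    by (simp add: weak_deriv_innerL2[OF w] L U V v innerL2_add_left)
qed

text \<open>
  A mode is an eigenfunction, at the same time, of the bending form (eigenvalue \<open>\<Lambda>\<close>) and of the form
  \<open>(u_x, v_x)\<close> of the stretching term (eigenvalue \<open>\<kappa>\<close>). On the span of such functions the plate problem
  becomes a system of ordinary differential equations.
\<close>

definition mode :: "real \<Rightarrow> real \<Rightarrow> real \<Rightarrow> (real \<times> real \<Rightarrow> real) \<Rightarrow> bool" where
  "mode l \<kappa> \<Lambda> e \<longleftrightarrow> e \<in> H2star l \<and>
     (\<forall>v \<in> H2star l. innerH2star l e v = \<Lambda> * innerL2 l e v \<and> gradx l e v = \<kappa> * innerL2 l e v)"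

text \<open>
  The form \<open>gradx\<close> is symmetric, and its eigenfunctions for different eigenvalues are orthogonal.
\<close>

lemma mode_orthogonal:
  assumes e: "mode l \<kappa> \<Lambda> e" and f: "mode l \<kappa>' \<Lambda>' f" and ne: "\<kappa> \<noteq> \<kappa>'"
  shows "innerL2 l e f = 0"
proof -
  have "\<kappa> * innerL2 l e f = gradx l e f" "\<kappa>' * innerL2 l f e = gradx l f e"
    using e f by (simp_all add: mode_def)
  moreover have "gradx l e f = gradx l f e"
    unfolding gradx_def by (rule innerL2_commute)
  ultimately have "(\<kappa> - \<kappa>') * innerL2 l e f = 0"
    by (simp add: innerL2_commute[of l f e] left_diff_distrib)
  then show ?thesis using ne by simp
qed

lemma mode_scale: "mode l \<kappa> \<Lambda> e \<Longrightarrow> mode l \<kappa> \<Lambda> (\<lambda>z. c * e z)"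
  unfolding mode_def by (simp add: H2star_scale H2star_forms_scale innerL2_scale_left)

lemma deriv_sin: "deriv (\<lambda>x. sin (m * x)) = (\<lambda>x. m * cos (m * x))" for m :: real
  by (rule ext, rule DERIV_imp_deriv) (auto intro!: derivative_eq_intros)

lemma deriv_cos: "deriv (\<lambda>x. m * cos (m * x)) = (\<lambda>x. - (m\<^sup>2) * sin (m * x))" for m :: real
  by (rule ext, rule DERIV_imp_deriv) (auto intro!: derivative_eq_intros simp: power2_eq_square)

lemma sep_scale_left: "sep (\<lambda>x. c * a x) b = (\<lambda>z. c * sep a b z)"
  by (simp add: sep_def fun_eq_iff)

text \<open>
  For \<open>e = sin (m x) \<psi>(y)\<close> the hypotheses are the boundary conditions on the long edges and the equation
  \<open>\<Delta>\<^sup>2 e = \<Lambda> e\<close>. The bending form is collected as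
  \<open>(e_xx + \<sigma> e_yy) v_xx + (e_yy + \<sigma> e_xx) v_yy + 2 (1 - \<sigma>) e_xy v_xy\<close>. In the second term the coefficient
  \<open>A = \<psi>_yy - \<sigma> m\<^sup>2 \<psi>\<close> vanishes on the long edges, so \<open>v_yy\<close> can be integrated by parts; together with
  the mixed term this leaves \<open>v_y\<close> against \<open>B = \<psi>_yyy - (2 - \<sigma>) m\<^sup>2 \<psi>_y\<close>, which vanishes there as well, so that
  a second integration by parts reaches \<open>v\<close>.
\<close>

lemma mode_separated:
  fixes n :: nat and \<psi> :: "real \<Rightarrow> real"
  defines "m \<equiv> real n"
  assumes l: "0 < l" and \<psi>: "smooth \<psi>"
    and bc2: "\<And>y. y \<in> {-l, l} \<Longrightarrow> deriv (deriv \<psi>) y = sigma * m\<^sup>2 * \<psi> y"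
    and bc3: "\<And>y. y \<in> {-l, l} \<Longrightarrow> deriv (deriv (deriv \<psi>)) y = (2 - sigma) * m\<^sup>2 * deriv \<psi> y"
    and ode: "\<And>y. deriv (deriv (deriv (deriv \<psi>))) y - 2 * m\<^sup>2 * deriv (deriv \<psi>) y + m ^ 4 * \<psi> y = \<Lambda> * \<psi> y"
  shows "mode l (m\<^sup>2) \<Lambda> (sep (\<lambda>x. sin (m * x)) \<psi>)"
proof -
  define s where "s = (\<lambda>x. sin (m * x))"
  define s1 where "s1 = (\<lambda>x. m * cos (m * x))"
  define s2 where "s2 = (\<lambda>x. - (m\<^sup>2) * s x)"
  define \<psi>1 \<psi>2 \<psi>3 \<psi>4 where "\<psi>1 = deriv \<psi>" and "\<psi>2 = deriv \<psi>1" and "\<psi>3 = deriv \<psi>2" and "\<psi>4 = deriv \<psi>3"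
  have sm: "smooth s" "smooth s1" "smooth \<psi>" "smooth \<psi>1" "smooth \<psi>2" "smooth \<psi>3" "smooth s2"
    unfolding s_def s1_def s2_def \<psi>1_def \<psi>2_def \<psi>3_def
    by (intro smooth_sin smooth_mult smooth_const smooth_cos smooth_deriv \<psi>)+
  have ds: "deriv s = s1" "deriv s1 = s2"
    unfolding s2_def s_def s1_def by (rule deriv_sin, rule deriv_cos)
  have s0: "s 0 = 0" "s pi = 0"
    by (simp_all add: s_def m_def mult.commute)
  let ?e = "sep s \<psi>"
  note w = is_weak_deriv_sep[OF l sm(1,3)]
  have eH: "?e \<in> H2star l"
    unfolding H2star_def H2_def
  proof (intro CollectI conjI allI impI exI ballI)
    show "?e \<in> L2 l" by (intro sep_smooth_L2 sm)
    show "is_weak_deriv l i j ?e (sep ((deriv ^^ i) s) ((deriv ^^ j) \<psi>))" for i j by (rule w)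
    show "continuous_on ({0..pi} \<times> {-l..l}) ?e" by (intro continuous_sep smooth_continuous sm)
    show "eqL2 l ?e ?e" by (simp add: eqL2_def)
    show "?e z = 0" if "z \<in> {0, pi} \<times> {-l..l}" for z
      using that s0 by (auto simp: sep_def)
  qed
  have X: "is_weak_deriv l 2 0 ?e (sep s2 \<psi>)"
    using w[of 2 0] by (simp add: numeral_2_eq_2 ds)
  have Y: "is_weak_deriv l 0 2 ?e (sep s \<psi>2)"
    using w[of 0 2] by (simp add: numeral_2_eq_2 \<psi>1_def \<psi>2_def)
  have Z: "is_weak_deriv l 1 1 ?e (sep s1 \<psi>1)"
    using w[of 1 1] by (simp add: ds \<psi>1_def)
  have D: "is_weak_deriv l 1 0 ?e (sep s1 \<psi>)"
    using w[of 1 0] by (simp add: ds)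
  have "innerH2star l ?e v = \<Lambda> * innerL2 l ?e v \<and> gradx l ?e v = m\<^sup>2 * innerL2 l ?e v"
    if v: "v \<in> H2star l" for v
  proof
    note p = H2star_parts[OF l v]
    have L: "weak_deriv l i j v \<in> L2 l" if "i + j \<le> 2" for i j
      using v that by (rule H2star_deriv_L2)
    note vL = H2star_L2[OF v]
    note sL = sep_smooth_L2
    have grad: "innerL2 l (weak_deriv l 1 0 v) (sep s1 f) = m\<^sup>2 * innerL2 l v (sep s f)" if "smooth f" for f
    proof -
      have "innerL2 l (weak_deriv l 1 0 v) (sep s1 f) = - innerL2 l v (sep s2 f)"
        using p(1)[OF sm(2) that] by (simp add: ds)
      also have "\<dots> = m\<^sup>2 * innerL2 l v (sep s f)"
        unfolding s2_def sep_scale_left innerL2_scale_right by simp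
      finally show ?thesis .
    qed
    show "gradx l ?e v = m\<^sup>2 * innerL2 l ?e v"
      unfolding gradx_def
      by (subst weak_deriv_innerL2[OF D L])
         (simp_all add: innerL2_commute[of l "sep _ _"] grad[unfolded One_nat_def] sm)
    define A where "A = (\<lambda>y. \<psi>2 y - sigma * m\<^sup>2 * \<psi> y)"
    define A1 where "A1 = (\<lambda>y. \<psi>3 y - sigma * m\<^sup>2 * \<psi>1 y)"
    define B where "B = (\<lambda>y. \<psi>3 y - (2 - sigma) * m\<^sup>2 * \<psi>1 y)"
    define B1 where "B1 = (\<lambda>y. \<psi>4 y - (2 - sigma) * m\<^sup>2 * \<psi>2 y)"
    define P where "P = (\<lambda>y. sigma * \<psi>2 y - m\<^sup>2 * \<psi> y)"
    have smAB: "smooth A" "smooth A1" "smooth B" "smooth P"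
      unfolding A_def A1_def B_def P_def by (intro smooth_diff smooth_mult smooth_const sm)+
    have dA: "deriv A = A1"
      unfolding A_def A1_def \<psi>3_def \<psi>1_def
      by (rule ext, rule DERIV_imp_deriv, rule DERIV_diff[OF smooth_DERIV[OF sm(5)] DERIV_cmult[OF smooth_DERIV[OF sm(3)]]])
    have dB: "deriv B = B1"
      unfolding B_def B1_def \<psi>4_def \<psi>2_def
      by (rule ext, rule DERIV_imp_deriv, rule DERIV_diff[OF smooth_DERIV[OF sm(6)] DERIV_cmult[OF smooth_DERIV[OF sm(4)]]])
    have A0: "A (-l) = 0" "A l = 0"
      using bc2 by (simp_all add: A_def \<psi>2_def \<psi>1_def)
    have B0: "B (-l) = 0" "B l = 0"
      using bc3 by (simp_all add: B_def \<psi>3_def \<psi>2_def \<psi>1_def)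
    have "innerL2 l (sep s2 \<psi>) (weak_deriv l 2 0 v) + sigma * innerL2 l (sep s \<psi>2) (weak_deriv l 2 0 v)
        = innerL2 l (weak_deriv l 2 0 v) (sep s P)"
    proof -
      have "sep s P = (\<lambda>z. sep s2 \<psi> z + sigma * sep s \<psi>2 z)"
        by (simp add: fun_eq_iff sep_def P_def s2_def algebra_simps)
      then show ?thesis
        by (simp add: innerL2_add_right innerL2_scale_right L2_scale L sL sm smooth_mult innerL2_commute[of l "sep _ _"])
    qed
    also have "\<dots> = - innerL2 l (weak_deriv l 1 0 v) (sep s1 P)"
      using p(3)[OF sm(1) smAB(4) s0] by (simp add: ds)
    also have "\<dots> = - (m\<^sup>2) * innerL2 l v (sep s P)"
      using grad[OF smAB(4)] by simp
    finally have T1: "innerL2 l (sep s2 \<psi>) (weak_deriv l 2 0 v) + sigma * innerL2 l (sep s \<psi>2) (weak_deriv l 2 0 v)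
        = - (m\<^sup>2) * innerL2 l v (sep s P)" .
    have "innerL2 l (sep s \<psi>2) (weak_deriv l 0 2 v) + sigma * innerL2 l (sep s2 \<psi>) (weak_deriv l 0 2 v)
        = innerL2 l (weak_deriv l 0 2 v) (sep s A)"
    proof -
      have "sep s A = (\<lambda>z. sep s \<psi>2 z + sigma * sep s2 \<psi> z)"
        by (simp add: fun_eq_iff sep_def A_def s2_def algebra_simps)
      then show ?thesis
        by (simp add: innerL2_add_right innerL2_scale_right L2_scale L sL sm smooth_mult innerL2_commute[of l "sep _ _"])
    qed
    also have "\<dots> = - innerL2 l (weak_deriv l 0 1 v) (sep s A1)"
      using p(5)[OF sm(1) smAB(1) A0] by (simp add: dA)
    finally have T2: "innerL2 l (sep s \<psi>2) (weak_deriv l 0 2 v) + sigma * innerL2 l (sep s2 \<psi>) (weak_deriv l 0 2 v)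
        = - innerL2 l (weak_deriv l 0 1 v) (sep s A1)" .
    have T3: "innerL2 l (sep s1 \<psi>1) (weak_deriv l 1 1 v) = m\<^sup>2 * innerL2 l (weak_deriv l 0 1 v) (sep s \<psi>1)"
    proof -
      have "innerL2 l (weak_deriv l 1 1 v) (sep s1 \<psi>1) = - innerL2 l (weak_deriv l 0 1 v) (sep s2 \<psi>1)"
        using p(2)[OF sm(2,4)] by (simp add: ds)
      also have "\<dots> = m\<^sup>2 * innerL2 l (weak_deriv l 0 1 v) (sep s \<psi>1)"
        unfolding s2_def sep_scale_left innerL2_scale_right by simp
      finally show ?thesis by (simp add: innerL2_commute)
    qed
    have T4: "innerL2 l (weak_deriv l 0 1 v) (sep s A1) - 2 * (1 - sigma) * (m\<^sup>2 * innerL2 l (weak_deriv l 0 1 v) (sep s \<psi>1))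
        = innerL2 l (weak_deriv l 0 1 v) (sep s B)"
    proof -
      have "sep s B = (\<lambda>z. sep s A1 z + (- 2 * (1 - sigma) * m\<^sup>2) * sep s \<psi>1 z)"
        by (simp add: fun_eq_iff sep_def B_def A1_def algebra_simps)
      then show ?thesis
        by (simp add: innerL2_add_right innerL2_scale_right L2_scale L sL sm smAB) (simp add: algebra_simps)
    qed
    have T5: "innerL2 l (weak_deriv l 0 1 v) (sep s B) = - innerL2 l v (sep s B1)"
      using p(4)[OF sm(1) smAB(3) B0] by (simp add: dB)
    have T6: "innerL2 l v (sep s B1) - m\<^sup>2 * innerL2 l v (sep s P) = \<Lambda> * innerL2 l v ?e"
    proof -
      have "\<Lambda> * \<psi> y = B1 y - m\<^sup>2 * P y" for y
        unfolding B1_def P_def using ode[of y] unfolding \<psi>4_def \<psi>3_def \<psi>2_def \<psi>1_def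
        by (simp add: algebra_simps power2_eq_square power4_eq_xxxx)
      then have "\<Lambda> * (s x * \<psi> y) = s x * B1 y - m\<^sup>2 * (s x * P y)" for x y
        by (metis (no_types) mult.left_commute right_diff_distrib)
      then have "(\<lambda>z. \<Lambda> * ?e z) = (\<lambda>z. sep s B1 z - m\<^sup>2 * sep s P z)"
        by (simp add: fun_eq_iff sep_def)
      moreover have "smooth B1"
        using smooth_deriv[OF smAB(3)] by (simp add: dB)
      ultimately show ?thesis
        using innerL2_scale_right[of l v \<Lambda> ?e]
        by (simp add: innerL2_diff_right innerL2_scale_right L2_scale vL sL sm smAB)
    qed
    have "innerH2star l ?e v = - (m\<^sup>2) * innerL2 l v (sep s P) + - innerL2 l (weak_deriv l 0 1 v) (sep s A1)
        + 2 * (1 - sigma) * (m\<^sup>2 * innerL2 l (weak_deriv l 0 1 v) (sep s \<psi>1))"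
      unfolding innerH2star_expand[OF X Y Z v] T1 T2 T3 ..
    with T4 T5 T6 show "innerH2star l ?e v = \<Lambda> * innerL2 l ?e v"
      by (simp add: innerL2_commute[of l ?e v])
  qed
  with eH show ?thesis
    unfolding mode_def s_def by blast
qed


lemma deriv_cosh_sinh:
  fixes A B \<alpha> \<beta> :: real
  shows "deriv (\<lambda>y. A * cosh (\<alpha> * y) + B * cosh (\<beta> * y)) = (\<lambda>y. (A * \<alpha>) * sinh (\<alpha> * y) + (B * \<beta>) * sinh (\<beta> * y))"
    and "deriv (\<lambda>y. A * sinh (\<alpha> * y) + B * sinh (\<beta> * y)) = (\<lambda>y. (A * \<alpha>) * cosh (\<alpha> * y) + (B * \<beta>) * cosh (\<beta> * y))"
  by (rule ext, rule DERIV_imp_deriv, auto intro!: derivative_eq_intros simp: algebra_simps)+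

text \<open>
  By Fubini the integral factorises, and \<open>(sin (n x))\<^sup>2\<close> has integral \<open>pi / 2\<close>.
\<close>

lemma innerL2_sep_sin_pos:
  fixes n :: nat
  assumes l: "0 < l" and n: "1 \<le> n" and \<psi>: "smooth \<psi>" and c: "0 < c" "\<And>y. c \<le> \<psi> y"
  shows "0 < innerL2 l (sep (\<lambda>x. sin (real n * x)) \<psi>) (sep (\<lambda>x. sin (real n * x)) \<psi>)"
proof -
  define m where "m = real n"
  have m: "m > 0" using n by (simp add: m_def)
  let ?e = "sep (\<lambda>x. sin (m * x)) \<psi>"
  define I where "I = integral {-l..l} (\<lambda>y. (\<psi> y)\<^sup>2)"
  have \<psi>c: "continuous_on S \<psi>" for S by (rule smooth_continuous[OF \<psi>])
  have "innerL2 l ?e ?e = integral {0..pi} (\<lambda>x. integral {-l..l} (\<lambda>y. ?e (x, y) * ?e (x, y)))"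
    unfolding innerL2_def
    by (intro integral_Omega_iterated(1) continuous_on_mult continuous_sep continuous_intros \<psi>c)
  also have "\<dots> = integral {0..pi} (\<lambda>x. (sin (m * x))\<^sup>2 * I)"
  proof (intro arg_cong[where f = "integral {0..pi}"] ext)
    fix x
    have "(\<lambda>y. ?e (x, y) * ?e (x, y)) = (\<lambda>y. (sin (m * x))\<^sup>2 * (\<psi> y)\<^sup>2)"
      by (simp add: sep_def fun_eq_iff power2_eq_square)
    then show "integral {-l..l} (\<lambda>y. ?e (x, y) * ?e (x, y)) = (sin (m * x))\<^sup>2 * I"
      by (simp add: I_def)
  qed
  also have "\<dots> = integral {0..pi} (\<lambda>x. (sin (m * x))\<^sup>2) * I"
    by simp
  also have "integral {0..pi} (\<lambda>x. (sin (m * x))\<^sup>2) = pi / 2"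
  proof -
    have "((\<lambda>x. x / 2 - sin (2 * m * x) / (4 * m)) has_real_derivative (sin (m * x))\<^sup>2) (at x)" for x
    proof -
      have "((\<lambda>x. x / 2 - sin (2 * m * x) / (4 * m)) has_real_derivative 1 / 2 - cos (2 * m * x) / 2) (at x)"
        using m by (auto intro!: derivative_eq_intros)
      moreover have "1 / 2 - cos (2 * m * x) / 2 = (sin (m * x))\<^sup>2"
        using cos_double_sin[of "m * x"] by (simp add: mult.assoc diff_divide_distrib)
      ultimately show ?thesis by simp
    qed
    then have "integral {0..pi} (\<lambda>x. (sin (m * x))\<^sup>2) =
        (pi / 2 - sin (2 * m * pi) / (4 * m)) - (0 / 2 - sin (2 * m * 0) / (4 * m))"
      by (intro FTC_real) auto
    moreover have "sin (2 * m * pi) = 0"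
      using sin_npi[of "2 * n"] by (simp add: m_def)
    ultimately show ?thesis by simp
  qed
  finally have "innerL2 l ?e ?e = pi / 2 * I" .
  moreover have "0 < I"
  proof -
    have "integral {-l..l} (\<lambda>y. c\<^sup>2) \<le> I"
      unfolding I_def
    proof (rule integral_le)
      show "c\<^sup>2 \<le> (\<psi> y)\<^sup>2" for y
        using c by (intro power_mono) (auto intro: less_imp_le)
    qed (auto intro!: integrable_continuous_interval continuous_intros \<psi>c)
    moreover have "integral {-l..l} (\<lambda>y. c\<^sup>2) > 0"
      using l c by simp
    ultimately show ?thesis by linarith
  qed
  then have "0 < pi / 2 * I" by simp
  ultimately show ?thesis by (simp only: m_def)
qed

text \<open>
  The even solutions of \<open>(\<psi>'' - m\<^sup>2 \<psi>)'' - m\<^sup>2 (\<psi>'' - m\<^sup>2 \<psi>) = \<mu>\<^sup>2 \<psi>\<close> with \<open>\<mu> < m\<^sup>2\<close> are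
  \<open>A cosh (a y) + B cosh (b y)\<close> with \<open>a\<^sup>2 = m\<^sup>2 + \<mu>\<close> and \<open>b\<^sup>2 = m\<^sup>2 - \<mu>\<close>. The choice of \<open>A\<close> and \<open>B\<close> solves the first
  boundary condition; the second one becomes \<open>F \<mu> = 0\<close>, where \<open>c = (1 - \<sigma>) m\<^sup>2\<close>. At \<open>\<mu> = c\<close> only the positive
  term of \<open>F\<close> survives, at \<open>\<mu> = m\<^sup>2\<close> only the negative one, so there is a root between. For this root
  \<open>A\<close> and \<open>B\<close> are positive and the mode is not trivial. The normalisation makes the square of the norm
  of \<open>e_x\<close> equal to \<open>1\<close>.
\<close>

lemma exists_mode:
  fixes n :: nat
  assumes l: "0 < l" and n: "1 \<le> n"
  shows "\<exists>e \<Lambda>. mode l ((real n)\<^sup>2) \<Lambda> e \<and> (real n)\<^sup>2 * innerL2 l e e = 1 \<and> 0 < \<Lambda> \<and> \<Lambda> < (real n) ^ 4"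
proof -
  define m where "m = real n"
  have m: "m > 0" using n by (simp add: m_def)
  define c where "c = (4/5) * m\<^sup>2"
  have c: "0 < c" "c < m\<^sup>2" using m by (simp_all add: c_def)
  define \<alpha> where "\<alpha> = (\<lambda>\<mu>. sqrt (m\<^sup>2 + \<mu>))"
  define \<beta> where "\<beta> = (\<lambda>\<mu>. sqrt (m\<^sup>2 - \<mu>))"
  define F where "F = (\<lambda>\<mu>. (\<mu> + c)\<^sup>2 * \<beta> \<mu> * sinh (\<beta> \<mu> * l) * cosh (\<alpha> \<mu> * l)
      - (\<mu> - c)\<^sup>2 * \<alpha> \<mu> * sinh (\<alpha> \<mu> * l) * cosh (\<beta> \<mu> * l))"
  have Fc: "F c > 0"
    using c l by (auto simp: F_def \<beta>_def)
  have Fm: "F (m\<^sup>2) < 0"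
    using c l m by (auto simp: F_def \<beta>_def \<alpha>_def intro!: mult_pos_pos)
  have "continuous_on {c..m\<^sup>2} F"
    unfolding F_def \<alpha>_def \<beta>_def by (intro continuous_intros)
  then obtain \<mu> where \<mu>: "c \<le> \<mu>" "\<mu> \<le> m\<^sup>2" "F \<mu> = 0"
    using IVT2'[of F "m\<^sup>2" 0 c] Fc Fm c by (auto intro: less_imp_le)
  with Fc Fm have \<mu>s: "c < \<mu>" "\<mu> < m\<^sup>2"
    by (metis less_eq_real_def less_irrefl)+
  define a b where "a = \<alpha> \<mu>" and "b = \<beta> \<mu>"
  have a2: "a * a = m\<^sup>2 + \<mu>" and b2: "b * b = m\<^sup>2 - \<mu>"
    using \<mu>s c m by (simp_all add: a_def b_def \<alpha>_def \<beta>_def)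
  define A where "A = (\<mu> - c) * cosh (b * l)"
  define B where "B = (\<mu> + c) * cosh (a * l)"
  have AB: "A > 0" "B > 0"
    using \<mu>s c by (simp_all add: A_def B_def)
  define \<psi> where "\<psi> = (\<lambda>y. A * cosh (a * y) + B * cosh (b * y))"
  have sm: "smooth \<psi>"
    unfolding \<psi>_def by (intro smooth_add smooth_mult smooth_const smooth_cosh)
  note d = deriv_cosh_sinh
  have d1: "deriv \<psi> = (\<lambda>y. (A * a) * sinh (a * y) + (B * b) * sinh (b * y))"
    unfolding \<psi>_def d ..
  have d2: "deriv (deriv \<psi>) = (\<lambda>y. (A * a * a) * cosh (a * y) + (B * b * b) * cosh (b * y))"
    unfolding d1 d ..
  have d3: "deriv (deriv (deriv \<psi>)) = (\<lambda>y. (A * a * a * a) * sinh (a * y) + (B * b * b * b) * sinh (b * y))"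
    unfolding d2 d ..
  have d4: "deriv (deriv (deriv (deriv \<psi>))) = (\<lambda>y. (A * a * a * a * a) * cosh (a * y) + (B * b * b * b * b) * cosh (b * y))"
    unfolding d3 d ..
  have bc2: "deriv (deriv \<psi>) l = sigma * m\<^sup>2 * \<psi> l"
  proof -
    have "deriv (deriv \<psi>) l - sigma * m\<^sup>2 * \<psi> l =
        A * (a * a - sigma * m\<^sup>2) * cosh (a * l) + B * (b * b - sigma * m\<^sup>2) * cosh (b * l)"
      unfolding d2 unfolding \<psi>_def by (simp add: algebra_simps)
    also have "\<dots> = 0"
    proof -
      have ab: "a * a - sigma * m\<^sup>2 = \<mu> + c" "b * b - sigma * m\<^sup>2 = c - \<mu>"
        unfolding a2 b2 by (simp_all add: sigma_def c_def algebra_simps)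
      show ?thesis
        unfolding ab A_def B_def by (simp add: algebra_simps)
    qed
    finally show ?thesis by simp
  qed
  have bc3: "deriv (deriv (deriv \<psi>)) l = (2 - sigma) * m\<^sup>2 * deriv \<psi> l"
  proof -
    have "deriv (deriv (deriv \<psi>)) l - (2 - sigma) * m\<^sup>2 * deriv \<psi> l =
        A * a * (a * a - (2 - sigma) * m\<^sup>2) * sinh (a * l) + B * b * (b * b - (2 - sigma) * m\<^sup>2) * sinh (b * l)"
      unfolding d3 unfolding d1 by (simp add: algebra_simps)
    also have "\<dots> = - F \<mu>"
    proof -
      have ab: "a * a - (2 - sigma) * m\<^sup>2 = \<mu> - c" "b * b - (2 - sigma) * m\<^sup>2 = - (\<mu> + c)"
        unfolding a2 b2 by (simp_all add: sigma_def c_def algebra_simps)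
      show ?thesis
        unfolding ab A_def B_def F_def a_def[symmetric] b_def[symmetric]
        by (simp add: algebra_simps power2_eq_square)
    qed
    finally show ?thesis using \<mu>(3) by simp
  qed
  have sym: "deriv (deriv \<psi>) (-l) = deriv (deriv \<psi>) l" "\<psi> (-l) = \<psi> l"
    "deriv (deriv (deriv \<psi>)) (-l) = - deriv (deriv (deriv \<psi>)) l" "deriv \<psi> (-l) = - deriv \<psi> l"
    unfolding d3 unfolding d2 unfolding d1 unfolding \<psi>_def by simp_all
  have ode: "deriv (deriv (deriv (deriv \<psi>))) y - 2 * m\<^sup>2 * deriv (deriv \<psi>) y + m ^ 4 * \<psi> y = \<mu>\<^sup>2 * \<psi> y" for y
  proof -
    have "deriv (deriv (deriv (deriv \<psi>))) y - 2 * m\<^sup>2 * deriv (deriv \<psi>) y + m ^ 4 * \<psi> y =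
      A * (a * a - m\<^sup>2)\<^sup>2 * cosh (a * y) + B * (b * b - m\<^sup>2)\<^sup>2 * cosh (b * y)"
      unfolding d4 unfolding d2 unfolding \<psi>_def by (simp add: algebra_simps power2_eq_square power4_eq_xxxx)
    also have "\<dots> = \<mu>\<^sup>2 * \<psi> y"
      unfolding a2 b2 \<psi>_def by (simp add: algebra_simps)
    finally show ?thesis .
  qed
  let ?e = "sep (\<lambda>x. sin (m * x)) \<psi>"
  have md: "mode l (m\<^sup>2) (\<mu>\<^sup>2) ?e"
    unfolding m_def
  proof (rule mode_separated[OF l sm])
    show "deriv (deriv \<psi>) y = sigma * (real n)\<^sup>2 * \<psi> y" if "y \<in> {-l, l}" for y
      using that bc2 sym by (auto simp: m_def)
    show "deriv (deriv (deriv \<psi>)) y = (2 - sigma) * (real n)\<^sup>2 * deriv \<psi> y" if "y \<in> {-l, l}" for y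
      using that bc3 sym by (auto simp: m_def)
  qed (use ode in \<open>simp add: m_def\<close>)
  have "A + B \<le> \<psi> y" for y
    unfolding \<psi>_def using AB cosh_real_ge_1[of "a * y"] cosh_real_ge_1[of "b * y"]
    by (intro add_mono) simp_all
  then have pos: "innerL2 l ?e ?e > 0"
    using innerL2_sep_sin_pos[OF l n sm, of "A + B"] AB by (simp add: m_def)
  define k where "k = 1 / (m * sqrt (innerL2 l ?e ?e))"
  have "mode l (m\<^sup>2) (\<mu>\<^sup>2) (\<lambda>z. k * ?e z)"
    by (rule mode_scale[OF md])
  moreover have "m\<^sup>2 * innerL2 l (\<lambda>z. k * ?e z) (\<lambda>z. k * ?e z) = 1"
  proof -
    define J where "J = innerL2 l ?e ?e"
    have "J > 0" using pos by (simp add: J_def)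
    have "m\<^sup>2 * innerL2 l (\<lambda>z. k * ?e z) (\<lambda>z. k * ?e z) = m\<^sup>2 * (k * (k * J))"
      unfolding J_def by (simp only: innerL2_scale_left innerL2_scale_right)
    also have "k * (k * J) = J / (m\<^sup>2 * (sqrt J * sqrt J))"
      unfolding k_def J_def[symmetric] by (simp add: power2_eq_square)
    also have "m\<^sup>2 * \<dots> = 1"
      using \<open>J > 0\<close> m by simp
    finally show ?thesis .
  qed
  moreover have "0 < \<mu>\<^sup>2" "\<mu>\<^sup>2 < m ^ 4"
  proof -
    have "\<mu>\<^sup>2 < (m\<^sup>2)\<^sup>2"
      using \<mu>s c by (intro power_strict_mono) auto
    then show "\<mu>\<^sup>2 < m ^ 4" by simp
  qed (use \<mu>s c in simp)
  ultimately show ?thesis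
    unfolding m_def by blast
qed


section \<open>Time profiles\<close>

text \<open>
  The first and second derivative are named explicitly because both occur in the equation of motion.
\<close>

definition has_derivs2 :: "(real \<Rightarrow> real) \<Rightarrow> (real \<Rightarrow> real) \<Rightarrow> (real \<Rightarrow> real) \<Rightarrow> bool" where
  "has_derivs2 f f' f'' \<longleftrightarrow> (\<forall>t. (f has_real_derivative f' t) (at t)) \<and>
     (\<forall>t. (f' has_real_derivative f'' t) (at t)) \<and> continuous_on UNIV f''"

lemma has_derivs2_continuous:
  assumes "has_derivs2 f f' f''"
  shows "continuous_on UNIV f" "continuous_on UNIV f'" "continuous_on UNIV f''"
  using assms unfolding has_derivs2_def by (auto intro: DERIV_continuous_on)

lemma has_derivs2_mult:
  assumes "has_derivs2 f f' f''" "has_derivs2 g g' g''"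
  shows "has_derivs2 (\<lambda>t. f t * g t) (\<lambda>t. f' t * g t + f t * g' t) (\<lambda>t. f'' t * g t + 2 * (f' t * g' t) + f t * g'' t)"
  unfolding has_derivs2_def
  using assms has_derivs2_continuous[OF assms(1)] has_derivs2_continuous[OF assms(2)]
  by (auto simp: has_derivs2_def intro!: derivative_eq_intros continuous_intros)

lemma has_derivs2_add:
  assumes "has_derivs2 f f' f''" "has_derivs2 g g' g''"
  shows "has_derivs2 (\<lambda>t. f t + g t) (\<lambda>t. f' t + g' t) (\<lambda>t. f'' t + g'' t)"
  unfolding has_derivs2_def
  using assms has_derivs2_continuous[OF assms(1)] has_derivs2_continuous[OF assms(2)]
  by (auto simp: has_derivs2_def intro!: derivative_eq_intros continuous_intros)

lemma has_derivs2_const: "has_derivs2 (\<lambda>t. c) (\<lambda>t. 0) (\<lambda>t. 0)"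
  by (simp add: has_derivs2_def)

lemma has_derivs2_sin: "has_derivs2 (\<lambda>t. sin (a * t)) (\<lambda>t. a * cos (a * t)) (\<lambda>t. - (a\<^sup>2) * sin (a * t))"
  unfolding has_derivs2_def
  by (auto intro!: derivative_eq_intros continuous_intros simp: power2_eq_square)

lemma has_derivs2_cos: "has_derivs2 (\<lambda>t. cos (a * t)) (\<lambda>t. - a * sin (a * t)) (\<lambda>t. - (a\<^sup>2) * cos (a * t))"
  unfolding has_derivs2_def
  by (auto intro!: derivative_eq_intros continuous_intros simp: power2_eq_square)

lemma has_derivs2_sqrt:
  assumes R: "has_derivs2 R R' R''" and pos: "\<And>t. R t > 0"
  shows "has_derivs2 (\<lambda>t. sqrt (R t)) (\<lambda>t. R' t / (2 * sqrt (R t)))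
           (\<lambda>t. R'' t / (2 * sqrt (R t)) - (R' t)\<^sup>2 / (4 * R t * sqrt (R t)))"
  unfolding has_derivs2_def
proof (intro conjI allI)
  have d: "((\<lambda>t. sqrt (R t)) has_real_derivative R' t / (2 * sqrt (R t))) (at t)" for t
  proof -
    have "(R has_real_derivative R' t) (at t)" using R by (simp add: has_derivs2_def)
    from DERIV_chain2[OF DERIV_real_sqrt[OF pos] this] show ?thesis
      by (simp add: field_simps)
  qed
  fix t
  show "((\<lambda>t. sqrt (R t)) has_real_derivative R' t / (2 * sqrt (R t))) (at t)" by (rule d)
  define w where "w = sqrt (R t)"
  have w: "w > 0" "R t = w * w" using pos[of t] by (auto simp: w_def)
  have "(R' has_real_derivative R'' t) (at t)" using R by (simp add: has_derivs2_def)
  from DERIV_divide[OF this DERIV_cmult[OF d[of t], of 2]] w(1)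
  have D: "((\<lambda>t. R' t / (2 * sqrt (R t))) has_real_derivative
      (R'' t * (2 * w) - R' t * (2 * (R' t / (2 * w)))) / (2 * w * (2 * w))) (at t)"
    by (simp add: w_def)
  have "(R'' t * (2 * w) - R' t * (2 * (R' t / (2 * w)))) / (2 * w * (2 * w)) =
      R'' t / (2 * w) - (R' t)\<^sup>2 / (4 * R t * w)"
    unfolding w(2) using w(1) by (simp add: field_simps power2_eq_square)
  from DERIV_cong[OF D this]
  show "((\<lambda>t. R' t / (2 * sqrt (R t))) has_real_derivative
      R'' t / (2 * sqrt (R t)) - (R' t)\<^sup>2 / (4 * R t * sqrt (R t))) (at t)"
    unfolding w_def .
next
  show "continuous_on UNIV (\<lambda>t. R'' t / (2 * sqrt (R t)) - (R' t)\<^sup>2 / (4 * R t * sqrt (R t)))"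
    using pos has_derivs2_continuous[OF R]
    by (intro continuous_intros) (auto simp: less_imp_neq[symmetric])
qed

lemma antiperiodic_deriv:
  fixes f :: "real \<Rightarrow> real"
  assumes "\<And>t. f (t + \<tau>) = - f t" "\<And>t. (f has_real_derivative f' t) (at t)"
  shows "f' (t + \<tau>) = - f' t"
proof -
  have "((\<lambda>t. f (t + \<tau>)) has_real_derivative f' (t + \<tau>)) (at t)"
    by (rule DERIV_shift[THEN iffD1, OF assms(2)])
  then have "((\<lambda>t. - f t) has_real_derivative f' (t + \<tau>)) (at t)"
    by (simp add: assms(1))
  moreover have "((\<lambda>t. - f t) has_real_derivative - f' t) (at t)"
    by (intro DERIV_minus assms)
  ultimately show ?thesis by (rule DERIV_unique)
qed

text \<open>
  Parametric excitation can balance the damping. In the time \<open>s = 3 t\<close>, with \<open>\<epsilon> = 1/10\<close>, the damping factor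
  is split off as \<open>d = exp (- \<epsilon> s / 2) y\<close>, where \<open>y = exp (h) sin s\<close> has to satisfy \<open>y'' + q y = 0\<close>
  for some \<open>q\<close>. This forces \<open>h' = 0\<close> at the zeros of the sine. The choice \<open>h' = \<epsilon> (sin s)\<^sup>2\<close> has mean
  \<open>\<epsilon> / 2\<close> and therefore offsets the damping exactly: \<open>d = sin s exp (- \<epsilon> sin (2 s) / 4)\<close>. Then \<open>Q\<close> is
  periodic and stays close to \<open>1\<close>.
\<close>

lemma damped_profile:
  fixes d Q :: "real \<Rightarrow> real"
  defines "d \<equiv> \<lambda>t::real. sin (3 * t) * exp (- sin (6 * t) / 40)"
  defines "Q \<equiv> \<lambda>t::real. 1 - (1/5) * sin (6 * t) - (1/400) * ((cos (6 * t))\<^sup>2 - 2 * cos (6 * t))"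
  shows "\<exists>d' d''. has_derivs2 d d' d'' \<and> (\<forall>t. d'' t + (3/10) * d' t + 9 * Q t * d t = 0)"
proof -
  define E where "E = (\<lambda>t::real. exp (- sin (6 * t) / 40))"
  have "has_derivs2 E (\<lambda>t. E t * (- (3/20) * cos (6 * t)))
      (\<lambda>t. E t * ((9/10) * sin (6 * t) + (9/400) * (cos (6 * t))\<^sup>2))"
    unfolding has_derivs2_def E_def
    by (auto intro!: derivative_eq_intros continuous_intros simp: field_simps power2_eq_square)
  from has_derivs2_mult[OF has_derivs2_sin[of 3] this]
  have hd: "has_derivs2 d (\<lambda>t. 3 * cos (3 * t) * E t + sin (3 * t) * (E t * (- (3/20) * cos (6 * t))))
     (\<lambda>t. - (3\<^sup>2) * sin (3 * t) * E t + 2 * (3 * cos (3 * t) * (E t * (- (3/20) * cos (6 * t)))) +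
          sin (3 * t) * (E t * ((9/10) * sin (6 * t) + (9/400) * (cos (6 * t))\<^sup>2)))"
    (is "has_derivs2 d ?d1 ?d2")
    unfolding d_def E_def .
  have "?d2 t + (3/10) * ?d1 t + 9 * Q t * d t = 0" for t
  proof -
    have s6: "sin (6 * t) = 2 * sin (3 * t) * cos (3 * t)"
      using sin_double[of "3 * t"] by simp
    have c6: "cos (6 * t) = 1 - 2 * (sin (3 * t))\<^sup>2"
      using cos_double_sin[of "3 * t"] by simp
    define S C where "S = sin (3 * t)" and "C = cos (3 * t)"
    have dt: "d t = S * E t" by (simp add: d_def E_def S_def)
    show ?thesis
      unfolding Q_def s6 c6 dt S_def[symmetric] C_def[symmetric]
      by (simp add: field_simps power2_eq_square)
  qed
  with hd show ?thesis by blast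
qed

lemma ex_derivs2:
  assumes "\<exists>f' f''. has_derivs2 f f' f''" "\<exists>g' g''. has_derivs2 g g' g''"
  shows "\<exists>h' h''. has_derivs2 (\<lambda>t. f t + g t) h' h''" "\<exists>h' h''. has_derivs2 (\<lambda>t. f t * g t) h' h''"
  using assms has_derivs2_add has_derivs2_mult by blast+

text \<open>
  The coefficient \<open>9 Q\<close> of the Hill equation for \<open>d\<close> is realised as \<open>\<Lambda>\<close> plus the stretching energy
  \<open>d\<^sup>2 + p\<^sup>2 + q\<^sup>2\<close>. The remainder \<open>R = 9 Q - \<Lambda> - d\<^sup>2\<close> is periodic and positive, whereas a single
  antiperiodic \<open>p\<close> has zeros; the vector \<open>(p, q)\<close> of length \<open>sqrt R\<close> has to be antiperiodic without
  vanishing, so it makes a half-turn in each period of \<open>R\<close>. The frequency \<open>3\<close> is large enough for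
  \<open>R > 0\<close>, since \<open>\<Lambda> < 1\<close>, \<open>d\<^sup>2 \<le> 2\<close> and \<open>9 Q > 7\<close>.
\<close>

lemma time_profiles:
  assumes L: "0 < \<Lambda>" "\<Lambda> < (1::real)"
  shows "\<exists>d d' d'' p p' p'' q q' q''. has_derivs2 d d' d'' \<and> has_derivs2 p p' p'' \<and> has_derivs2 q q' q'' \<and>
     (\<forall>t. d (t + pi / 3) = - d t \<and> p (t + pi / 3) = - p t \<and> q (t + pi / 3) = - q t) \<and>
     (\<forall>t. d'' t + (3/10) * d' t + (\<Lambda> + ((d t)\<^sup>2 + (p t)\<^sup>2 + (q t)\<^sup>2)) * d t = 0) \<and> d (pi / 6) \<noteq> 0"
proof -
  define d where "d = (\<lambda>t::real. sin (3 * t) * exp (- sin (6 * t) / 40))"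
  define Q where "Q = (\<lambda>t::real. 1 - (1/5) * sin (6 * t) - (1/400) * ((cos (6 * t))\<^sup>2 - 2 * cos (6 * t)))"
  obtain d' d'' where d: "has_derivs2 d d' d''" "\<And>t. d'' t + (3/10) * d' t + 9 * Q t * d t = 0"
    using damped_profile unfolding d_def Q_def by blast
  define R where "R = (\<lambda>t. 9 * Q t - \<Lambda> - (d t)\<^sup>2)"
  have per3: "sin (3 * (t + pi / 3)) = - sin (3 * t)" "cos (3 * (t + pi / 3)) = - cos (3 * t)" for t
    by (simp_all add: distrib_left)
  have per6: "sin (6 * (t + pi / 3)) = sin (6 * t)" "cos (6 * (t + pi / 3)) = cos (6 * t)" for t
    by (simp_all add: distrib_left)
  have da: "d (t + pi / 3) = - d t" for t
    unfolding d_def per3 per6 by simp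
  have Rp: "R (t + pi / 3) = R t" for t
    unfolding R_def da Q_def per6 by simp
  have Rpos: "R t > 0" for t
  proof -
    have "\<bar>d t\<bar> \<le> 1 * exp (1/40)"
      unfolding d_def abs_mult using sin_ge_minus_one[of "6 * t"] by (intro mult_mono) auto
    then have "(d t)\<^sup>2 \<le> (exp (1/40))\<^sup>2"
      by (subst abs_le_square_iff[symmetric]) simp
    also have "\<dots> = exp (1/20)"
      by (simp add: power2_eq_square exp_add[symmetric])
    also have "\<dots> \<le> 2"
      using exp_bound[of "1/20"] by (simp add: power2_eq_square)
    finally have d2: "(d t)\<^sup>2 \<le> 2" .
    have "(cos (6 * t))\<^sup>2 \<le> 1"
      by (simp add: abs_square_le_1)
    moreover have "1 - (1/5) - (1/400) * (1 + 2) \<le> 1 - (1/5) * s - (1/400) * (w - 2 * c)"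
      if "s \<le> 1" "w \<le> 1" "-1 \<le> c" for s w c :: real
    proof -
      have "(1/400) * (w - 2 * c) \<le> (1/400) * (1 + 2)"
        using that by (intro mult_left_mono) auto
      moreover have "(1/5) * s \<le> 1/5"
        using that by simp
      ultimately show ?thesis by linarith
    qed
    ultimately have "Q t \<ge> 1 - (1/5) - (1/400) * (1 + 2)"
      unfolding Q_def using sin_le_one[of "6 * t"] cos_ge_minus_one[of "6 * t"] by blast
    with d2 L show ?thesis unfolding R_def by simp
  qed
  have "\<exists>R' R''. has_derivs2 R R' R''"
  proof -
    let ?s = "\<lambda>t::real. sin (6 * t)" and ?c = "\<lambda>t::real. cos (6 * t)"
    have e: "R = (\<lambda>t. (9 - \<Lambda>) + ((-9/5) * ?s t + (((-9/400) * (?c t * ?c t) + (9/200) * ?c t) + (-1) * (d t * d t))))"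
      by (simp add: R_def Q_def fun_eq_iff power2_eq_square algebra_simps)
    show ?thesis
      unfolding e
    proof (intro ex_derivs2)
      show "\<exists>h' h''. has_derivs2 (\<lambda>t. c) h' h''" for c
        using has_derivs2_const by blast
    qed (use has_derivs2_const has_derivs2_sin has_derivs2_cos d(1) in blast)+
  qed
  then obtain R' R'' where "has_derivs2 R R' R''" by blast
  note r = has_derivs2_sqrt[OF this Rpos]
  have "\<exists>p' p'' q' q''. has_derivs2 (\<lambda>t. sqrt (R t) * cos (3 * t)) p' p'' \<and> has_derivs2 (\<lambda>t. sqrt (R t) * sin (3 * t)) q' q''"
    using has_derivs2_mult[OF r has_derivs2_cos] has_derivs2_mult[OF r has_derivs2_sin] by blast
  then obtain p' p'' q' q'' where pq: "has_derivs2 (\<lambda>t. sqrt (R t) * cos (3 * t)) p' p''"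
      "has_derivs2 (\<lambda>t. sqrt (R t) * sin (3 * t)) q' q''" by blast
  have N: "\<Lambda> + ((d t)\<^sup>2 + (sqrt (R t) * cos (3 * t))\<^sup>2 + (sqrt (R t) * sin (3 * t))\<^sup>2) = 9 * Q t" for t
  proof -
    have "(sqrt (R t) * cos (3 * t))\<^sup>2 + (sqrt (R t) * sin (3 * t))\<^sup>2 = R t * ((sin (3 * t))\<^sup>2 + (cos (3 * t))\<^sup>2)"
      using Rpos[of t] by (simp only: power_mult_distrib real_sqrt_pow2 less_imp_le distrib_left)
    then show ?thesis by (simp add: R_def)
  qed
  show ?thesis
  proof (intro exI conjI allI)
    show "has_derivs2 d d' d''" by (rule d)
    show "has_derivs2 (\<lambda>t. sqrt (R t) * cos (3 * t)) p' p''" "has_derivs2 (\<lambda>t. sqrt (R t) * sin (3 * t)) q' q''"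
      by (rule pq)+
    fix t
    show "d (t + pi / 3) = - d t" by (rule da)
    show "sqrt (R (t + pi / 3)) * cos (3 * (t + pi / 3)) = - (sqrt (R t) * cos (3 * t))"
      "sqrt (R (t + pi / 3)) * sin (3 * (t + pi / 3)) = - (sqrt (R t) * sin (3 * t))"
      unfolding Rp per3 by simp_all
    show "d'' t + (3/10) * d' t + (\<Lambda> + ((d t)\<^sup>2 + (sqrt (R t) * cos (3 * t))\<^sup>2 + (sqrt (R t) * sin (3 * t))\<^sup>2)) * d t = 0"
      unfolding N by (rule d)
    show "d (pi / 6) \<noteq> 0" by (simp add: d_def)
  qed
qed


section \<open>The dual norm and the smallest eigenvalue\<close>

definition Poincare_const :: real where
  "Poincare_const = sqrt (5 * pi ^ 4)"

lemma innerH2star_nonneg: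
  assumes "0 < l" "v \<in> H2star l"
  shows "0 \<le> innerH2star l v v"
proof -
  have "0 \<le> 5 * pi ^ 4 * innerH2star l v v"
    using H2star_coercive[OF assms] innerL2_nonneg[of l v] by linarith
  then show ?thesis by (simp add: zero_le_mult_iff)
qed

lemma normL2_le_normH2star:
  assumes "0 < l" "v \<in> H2star l"
  shows "normL2 l v \<le> Poincare_const * normH2star l v"
proof -
  have "sqrt (innerL2 l v v) \<le> sqrt (5 * pi ^ 4 * innerH2star l v v)"
    by (rule real_sqrt_le_mono[OF H2star_coercive[OF assms]])
  then show ?thesis
    by (simp only: normL2_def normH2star_def Poincare_const_def real_sqrt_mult)
qed

lemma innerL2_dual_bound:
  assumes "0 < l" "w \<in> L2 l" "v \<in> H2star l"
  shows "\<bar>innerL2 l w v\<bar> \<le> (Poincare_const * normL2 l w) * normH2star l v"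
proof -
  have "\<bar>innerL2 l w v\<bar> \<le> normL2 l w * normL2 l v"
    by (rule innerL2_Cauchy_Schwarz[OF assms(2) H2star_L2[OF assms(3)]])
  also have "\<dots> \<le> normL2 l w * (Poincare_const * normH2star l v)"
    by (intro mult_left_mono normL2_le_normH2star assms) (simp add: normL2_def innerL2_nonneg)
  finally show ?thesis by (simp add: mult_ac)
qed

lemma innerL2_in_dual:
  assumes "0 < l" "w \<in> L2 l"
  shows "innerL2 l w \<in> dualH2star l"
  unfolding dualH2star_def
proof (intro CollectI conjI ballI allI)
  show "innerL2 l w (\<lambda>z. a * U z + b * V z) = a * innerL2 l w U + b * innerL2 l w V"
    if "U \<in> H2star l" "V \<in> H2star l" for U V a b
    using that assms by (simp add: innerL2_add_right innerL2_scale_right L2_scale H2star_L2)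
  show "\<exists>C. \<forall>V\<in>H2star l. \<bar>innerL2 l w V\<bar> \<le> C * normH2star l V"
    using innerL2_dual_bound[OF assms] by blast
qed

text \<open>
  The supremum is taken over a nonempty set because \<open>H2star\<close> contains the zero multiple of \<open>u\<close>. The functional \<open>F\<close> is free outside \<open>H2star\<close>, where the difference quotients of
  functionals need not be represented by an inner product.
\<close>

lemma norm_dual_innerL2_bound:
  assumes l: "0 < l" and w: "w \<in> L2 l" and u: "u \<in> H2star l"
    and F: "\<And>v. v \<in> H2star l \<Longrightarrow> F v = innerL2 l w v"
  shows "0 \<le> norm_dual l F" "norm_dual l F \<le> Poincare_const * normL2 l w"
proof -
  let ?S = "{V \<in> H2star l. normH2star l V \<le> 1}"
  have "(\<lambda>z. 0 * u z) \<in> H2star l" by (rule H2star_scale[OF u])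
  moreover have "normH2star l (\<lambda>z. 0 * u z) = 0"
    using H2star_forms_scale(1)[OF u calculation, of 0] by (simp add: normH2star_def)
  ultimately have z: "(\<lambda>z. 0 * u z) \<in> ?S" by simp
  have C: "0 \<le> Poincare_const * normL2 l w"
    by (simp add: Poincare_const_def normL2_def innerL2_nonneg)
  have b: "\<bar>F V\<bar> \<le> Poincare_const * normL2 l w" if "V \<in> ?S" for V
  proof -
    have "\<bar>F V\<bar> \<le> (Poincare_const * normL2 l w) * normH2star l V"
      using that innerL2_dual_bound[OF l w] F by simp
    also have "\<dots> \<le> (Poincare_const * normL2 l w) * 1"
      using that by (intro mult_left_mono C) simp
    finally show ?thesis by simp
  qed
  show "norm_dual l F \<le> Poincare_const * normL2 l w"
    unfolding norm_dual_def using z b by (intro cSUP_least) auto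
  have "bdd_above ((\<lambda>V. \<bar>F V\<bar>) ` ?S)"
    using b by (intro bdd_aboveI2)
  then have "\<bar>F (\<lambda>z. 0 * u z)\<bar> \<le> norm_dual l F"
    unfolding norm_dual_def by (rule cSUP_upper[OF z])
  then show "0 \<le> norm_dual l F" by linarith
qed

lemma eqL2_zero_iff:
  assumes "v \<in> L2 l"
  shows "innerL2 l v v = 0 \<longleftrightarrow> eqL2 l v (\<lambda>_. 0)"
  unfolding innerL2_def eqL2_def
  by (subst integral_nonneg_eq_0_iff_AE) (auto intro: L2_product_integrable assms)

lemma lambda1_pos:
  assumes l: "0 < l" and u: "u \<in> H2star l" "\<not> eqL2 l u (\<lambda>_. 0)"
  shows "0 < lambda1 l"
proof -
  have "1 / (5 * pi ^ 4) \<le> lambda1 l"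
    unfolding lambda1_def
  proof (rule cInf_greatest)
    show "{(normH2star l v)\<^sup>2 / (normL2 l v)\<^sup>2 |v. v \<in> H2star l \<and> \<not> eqL2 l v (\<lambda>_. 0)} \<noteq> {}"
      using u by blast
    fix x assume "x \<in> {(normH2star l v)\<^sup>2 / (normL2 l v)\<^sup>2 |v. v \<in> H2star l \<and> \<not> eqL2 l v (\<lambda>_. 0)}"
    then obtain v where v: "v \<in> H2star l" "\<not> eqL2 l v (\<lambda>_. 0)"
        and x: "x = (normH2star l v)\<^sup>2 / (normL2 l v)\<^sup>2" by blast
    have "innerL2 l v v > 0"
      using eqL2_zero_iff[OF H2star_L2[OF v(1)]] v(2) innerL2_nonneg[of l v] by linarith
    moreover have xq: "x = innerH2star l v v / innerL2 l v v"
      unfolding x normL2_square using innerH2star_nonneg[OF l v(1)] by (simp add: normH2star_def)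
    ultimately show "1 / (5 * pi ^ 4) \<le> x"
      using H2star_coercive[OF l v(1)] unfolding xq by (simp add: field_simps)
  qed
  moreover have "0 < 1 / (5 * pi ^ 4)" by simp
  ultimately show ?thesis by linarith
qed


section \<open>Motions in three modes\<close>

text \<open>
  The modes belong to \<open>sin x\<close>, \<open>sin (2 x)\<close> and \<open>sin (3 x)\<close>, and each is normalised so that its
  \<open>x\<close>-derivative has norm \<open>1\<close>.
\<close>

locale three_modes =
  fixes l :: real and e1 e2 e3 :: "real \<times> real \<Rightarrow> real" and \<Lambda>1 \<Lambda>2 \<Lambda>3 :: real
  assumes l_pos: "0 < l"
    and mode1: "mode l 1 \<Lambda>1 e1" and mode2: "mode l 4 \<Lambda>2 e2" and mode3: "mode l 9 \<Lambda>3 e3"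
    and normal: "innerL2 l e1 e1 = 1" "4 * innerL2 l e2 e2 = 1" "9 * innerL2 l e3 e3 = 1"
begin

definition comb :: "real \<Rightarrow> real \<Rightarrow> real \<Rightarrow> real \<times> real \<Rightarrow> real" where
  "comb a b c = (\<lambda>z. (a * e1 z + b * e2 z) + c * e3 z)"

lemma e_H2star: "e1 \<in> H2star l" "e2 \<in> H2star l" "e3 \<in> H2star l"
  using mode1 mode2 mode3 by (auto simp: mode_def)

lemma e_L2: "e1 \<in> L2 l" "e2 \<in> L2 l" "e3 \<in> L2 l"
  using e_H2star by (auto intro: H2star_L2)

lemma comb_H2star: "comb a b c \<in> H2star l"
  unfolding comb_def by (intro H2star_add H2star_scale e_H2star)

lemma comb_L2: "comb a b c \<in> L2 l"
  by (rule H2star_L2[OF comb_H2star])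

lemma comb_innerL2:
  "v \<in> L2 l \<Longrightarrow> innerL2 l (comb a b c) v = a * innerL2 l e1 v + b * innerL2 l e2 v + c * innerL2 l e3 v"
  unfolding comb_def by (simp add: innerL2_add_left L2_add L2_scale e_L2 innerL2_scale_left)

lemma comb_forms:
  assumes v: "v \<in> H2star l"
  shows "innerH2star l (comb a b c) v =
      \<Lambda>1 * a * innerL2 l e1 v + \<Lambda>2 * b * innerL2 l e2 v + \<Lambda>3 * c * innerL2 l e3 v"
    and "gradx l (comb a b c) v = a * innerL2 l e1 v + 4 * b * innerL2 l e2 v + 9 * c * innerL2 l e3 v"
  using mode1 mode2 mode3 v unfolding comb_def mode_def
  by (simp_all add: H2star_forms_add H2star_forms_scale H2star_add H2star_scale e_H2star)

lemma orthogonal: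
  "innerL2 l e1 e2 = 0" "innerL2 l e2 e1 = 0" "innerL2 l e1 e3 = 0" "innerL2 l e3 e1 = 0"
  "innerL2 l e2 e3 = 0" "innerL2 l e3 e2 = 0"
  using mode_orthogonal[OF mode1 mode2] mode_orthogonal[OF mode2 mode1] mode_orthogonal[OF mode1 mode3]
    mode_orthogonal[OF mode3 mode1] mode_orthogonal[OF mode2 mode3] mode_orthogonal[OF mode3 mode2]
  by simp_all

lemma e_comb:
  "innerL2 l e1 (comb a b c) = a" "innerL2 l e2 (comb a b c) = b / 4" "innerL2 l e3 (comb a b c) = c / 9"
  using normal orthogonal
  by (simp_all add: innerL2_commute[of l _ "comb a b c"] comb_innerL2 e_L2)

lemma comb_norms:
  "normL2 l (comb a b c) = sqrt (a\<^sup>2 + b\<^sup>2 / 4 + c\<^sup>2 / 9)"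
  "normH2star l (comb a b c) = sqrt (\<Lambda>1 * a\<^sup>2 + \<Lambda>2 * b\<^sup>2 / 4 + \<Lambda>3 * c\<^sup>2 / 9)"
  "(normL2 l (weak_deriv l 1 0 (comb a b c)))\<^sup>2 = a\<^sup>2 + b\<^sup>2 + c\<^sup>2"
proof -
  show "normL2 l (comb a b c) = sqrt (a\<^sup>2 + b\<^sup>2 / 4 + c\<^sup>2 / 9)"
    by (simp add: normL2_def comb_innerL2 comb_L2 e_comb power2_eq_square)
  show "normH2star l (comb a b c) = sqrt (\<Lambda>1 * a\<^sup>2 + \<Lambda>2 * b\<^sup>2 / 4 + \<Lambda>3 * c\<^sup>2 / 9)"
    by (simp add: normH2star_def comb_forms comb_H2star e_comb power2_eq_square mult.assoc)
  have "(normL2 l (weak_deriv l 1 0 (comb a b c)))\<^sup>2 = gradx l (comb a b c) (comb a b c)"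
    by (simp only: normL2_square gradx_def)
  also have "\<dots> = a\<^sup>2 + b\<^sup>2 + c\<^sup>2"
    by (simp add: comb_forms comb_H2star e_comb power2_eq_square)
  finally show "(normL2 l (weak_deriv l 1 0 (comb a b c)))\<^sup>2 = a\<^sup>2 + b\<^sup>2 + c\<^sup>2" .
qed

lemma comb_diff: "(\<lambda>z. comb a b c z - comb a' b' c' z) = comb (a - a') (b - b') (c - c')"
  by (simp add: comb_def fun_eq_iff algebra_simps)

lemma comb_quotient:
  "(\<lambda>z. (comb a b c z - comb a' b' c' z) / h - comb p q r z) =
     comb ((a - a') / h - p) ((b - b') / h - q) ((c - c') / h - r)"
  by (simp add: comb_def fun_eq_iff diff_divide_distrib add_divide_distrib algebra_simps)

lemma comb_norms_tendsto:
  assumes "(f \<longlongrightarrow> 0) F" "(g \<longlongrightarrow> 0) F" "(h \<longlongrightarrow> 0) F"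
  shows "((\<lambda>s. normL2 l (comb (f s) (g s) (h s))) \<longlongrightarrow> 0) F"
    and "((\<lambda>s. normH2star l (comb (f s) (g s) (h s))) \<longlongrightarrow> 0) F"
proof -
  have "((\<lambda>s. sqrt ((f s)\<^sup>2 + (g s)\<^sup>2 / 4 + (h s)\<^sup>2 / 9)) \<longlongrightarrow> sqrt (0\<^sup>2 + 0\<^sup>2 / 4 + 0\<^sup>2 / 9)) F"
    by (intro tendsto_intros assms) auto
  then show "((\<lambda>s. normL2 l (comb (f s) (g s) (h s))) \<longlongrightarrow> 0) F"
    by (simp add: comb_norms)
  have "((\<lambda>s. sqrt (\<Lambda>1 * (f s)\<^sup>2 + \<Lambda>2 * (g s)\<^sup>2 / 4 + \<Lambda>3 * (h s)\<^sup>2 / 9)) \<longlongrightarrow>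
      sqrt (\<Lambda>1 * 0\<^sup>2 + \<Lambda>2 * 0\<^sup>2 / 4 + \<Lambda>3 * 0\<^sup>2 / 9)) F"
    by (intro tendsto_intros assms) auto
  then show "((\<lambda>s. normH2star l (comb (f s) (g s) (h s))) \<longlongrightarrow> 0) F"
    by (simp add: comb_norms)
qed

lemma dual_tendsto:
  assumes "\<And>s v. v \<in> H2star l \<Longrightarrow> G s v = innerL2 l (comb (f s) (g s) (h s)) v"
    and "(f \<longlongrightarrow> 0) F" "(g \<longlongrightarrow> 0) F" "(h \<longlongrightarrow> 0) F"
  shows "((\<lambda>s. norm_dual l (G s)) \<longlongrightarrow> 0) F"
proof (rule tendsto_sandwich)
  note b = norm_dual_innerL2_bound[OF l_pos comb_L2 e_H2star(1) assms(1)]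
  show "\<forall>\<^sub>F s in F. 0 \<le> norm_dual l (G s)"
    by (intro always_eventually allI b(1))
  show "\<forall>\<^sub>F s in F. norm_dual l (G s) \<le> Poincare_const * normL2 l (comb (f s) (g s) (h s))"
    by (intro always_eventually allI b(2))
  show "((\<lambda>s. Poincare_const * normL2 l (comb (f s) (g s) (h s))) \<longlongrightarrow> 0) F"
    using tendsto_mult[OF tendsto_const comb_norms_tendsto(1)[OF assms(2-4)], of Poincare_const] by simp
qed simp

lemma diff_tendsto:
  fixes f :: "real \<Rightarrow> real"
  assumes "continuous_on UNIV f"
  shows "((\<lambda>s. f s - f t) \<longlongrightarrow> 0) (at t)"
  using assms by (simp add: continuous_on_eq_continuous_at isCont_def LIM_zero)

lemma quotient_tendsto:
  fixes f :: "real \<Rightarrow> real"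
  assumes "(f has_real_derivative f') (at t)"
  shows "((\<lambda>h. (f (t + h) - f t) / h - f') \<longlongrightarrow> 0) (at 0)"
  using assms by (simp add: DERIV_def LIM_zero)

lemma comb_cont_wrt:
  assumes "continuous_on UNIV f" "continuous_on UNIV g" "continuous_on UNIV h"
  shows "cont_wrt (normL2 l) (\<lambda>t. comb (f t) (g t) (h t))"
    and "cont_wrt (normH2star l) (\<lambda>t. comb (f t) (g t) (h t))"
    and "cont_wrt (norm_dual l) (\<lambda>t. innerL2 l (comb (f t) (g t) (h t)))"
  unfolding cont_wrt_def comb_diff
proof (safe)
  fix t
  note d = diff_tendsto[OF assms(1), of t] diff_tendsto[OF assms(2), of t] diff_tendsto[OF assms(3), of t]
  show "((\<lambda>s. normL2 l (comb (f s - f t) (g s - g t) (h s - h t))) \<longlongrightarrow> 0) (at t)"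
    by (rule comb_norms_tendsto(1)[OF d])
  show "((\<lambda>s. normH2star l (comb (f s - f t) (g s - g t) (h s - h t))) \<longlongrightarrow> 0) (at t)"
    by (rule comb_norms_tendsto(2)[OF d])
  show "((\<lambda>s. norm_dual l (\<lambda>a. innerL2 l (comb (f s) (g s) (h s)) a - innerL2 l (comb (f t) (g t) (h t)) a)) \<longlongrightarrow> 0) (at t)"
  proof (rule dual_tendsto[OF _ d])
    fix s v assume "v \<in> H2star l"
    then show "innerL2 l (comb (f s) (g s) (h s)) v - innerL2 l (comb (f t) (g t) (h t)) v =
        innerL2 l (comb (f s - f t) (g s - g t) (h s - h t)) v"
      by (simp add: comb_innerL2 H2star_L2 algebra_simps)
  qed
qed

lemma comb_deriv_wrt:
  assumes "\<And>t. (f has_real_derivative f' t) (at t)" "\<And>t. (g has_real_derivative g' t) (at t)"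
    "\<And>t. (h has_real_derivative h' t) (at t)"
  shows "deriv_wrt (normL2 l) (\<lambda>t. comb (f t) (g t) (h t)) (\<lambda>t. comb (f' t) (g' t) (h' t))"
    and "deriv_wrt (norm_dual l) (\<lambda>t. innerL2 l (comb (f t) (g t) (h t))) (\<lambda>t. innerL2 l (comb (f' t) (g' t) (h' t)))"
  unfolding deriv_wrt_def comb_quotient
proof (safe)
  fix t
  note d = quotient_tendsto[OF assms(1), of t] quotient_tendsto[OF assms(2), of t] quotient_tendsto[OF assms(3), of t]
  show "((\<lambda>s. normL2 l (comb ((f (t + s) - f t) / s - f' t) ((g (t + s) - g t) / s - g' t) ((h (t + s) - h t) / s - h' t))) \<longlongrightarrow> 0) (at 0)"
    by (rule comb_norms_tendsto(1)[OF d])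
  show "((\<lambda>s. norm_dual l (\<lambda>a. (innerL2 l (comb (f (t + s)) (g (t + s)) (h (t + s))) a - innerL2 l (comb (f t) (g t) (h t)) a) / s
      - innerL2 l (comb (f' t) (g' t) (h' t)) a)) \<longlongrightarrow> 0) (at 0)"
  proof (rule dual_tendsto[OF _ d])
    fix s v assume "v \<in> H2star l"
    then show "(innerL2 l (comb (f (t + s)) (g (t + s)) (h (t + s))) v - innerL2 l (comb (f t) (g t) (h t)) v) / s
        - innerL2 l (comb (f' t) (g' t) (h' t)) v =
        innerL2 l (comb ((f (t + s) - f t) / s - f' t) ((g (t + s) - g t) / s - g' t) ((h (t + s) - h t) / s - h' t)) v"
      by (simp add: comb_innerL2 H2star_L2 diff_divide_distrib add_divide_distrib algebra_simps)
  qed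
qed

text \<open>
  The stretching energy of a combination is \<open>N = f\<^sup>2 + g\<^sup>2 + h\<^sup>2\<close>, and testing with \<open>v\<close> gives one scalar
  equation per mode. Only \<open>f\<^sup>2\<close> enters \<open>N\<close>, so a change of the sign of \<open>f\<close> affects the force in the
  first mode alone.
\<close>

lemma comb_weak_solution:
  assumes f: "has_derivs2 f f' f''" and g: "has_derivs2 g g' g''" and h: "has_derivs2 h h' h''"
  defines "N \<equiv> \<lambda>t. (f t)\<^sup>2 + (g t)\<^sup>2 + (h t)\<^sup>2"
  assumes G: "\<And>t. G t = comb (f'' t + \<delta> * f' t + (\<Lambda>1 + N t) * f t)
      (g'' t + \<delta> * g' t + (\<Lambda>2 + 4 * N t) * g t) (h'' t + \<delta> * h' t + (\<Lambda>3 + 9 * N t) * h t)"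
  shows "weak_solution l \<delta> 0 1 G (\<lambda>t. comb (f t) (g t) (h t))"
proof -
  have D: "\<And>t. (f has_real_derivative f' t) (at t)" "\<And>t. (g has_real_derivative g' t) (at t)"
      "\<And>t. (h has_real_derivative h' t) (at t)"
      "\<And>t. (f' has_real_derivative f'' t) (at t)" "\<And>t. (g' has_real_derivative g'' t) (at t)"
      "\<And>t. (h' has_real_derivative h'' t) (at t)"
    using f g h by (auto simp: has_derivs2_def)
  note c = has_derivs2_continuous[OF f] has_derivs2_continuous[OF g] has_derivs2_continuous[OF h]
  show ?thesis
    unfolding weak_solution_def C0_L2_def
  proof (intro conjI allI ballI exI[of _ "\<lambda>t. comb (f' t) (g' t) (h' t)"]
      exI[of _ "\<lambda>t. innerL2 l (comb (f'' t) (g'' t) (h'' t))"])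
    show "comb (f t) (g t) (h t) \<in> H2star l" "comb (f' t) (g' t) (h' t) \<in> L2 l"
      "innerL2 l (comb (f'' t) (g'' t) (h'' t)) \<in> dualH2star l" for t
      by (rule comb_H2star comb_L2 innerL2_in_dual[OF l_pos comb_L2])+
    show "cont_wrt (normH2star l) (\<lambda>t. comb (f t) (g t) (h t))"
      "cont_wrt (normL2 l) (\<lambda>t. comb (f' t) (g' t) (h' t))"
      "cont_wrt (norm_dual l) (\<lambda>t. innerL2 l (comb (f'' t) (g'' t) (h'' t)))"
      using c by (auto intro: comb_cont_wrt)
    show "deriv_wrt (normL2 l) (\<lambda>t. comb (f t) (g t) (h t)) (\<lambda>t. comb (f' t) (g' t) (h' t))"
      "deriv_wrt (norm_dual l) (\<lambda>t. innerL2 l (comb (f' t) (g' t) (h' t))) (\<lambda>t. innerL2 l (comb (f'' t) (g'' t) (h'' t)))"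
      by (rule comb_deriv_wrt; rule D)+
    fix t v assume v: "v \<in> H2star l"
    note vL = H2star_L2[OF v]
    have "innerL2 l (comb (f'' t) (g'' t) (h'' t)) v + \<delta> * innerL2 l (comb (f' t) (g' t) (h' t)) v
         + innerH2star l (comb (f t) (g t) (h t)) v + (1 * N t - 0) * gradx l (comb (f t) (g t) (h t)) v
         = innerL2 l (G t) v"
      unfolding G comb_innerL2[OF vL] comb_forms[OF v] by (simp add: algebra_simps)
    then show "innerL2 l (comb (f'' t) (g'' t) (h'' t)) v + \<delta> * innerL2 l (comb (f' t) (g' t) (h' t)) v
         + innerH2star l (comb (f t) (g t) (h t)) v
         + (1 * (normL2 l (weak_deriv l 1 0 (comb (f t) (g t) (h t))))\<^sup>2 - 0) *
           innerL2 l (weak_deriv l 1 0 (comb (f t) (g t) (h t))) (weak_deriv l 1 0 v)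
         = innerL2 l (G t) v"
      unfolding comb_norms(3) N_def gradx_def .
  qed
qed

lemma comb_antiperiodic:
  assumes "\<And>t. f (t + \<tau>) = - f t" "\<And>t. g (t + \<tau>) = - g t" "\<And>t. h (t + \<tau>) = - h t"
  shows "antiperiodic l \<tau> (\<lambda>t. comb (f t) (g t) (h t))"
  by (simp add: antiperiodic_def assms eqL2_def comb_def)

lemma comb_distinct:
  assumes "a \<noteq> a'"
  shows "\<not> eqL2 l (comb a b c) (comb a' b c)"
proof
  assume "eqL2 l (comb a b c) (comb a' b c)"
  then have "innerL2 l (comb a b c) e1 = innerL2 l (comb a' b c) e1"
    by (intro innerL2_cong_AE comb_L2 e_L2) (auto simp: eqL2_def)
  with assms normal orthogonal show False
    by (simp add: comb_innerL2 e_L2)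
qed

end

theorem theorem10:
  fixes l :: real
  assumes "0 < l" and "l < pi"
  shows "\<exists>\<tau> > 0. \<exists>g. C0_L2 l g \<and> antiperiodic l \<tau> g \<and>
           (\<exists>\<delta> P S. 0 < \<delta> \<and> 0 \<le> P \<and> P < lambda1 l \<and> 0 < S \<and>
              (\<exists>u1 u2. weak_solution l \<delta> P S g u1 \<and> antiperiodic l \<tau> u1 \<and>
                       weak_solution l \<delta> P S g u2 \<and> antiperiodic l \<tau> u2 \<and>
                       (\<exists>t. \<not> eqL2 l (u1 t) (u2 t))))"
proof -
  obtain e1 \<Lambda>1 where e1: "mode l 1 \<Lambda>1 e1" "innerL2 l e1 e1 = 1" "0 < \<Lambda>1" "\<Lambda>1 < 1"
    using exists_mode[OF assms(1), of 1] by auto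
  obtain e2 \<Lambda>2 where e2: "mode l 4 \<Lambda>2 e2" "4 * innerL2 l e2 e2 = 1"
    using exists_mode[OF assms(1), of 2] by auto
  obtain e3 \<Lambda>3 where e3: "mode l 9 \<Lambda>3 e3" "9 * innerL2 l e3 e3 = 1"
    using exists_mode[OF assms(1), of 3] by auto
  interpret three_modes l e1 e2 e3 \<Lambda>1 \<Lambda>2 \<Lambda>3
    by unfold_locales (rule assms e1 e2 e3)+
  obtain d d' d'' p p' p'' q q' q'' where
      d: "has_derivs2 d d' d''" and p: "has_derivs2 p p' p''" and q: "has_derivs2 q q' q''"
    and ap: "\<And>t. d (t + pi / 3) = - d t" "\<And>t. p (t + pi / 3) = - p t" "\<And>t. q (t + pi / 3) = - q t"
    and ode: "\<And>t. d'' t + (3/10) * d' t + (\<Lambda>1 + ((d t)\<^sup>2 + (p t)\<^sup>2 + (q t)\<^sup>2)) * d t = 0"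
    and nz: "d (pi / 6) \<noteq> 0"
    using time_profiles[OF e1(3,4)] by blast
  define N where "N = (\<lambda>t. (d t)\<^sup>2 + (p t)\<^sup>2 + (q t)\<^sup>2)"
  define \<gamma>2 where "\<gamma>2 = (\<lambda>t. p'' t + (3/10) * p' t + (\<Lambda>2 + 4 * N t) * p t)"
  define \<gamma>3 where "\<gamma>3 = (\<lambda>t. q'' t + (3/10) * q' t + (\<Lambda>3 + 9 * N t) * q t)"
  \<comment> \<open>The force in the first mode is zero by \<open>ode\<close>, whichever sign \<open>d\<close> has.\<close>
  define g where "g = (\<lambda>t. comb 0 (\<gamma>2 t) (\<gamma>3 t))"
  have D: "\<And>t. (p has_real_derivative p' t) (at t)" "\<And>t. (p' has_real_derivative p'' t) (at t)"
      "\<And>t. (q has_real_derivative q' t) (at t)" "\<And>t. (q' has_real_derivative q'' t) (at t)"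
    using p q by (auto simp: has_derivs2_def)
  note ap1 = antiperiodic_deriv[of p, OF ap(2) D(1)] antiperiodic_deriv[of q, OF ap(3) D(3)]
  note ap2 = antiperiodic_deriv[of p', OF ap1(1) D(2)] antiperiodic_deriv[of q', OF ap1(2) D(4)]
  have \<gamma>ap: "\<gamma>2 (t + pi / 3) = - \<gamma>2 t" "\<gamma>3 (t + pi / 3) = - \<gamma>3 t" for t
    by (simp_all add: \<gamma>2_def \<gamma>3_def N_def ap ap1 ap2)
  have g0: "C0_L2 l g"
    unfolding C0_L2_def g_def
  proof (intro conjI allI comb_L2 comb_cont_wrt(1))
    note c = has_derivs2_continuous[OF d] has_derivs2_continuous[OF p] has_derivs2_continuous[OF q]
    show "continuous_on UNIV \<gamma>2" "continuous_on UNIV \<gamma>3"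
      unfolding \<gamma>2_def \<gamma>3_def N_def by (intro continuous_intros c)+
  qed auto
  have d': "has_derivs2 (\<lambda>t. - d t) (\<lambda>t. - d' t) (\<lambda>t. - d'' t)"
    using has_derivs2_mult[OF has_derivs2_const[of "-1"] d] by simp
  have u1: "weak_solution l (3/10) 0 1 g (\<lambda>t. comb (d t) (p t) (q t))"
  proof (rule comb_weak_solution[OF d p q])
    fix t
    show "g t = comb (d'' t + (3/10) * d' t + (\<Lambda>1 + ((d t)\<^sup>2 + (p t)\<^sup>2 + (q t)\<^sup>2)) * d t)
      (p'' t + (3/10) * p' t + (\<Lambda>2 + 4 * ((d t)\<^sup>2 + (p t)\<^sup>2 + (q t)\<^sup>2)) * p t)
      (q'' t + (3/10) * q' t + (\<Lambda>3 + 9 * ((d t)\<^sup>2 + (p t)\<^sup>2 + (q t)\<^sup>2)) * q t)"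
      unfolding ode by (simp only: g_def \<gamma>2_def \<gamma>3_def N_def)
  qed
  have u2: "weak_solution l (3/10) 0 1 g (\<lambda>t. comb (- d t) (p t) (q t))"
  proof (rule comb_weak_solution[OF d' p q])
    fix t
    have "- d'' t + (3/10) * - d' t + (\<Lambda>1 + ((- d t)\<^sup>2 + (p t)\<^sup>2 + (q t)\<^sup>2)) * - d t = 0"
      using ode[of t] by simp
    then show "g t = comb (- d'' t + (3/10) * - d' t + (\<Lambda>1 + ((- d t)\<^sup>2 + (p t)\<^sup>2 + (q t)\<^sup>2)) * - d t)
      (p'' t + (3/10) * p' t + (\<Lambda>2 + 4 * ((- d t)\<^sup>2 + (p t)\<^sup>2 + (q t)\<^sup>2)) * p t)
      (q'' t + (3/10) * q' t + (\<Lambda>3 + 9 * ((- d t)\<^sup>2 + (p t)\<^sup>2 + (q t)\<^sup>2)) * q t)"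
      by (simp only: g_def \<gamma>2_def \<gamma>3_def N_def power2_minus)
  qed
  have "\<not> eqL2 l e1 (\<lambda>_. 0)"
    using eqL2_zero_iff[OF e_L2(1)] e1(2) by simp
  then have lambda1: "0 < lambda1 l"
    by (rule lambda1_pos[OF assms(1) e_H2star(1)])
  have gap: "antiperiodic l (pi / 3) g"
    unfolding g_def by (rule comb_antiperiodic) (simp_all add: \<gamma>ap)
  have uap: "antiperiodic l (pi / 3) (\<lambda>t. comb (d t) (p t) (q t))"
      "antiperiodic l (pi / 3) (\<lambda>t. comb (- d t) (p t) (q t))"
    by (rule comb_antiperiodic; simp add: ap)+
  have "\<not> eqL2 l (comb (d (pi / 6)) (p (pi / 6)) (q (pi / 6))) (comb (- d (pi / 6)) (p (pi / 6)) (q (pi / 6)))"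
    using nz by (intro comb_distinct) auto
  then have "\<exists>t. \<not> eqL2 l (comb (d t) (p t) (q t)) (comb (- d t) (p t) (q t))"
    by (rule exI)
  with u1 u2 uap have sols: "\<exists>u1 u2. weak_solution l (3/10) 0 1 g u1 \<and> antiperiodic l (pi / 3) u1 \<and>
      weak_solution l (3/10) 0 1 g u2 \<and> antiperiodic l (pi / 3) u2 \<and> (\<exists>t. \<not> eqL2 l (u1 t) (u2 t))"
    by (intro exI[of _ "\<lambda>t. comb (d t) (p t) (q t)"] exI[of _ "\<lambda>t. comb (- d t) (p t) (q t)"] conjI)
  show ?thesis
  proof (rule exI[of _ "pi / 3"], rule conjI, simp, rule exI[of _ g], intro conjI g0 gap,
      rule exI[of _ "3/10"], rule exI[of _ 0], rule exI[of _ 1], intro conjI lambda1 sols)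
  qed simp_all
qed

end
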